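(* Consider the multi-agent system composed of the followers $$\dot x_i=A_ix_i+B_iu_i+E_id_i,\qquad y_i=C_ix_i+D_iu_i,\qquad \dot d_i=S_id_i,\qquad i=1,\dots,N,$$ and the leader $\dot r=S_0r$, $y_0=F_0r$, with switching communication graph $\mathcal G_{\sigma(t)}$, as described in the context. Assume: (1) every graph $\mathcal G_p$, $p\in\mathcal P$, is connected; (2) for each $i=1,\dots,N$ there exist constant matrices $X_{i1},X_{i2},U_{i1},U_{i2}$ with $$X_{i1}S_i=A_iX_{i1}+B_iU_{i1}+E_i,\quad 0=C_iX_{i1}+D_iU_{i1},$$ $$X_{i2}S_0=A_iX_{i2}+B_iU_{i2},\quad 0=C_iX_{i2}+D_iU_{i2}-F_0;$$ (3) for each $i=1,\dots,N$ the pair $\left([C_i,\ \mathbf 0^{l\times q_i}],\begin{bmatrix}A_i&E_i\\ \mathbf 0^{q_i\times n_i}&S_i\end{bmatrix}\right)$ is detectable. Then the leader-following coordination problem can be solved by the control law $$\begin{aligned}\dot\xi_i&=A_i\xi_i+E_i\zeta_i+B_iu_i-L_{i1}(y_i-\hat y_i),\\ \dot\zeta_i&=S_i\zeta_i-L_{i2}(y_i-\hat y_i),\\ \dot\eta_i&=S_0\eta_i+L_0F_0\eta_{vi},\\ u_i&=K_{i1}\xi_i+K_{i2}\zeta_i+K_{i3}\eta_i,\qquad i=1,\dots,N,\end{aligned}$$ where $\hat y_i=C_i\xi_i+D_iu_i$, $\eta_{vi}=\sum_{j=0}^Na_{ij}(t)(\eta_i-\eta_j)$, $\eta_0=r$.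 That is, gain matrices meeting the following design conditions exist, and with gains so chosen, for all initial conditions of the closed-loop system, $\lim_{t\to+\infty}(y_i(t)-y_0(t))=0$ for $i=1,\dots,N$. The design conditions are: $K_{i1}$ is such that $A_i+B_iK_{i1}$ is Hurwitz; $K_{i2}=U_{i1}-K_{i1}X_{i1}$; $K_{i3}=U_{i2}-K_{i1}X_{i2}$; $L_{i1},L_{i2}$ are constant matrices such that $\begin{bmatrix}A_i+L_{i1}C_i&E_i\\ L_{i2}C_i&S_i\end{bmatrix}$ is Hurwitz; and $L_0=-\mu^*P^{-1}F_0^T$ with $P$ and $\mu^*$ as specified in the context.
   Context: Agents. There are $N$ followers and one leader (agent $0$). For $i=1,\dots,N$: $x_i\in\mathbb R^{n_i}$ is the state, $y_i\in\mathbb R^l$ the output, $u_i\in\mathbb R^{m_i}$ the input, $d_i\in\mathbb R^{q_i}$ the local disturbance; $r\in\mathbb R^{n_0}$ and $y_0\in\mathbb R^l$ are the leader's state and output. All of $A_i,B_i,C_i,D_i,E_i,S_i,S_0,F_0$ are constant real matrices of compatible sizes. Standing assumptions: $(F_0,S_0)$ is detectable (output matrix listed first); $S_0,\dots,S_N$ have no eigenvalues in the open left half plane; $(A_i,B_i)$ is stabilizable for each $i=1,\dots,N$. Graphs. There are finitely many weighted digraphs $\mathcal G_1,\dots,\mathcal G_\kappa$ on the node set $\{0,1,\dots,N\}$; let $\mathcal P=\{1,\dots,\kappa\}$. Each has constant weights $a_{ij}\ge 0$, $a_{ii}=0$, with $a_{ij}>0$ if and only if there is an edge from $j$ to $i$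 (agent $i$ receives information from agent $j$), and $a_{0i}=0$ for $i=1,\dots,N$. A graph is called connected if there is a directed path from node $0$ to every node $1,\dots,N$ and the subgraph induced on $\{1,\dots,N\}$ is undirected ($a_{ij}=a_{ji}$ for $i,j=1,\dots,N$). The Laplacian $L=[l_{ij}]$ is $l_{ii}=\sum_{j\ne i}a_{ij}$, $l_{ij}=-a_{ij}$ for $j\neq i$; $H_p\in\mathbb R^{N\times N}$ is the Laplacian of $\mathcal G_p$ with the row and column of node $0$ deleted. It is positive definite when $\mathcal G_p$ is connected. Switching. $\sigma:[0,\infty)\to\mathcal P$ is piecewise constant, with switching instants $t_0=0<t_1<t_2<\cdots$ (an infinite sequence of bounded contiguous intervals $[t_k,t_{k+1})$ on each of which $\sigma$ is constant), and $t_{k+1}-t_k\ge\tau_0>0$ for all $k$. $a_{ij}(t)$ denotes the weight $a_{ij}$ of $\mathcal G_{\sigma(t)}$. Choice of $L_0$. $P$ is a symmetric positive definite matrix with $PS_0+S_0^TP-2F_0^TF_0<0$ (it exists by detectability of $(F_0,S_0)$), $\bar\lambda>0$ is the minimum of the eigenvalues of all $H_p$, $p\in\mathcal P$, and $\mu^*=\max\{1/\bar\lambda,1\}$. The leader-following coordination problem: find a distributed control law such that for all initial conditions of the closed-loop system, $e_i(t)=y_i(t)-y_0(t)\to 0$ as $t\to+\infty$ for $i=1,\dots,N$. *)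

theory Defs
  imports
    Complex_Main
    "Jordan_Normal_Form.Determinant"
    "Jordan_Normal_Form.Gauss_Jordan_Elimination"
    "Jordan_Normal_Form.Spectral_Radius"
begin

abbreviation cmat :: "real mat \<Rightarrow> complex mat" where
  "cmat \<equiv> map_mat complex_of_real"

definition hurwitz :: "real mat \<Rightarrow> bool" where
  "hurwitz A \<longleftrightarrow> square_mat A \<and> (\<forall>z \<in> spectrum (cmat A). Re z < 0)"

definition stabilizable :: "real mat \<Rightarrow> real mat \<Rightarrow> bool" where
  "stabilizable A B \<longleftrightarrow>
     (\<exists>K \<in> carrier_mat (dim_col B) (dim_row A). hurwitz (A + B * K))"

text \<open>The output matrix is the first argument.\<close>

definition detectable :: "real mat \<Rightarrow> real mat \<Rightarrow> bool" where
  "detectable C A \<longleftrightarrow>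
     (\<exists>L \<in> carrier_mat (dim_row A) (dim_row C). hurwitz (A + L * C))"

definition sym_pos_def :: "real mat \<Rightarrow> bool" where
  "sym_pos_def M \<longleftrightarrow> square_mat M \<and> transpose_mat M = M \<and>
     (\<forall>v \<in> carrier_vec (dim_row M). v \<noteq> 0\<^sub>v (dim_row M) \<longrightarrow> v \<bullet> (M *\<^sub>v v) > 0)"

text \<open>A weighted digraph on \<open>{0..N}\<close> is given by its weights: \<open>a i j > 0\<close> means that there is an
  edge from \<open>j\<close> to \<open>i\<close>.\<close>

definition comm_graph :: "nat \<Rightarrow> (nat \<Rightarrow> nat \<Rightarrow> real) \<Rightarrow> bool" where
  "comm_graph N a \<longleftrightarrow>
     (\<forall>i \<in> {0..N}. \<forall>j \<in> {0..N}. a i j \<ge> 0) \<and>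
     (\<forall>i \<in> {0..N}. a i i = 0) \<and>
     (\<forall>i \<in> {1..N}. a 0 i = 0)"

definition graph_edges :: "nat \<Rightarrow> (nat \<Rightarrow> nat \<Rightarrow> real) \<Rightarrow> (nat \<times> nat) set" where
  "graph_edges N a = {(j, i). j \<in> {0..N} \<and> i \<in> {0..N} \<and> a i j > 0}"

definition graph_connected :: "nat \<Rightarrow> (nat \<Rightarrow> nat \<Rightarrow> real) \<Rightarrow> bool" where
  "graph_connected N a \<longleftrightarrow>
     (\<forall>i \<in> {1..N}. (0, i) \<in> (graph_edges N a)\<^sup>*) \<and>
     (\<forall>i \<in> {1..N}. \<forall>j \<in> {1..N}. a i j = a j i)"

definition laplacian :: "nat \<Rightarrow> (nat \<Rightarrow> nat \<Rightarrow> real) \<Rightarrow> real mat" where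
  "laplacian N a = mat (N + 1) (N + 1)
     (\<lambda>(i, j). if i = j then \<Sum>k \<in> {0..N} - {i}. a i k else - a i j)"

definition grounded_laplacian :: "nat \<Rightarrow> (nat \<Rightarrow> nat \<Rightarrow> real) \<Rightarrow> real mat" where
  "grounded_laplacian N a = mat_delete (laplacian N a) 0 0"

text \<open>The grounded Laplacians of connected graphs are symmetric, so the real spectra used here
  contain all their eigenvalues.\<close>

definition lambda_bar :: "nat \<Rightarrow> nat \<Rightarrow> (nat \<Rightarrow> nat \<Rightarrow> nat \<Rightarrow> real) \<Rightarrow> real" where
  "lambda_bar N \<kappa> a = Min (\<Union>p \<in> {1..\<kappa>}. spectrum (grounded_laplacian N (a p)))"

definition mu_star :: "nat \<Rightarrow> nat \<Rightarrow> (nat \<Rightarrow> nat \<Rightarrow> nat \<Rightarrow> real) \<Rightarrow> real" where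
  "mu_star N \<kappa> a = max (1 / lambda_bar N \<kappa> a) 1"

definition switching_signal ::
  "nat \<Rightarrow> real \<Rightarrow> (nat \<Rightarrow> real) \<Rightarrow> (real \<Rightarrow> nat) \<Rightarrow> bool" where
  "switching_signal \<kappa> \<tau>\<^sub>0 t \<sigma> \<longleftrightarrow>
     \<tau>\<^sub>0 > 0 \<and> t 0 = 0 \<and> (\<forall>k. t (Suc k) - t k \<ge> \<tau>\<^sub>0) \<and>
     (\<forall>s \<ge> 0. \<sigma> s \<in> {1..\<kappa>}) \<and>
     (\<forall>k. \<forall>s \<in> {t k..<t (Suc k)}. \<sigma> s = \<sigma> (t k))"

text \<open>\<open>z\<close> is a solution of \<open>z' = f\<close> on \<open>[0, \<infinity>)\<close> in the sense usual for piecewise constant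
  switching: continuous everywhere, and differentiable away from the switching instants.\<close>

definition switched_solution ::
  "nat \<Rightarrow> (nat \<Rightarrow> real) \<Rightarrow> (real \<Rightarrow> real vec) \<Rightarrow> (real \<Rightarrow> real vec) \<Rightarrow> bool" where
  "switched_solution n t z f \<longleftrightarrow>
     (\<forall>s \<ge> 0. z s \<in> carrier_vec n) \<and>
     (\<forall>k < n. continuous_on {0..} (\<lambda>s. z s $ k)) \<and>
     (\<forall>s \<ge> 0. s \<notin> range t \<longrightarrow>
        (\<forall>k < n. ((\<lambda>s'. z s' $ k) has_real_derivative f s $ k) (at s)))"

text \<open>All matrices here belong to one follower; \<open>n\<close>, \<open>m\<close>, \<open>q\<close> are the dimensions of its state,
  input and disturbance, and \<open>n\<^sub>0\<close> and \<open>l\<close> those of the leader's state and of the outputs.\<close>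

definition regulator_equations ::
  "nat \<Rightarrow> nat \<Rightarrow> nat \<Rightarrow> nat \<Rightarrow> nat \<Rightarrow> real mat \<Rightarrow> real mat \<Rightarrow> real mat \<Rightarrow> real mat \<Rightarrow> real mat
   \<Rightarrow> real mat \<Rightarrow> real mat \<Rightarrow> real mat
   \<Rightarrow> real mat \<Rightarrow> real mat \<Rightarrow> real mat \<Rightarrow> real mat \<Rightarrow> bool" where
  "regulator_equations n m q n\<^sub>0 l A B C D E S S\<^sub>0 F\<^sub>0 X\<^sub>1 X\<^sub>2 U\<^sub>1 U\<^sub>2 \<longleftrightarrow>
     X\<^sub>1 \<in> carrier_mat n q \<and> U\<^sub>1 \<in> carrier_mat m q \<and>
     X\<^sub>2 \<in> carrier_mat n n\<^sub>0 \<and> U\<^sub>2 \<in> carrier_mat m n\<^sub>0 \<and>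
     X\<^sub>1 * S = A * X\<^sub>1 + B * U\<^sub>1 + E \<and> 0\<^sub>m l q = C * X\<^sub>1 + D * U\<^sub>1 \<and>
     X\<^sub>2 * S\<^sub>0 = A * X\<^sub>2 + B * U\<^sub>2 \<and> 0\<^sub>m l n\<^sub>0 = C * X\<^sub>2 + D * U\<^sub>2 - F\<^sub>0"

definition follower_gains ::
  "nat \<Rightarrow> nat \<Rightarrow> nat \<Rightarrow> nat \<Rightarrow> real mat \<Rightarrow> real mat \<Rightarrow> real mat \<Rightarrow> real mat \<Rightarrow> real mat
   \<Rightarrow> real mat \<Rightarrow> real mat \<Rightarrow> real mat \<Rightarrow> real mat
   \<Rightarrow> real mat \<Rightarrow> real mat \<Rightarrow> real mat \<Rightarrow> real mat \<Rightarrow> real mat \<Rightarrow> bool" where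
  "follower_gains n m q l A B C E S X\<^sub>1 X\<^sub>2 U\<^sub>1 U\<^sub>2 K\<^sub>1 K\<^sub>2 K\<^sub>3 L\<^sub>1 L\<^sub>2 \<longleftrightarrow>
     K\<^sub>1 \<in> carrier_mat m n \<and> hurwitz (A + B * K\<^sub>1) \<and>
     K\<^sub>2 = U\<^sub>1 - K\<^sub>1 * X\<^sub>1 \<and>
     K\<^sub>3 = U\<^sub>2 - K\<^sub>1 * X\<^sub>2 \<and>
     L\<^sub>1 \<in> carrier_mat n l \<and> L\<^sub>2 \<in> carrier_mat q l \<and>
     hurwitz (four_block_mat (A + L\<^sub>1 * C) E (L\<^sub>2 * C) S)"

text \<open>\<open>P S\<^sub>0 + S\<^sub>0\<^sup>T P - 2 F\<^sub>0\<^sup>T F\<^sub>0 < 0\<close> is expressed as positive definiteness of the negated matrix.\<close>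

definition observer_gain ::
  "nat \<Rightarrow> real mat \<Rightarrow> real mat \<Rightarrow> real \<Rightarrow> real mat \<Rightarrow> real mat \<Rightarrow> bool" where
  "observer_gain n\<^sub>0 S\<^sub>0 F\<^sub>0 \<mu> P L\<^sub>0 \<longleftrightarrow>
     P \<in> carrier_mat n\<^sub>0 n\<^sub>0 \<and> sym_pos_def P \<and>
     sym_pos_def (- (P * S\<^sub>0 + transpose_mat S\<^sub>0 * P - 2 \<cdot>\<^sub>m (transpose_mat F\<^sub>0 * F\<^sub>0))) \<and>
     L\<^sub>0 = (- \<mu>) \<cdot>\<^sub>m (the (mat_inverse P) * transpose_mat F\<^sub>0)"

end

theory Submission
  imports Defs
begin

text \<open>Put \<open>e\<^sub>i = \<eta>\<^sub>i - r\<close>. Along the switched system the derivative of the common Lyapunov function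
  \<open>V = \<Sum>\<^sub>i e\<^sub>i \<bullet> P e\<^sub>i\<close> is \<open>\<Sum>\<^sub>i 2 e\<^sub>i \<bullet> P S\<^sub>0 e\<^sub>i\<close> minus \<open>2 \<mu>\<close> times the quadratic form of the grounded
  Laplacian at \<open>F\<^sub>0 e\<close>. All its eigenvalues are at least \<open>\<lambda>\<close> and \<open>\<mu> \<lambda> \<ge> 1\<close>, so for every active graph the
  derivative is at most \<open>\<Sum>\<^sub>i e\<^sub>i \<bullet> (P S\<^sub>0 + S\<^sub>0\<^sup>T P - 2 F\<^sub>0\<^sup>T F\<^sub>0) e\<^sub>i \<le> - c V\<close>, and \<open>e\<^sub>i\<close> vanishes. The local
  estimation errors \<open>\<xi>\<^sub>i - x\<^sub>i\<close>, \<open>\<zeta>\<^sub>i - d\<^sub>i\<close> obey an autonomous Hurwitz system. Hence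
  \<open>z\<^sub>i = x\<^sub>i - X\<^sub>i\<^sub>1 d\<^sub>i - X\<^sub>i\<^sub>2 r\<close> solves \<open>z' = (A\<^sub>i + B\<^sub>i K\<^sub>i\<^sub>1) z + B\<^sub>i g\<close> with vanishing \<open>g\<close>, and the output error is a
  linear image of \<open>z\<^sub>i\<close> and \<open>g\<close>. Every Hurwitz matrix has a quadratic Lyapunov function, obtained from
  a triangularization over the complex numbers; it gives the decay, and applied to \<open>S\<^sub>0 + L F\<^sub>0\<close> it
  also gives the matrix \<open>P\<close>.\<close>

section \<open>Real quadratic forms\<close>

text \<open>Switching is arbitrary apart from a dwell time that may be very short, so stability
  under each frozen graph would not suffice: one function and one decay rate must serve all graphs.
  This is why \<open>lambda_bar\<close> is a minimum over all graphs. The dwell time enters as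
  finiteness of the switching instants in bounded time; across them continuity carries the
  monotonicity of the Lyapunov function. The leader and the disturbances need not decay, so no
  signal is estimated by itself. Decay is shown for differences, and the formulas for
  \<open>K\<^sub>2\<close> and \<open>K\<^sub>3\<close> are exactly what turns the closed loop into
  a system driven by differences. Positive definiteness is a pointwise statement, whereas a decay
  rate needs a uniform constant. The constant is obtained algebraically, without compactness of the
  sphere: a symmetric semidefinite injective matrix is coercive. The same fact shows that the best
  lower bound of a symmetric form is an eigenvalue, which links \<open>lambda_bar\<close>, defined
  through spectra, to the quadratic forms that occur in the derivative.\<close>

lemma scalar_prod_self_nonneg: "(v :: real vec) \<bullet> v \<ge> 0"
  by (auto simp: scalar_prod_def intro!: sum_nonneg)

lemma component_square_le:
  fixes v :: "real vec"
  assumes "k < dim_vec v"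
  shows "(v $ k)\<^sup>2 \<le> v \<bullet> v"
proof -
  have "v $ k * v $ k \<le> (\<Sum>i \<in> {0..<dim_vec v}. v $ i * v $ i)"
    by (rule member_le_sum) (use assms in auto)
  then show ?thesis by (simp add: scalar_prod_def power2_eq_square)
qed

lemma scalar_prod_self_pos:
  fixes v :: "real vec"
  assumes "v \<in> carrier_vec n" "v \<noteq> 0\<^sub>v n"
  shows "v \<bullet> v > 0"
proof -
  obtain k where k: "k < n" "v $ k \<noteq> 0"
    using assms by (metis carrier_vecD eq_vecI index_zero_vec(1) index_zero_vec(2))
  then have "0 < (v $ k)\<^sup>2" by simp
  also have "\<dots> \<le> v \<bullet> v" using component_square_le[of k v] k assms by simp
  finally show ?thesis .
qed

lemma young_inequality:
  fixes u v w \<epsilon> :: real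
  assumes "\<epsilon> > 0"
  shows "u * w \<le> \<epsilon> * u\<^sup>2 + w\<^sup>2 / (4 * \<epsilon>)"
proof -
  have "0 \<le> (2 * \<epsilon> * u - w)\<^sup>2 / (4 * \<epsilon>)" using assms by simp
  also have "\<dots> = \<epsilon> * u\<^sup>2 - u * w + w\<^sup>2 / (4 * \<epsilon>)"
    using assms by (simp add: power2_eq_square field_simps)
  finally show ?thesis by simp
qed

lemma scalar_prod_mat_vec:
  fixes M :: "'a :: comm_ring mat"
  assumes "M \<in> carrier_mat nr nc" "u \<in> carrier_vec nr" "v \<in> carrier_vec nc"
  shows "u \<bullet> (M *\<^sub>v v) = (\<Sum>i<nr. \<Sum>j<nc. u $ i * M $$ (i, j) * v $ j)"
  using assms by (auto simp: scalar_prod_def sum_distrib_left mult.assoc lessThan_atLeast0 intro!: sum.cong)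

text \<open>Replaces an operator norm by Young's inequality on each entry. The weight \<epsilon> of
  \<open>u\<close> is free, so a cross term can be hidden in an available dissipation at the price
  of a large \<open>K\<close> on \<open>v\<close>.\<close>

lemma bilinear_bound:
  fixes M :: "real mat"
  assumes M: "M \<in> carrier_mat nr nc" and \<epsilon>: "\<epsilon> > 0"
  obtains K where "K > 0"
    "\<And>u v. u \<in> carrier_vec nr \<Longrightarrow> v \<in> carrier_vec nc \<Longrightarrow> u \<bullet> (M *\<^sub>v v) \<le> \<epsilon> * (u \<bullet> u) + K * (v \<bullet> v)"
proof
  \<comment> \<open>Each square of an entry of \<open>u\<close> occurs \<open>nc\<close> times in
    the double sum. The added 1 keeps \<delta> positive when \<open>nc = 0\<close>; the one in
    \<open>K\<close> serves the same end for a zero matrix.\<close>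
  define \<delta> where "\<delta> = \<epsilon> / (real nc + 1)"
  have \<delta>: "\<delta> > 0" using \<epsilon> by (simp add: \<delta>_def)
  define K where "K = (\<Sum>i<nr. \<Sum>j<nc. (M $$ (i, j))\<^sup>2 / (4 * \<delta>)) + 1"
  have K0: "(\<Sum>i<nr. \<Sum>j<nc. (M $$ (i, j))\<^sup>2 / (4 * \<delta>)) \<ge> 0"
    using \<delta> by (intro sum_nonneg) auto
  then show "K > 0" by (simp add: K_def)
  fix u v :: "real vec" assume u: "u \<in> carrier_vec nr" and v: "v \<in> carrier_vec nc"
  have "u \<bullet> (M *\<^sub>v v) = (\<Sum>i<nr. \<Sum>j<nc. u $ i * (M $$ (i, j) * v $ j))"
    by (simp add: scalar_prod_mat_vec[OF M u v] mult.assoc)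
  also have "\<dots> \<le> (\<Sum>i<nr. \<Sum>j<nc. \<delta> * (u $ i)\<^sup>2 + (M $$ (i, j))\<^sup>2 / (4 * \<delta>) * (v \<bullet> v))"
  proof (intro sum_mono)
    fix i j assume j: "j \<in> {..<nc}"
    have "u $ i * (M $$ (i, j) * v $ j) \<le> \<delta> * (u $ i)\<^sup>2 + (M $$ (i, j) * v $ j)\<^sup>2 / (4 * \<delta>)"
      by (rule young_inequality[OF \<delta>])
    also have "(M $$ (i, j) * v $ j)\<^sup>2 / (4 * \<delta>) \<le> (M $$ (i, j))\<^sup>2 / (4 * \<delta>) * (v \<bullet> v)"
      using component_square_le[of j v] v j \<delta>
      by (auto simp: power_mult_distrib divide_right_mono mult_left_mono)
    finally show "u $ i * (M $$ (i, j) * v $ j)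
        \<le> \<delta> * (u $ i)\<^sup>2 + (M $$ (i, j))\<^sup>2 / (4 * \<delta>) * (v \<bullet> v)" by simp
  qed
  also have "\<dots> = \<delta> * nc * (u \<bullet> u) + (K - 1) * (v \<bullet> v)"
    using u by (simp add: sum.distrib K_def sum_distrib_right sum_distrib_left scalar_prod_def
        lessThan_atLeast0 power2_eq_square mult_ac)
  also have "\<dots> \<le> \<epsilon> * (u \<bullet> u) + K * (v \<bullet> v)"
    using \<epsilon> scalar_prod_self_nonneg[of u] scalar_prod_self_nonneg[of v]
    by (intro add_mono mult_right_mono) (auto simp: \<delta>_def field_simps)
  finally show "u \<bullet> (M *\<^sub>v v) \<le> \<epsilon> * (u \<bullet> u) + K * (v \<bullet> v)" .
qed

text \<open>Putting \<open>u = M v\<close> into the bilinear bound with weight 1/2 lets half of the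
  left side be subtracted.\<close>

lemma mult_mat_vec_bound:
  fixes M :: "real mat"
  assumes M: "M \<in> carrier_mat nr nc"
  obtains K where "K > 0"
    "\<And>v. v \<in> carrier_vec nc \<Longrightarrow> (M *\<^sub>v v) \<bullet> (M *\<^sub>v v) \<le> K * (v \<bullet> v)"
proof -
  from bilinear_bound[OF M, of "1/2"] obtain K where K: "K > 0"
    "\<And>u v. u \<in> carrier_vec nr \<Longrightarrow> v \<in> carrier_vec nc \<Longrightarrow> u \<bullet> (M *\<^sub>v v) \<le> 1/2 * (u \<bullet> u) + K * (v \<bullet> v)"
    by auto
  show ?thesis
  proof (rule that[of "2 * K"])
    show "2 * K > 0" using K by simp
    fix v :: "real vec" assume v: "v \<in> carrier_vec nc"
    from K(2)[OF mult_mat_vec_carrier[OF M v] v]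
    show "(M *\<^sub>v v) \<bullet> (M *\<^sub>v v) \<le> 2 * K * (v \<bullet> v)" by simp
  qed
qed

lemma symmetric_scalar_prod:
  fixes M :: "'a :: comm_ring_1 mat"
  assumes M: "M \<in> carrier_mat n n" "transpose_mat M = M"
    and u: "u \<in> carrier_vec n" and v: "v \<in> carrier_vec n"
  shows "u \<bullet> (M *\<^sub>v v) = v \<bullet> (M *\<^sub>v u)"
proof -
  have "(transpose_mat M *\<^sub>v u) \<bullet> v = u \<bullet> (M *\<^sub>v v)" by (rule transpose_vec_mult_scalar[OF M(1) v u])
  then show ?thesis using M u v comm_scalar_prod[of "M *\<^sub>v u" n v] by auto
qed

text \<open>Injectivity gives a nonzero determinant. The inverse is produced as the value of
  \<open>mat_inverse\<close>, because the formula for \<open>L\<^sub>0\<close> in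
  \<open>observer_gain\<close> refers to that function.\<close>

lemma injective_mat_inverse:
  fixes M :: "'a :: field mat"
  assumes M: "M \<in> carrier_mat n n"
    and inj: "\<And>v. v \<in> carrier_vec n \<Longrightarrow> M *\<^sub>v v = 0\<^sub>v n \<Longrightarrow> v = 0\<^sub>v n"
  obtains B where "mat_inverse M = Some B" "M * B = 1\<^sub>m n" "B * M = 1\<^sub>m n" "B \<in> carrier_mat n n"
proof -
  have "det M \<noteq> 0" using det_0_iff_vec_prod_zero_field[OF M] inj by blast
  then have "M \<in> Units (ring_mat TYPE('a) n ())" by (rule det_non_zero_imp_unit[OF M])
  then obtain B where "mat_inverse M = Some B"
    using mat_inverse(1)[OF M, where b = "()"] by (cases "mat_inverse M") auto
  with mat_inverse(2)[OF M this] that show ?thesis by blast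
qed

text \<open>Testing semidefiniteness with \<open>v - s M v\<close> for a small \<open>s\<close> bounds \<open>v \<bullet> M v\<close> below by a
  multiple of \<open>|M v|\<^sup>2\<close>.\<close>

lemma semidefinite_injective_coercive:
  fixes M :: "real mat"
  assumes M: "M \<in> carrier_mat n n" "transpose_mat M = M"
    and psd: "\<And>v. v \<in> carrier_vec n \<Longrightarrow> v \<bullet> (M *\<^sub>v v) \<ge> 0"
    and inj: "\<And>v. v \<in> carrier_vec n \<Longrightarrow> M *\<^sub>v v = 0\<^sub>v n \<Longrightarrow> v = 0\<^sub>v n"
  obtains c where "c > 0" "\<And>v. v \<in> carrier_vec n \<Longrightarrow> v \<bullet> (M *\<^sub>v v) \<ge> c * (v \<bullet> v)"
proof -
  from bilinear_bound[OF M(1), of 1] obtain K0 where K0: "K0 > 0"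
    "\<And>u v. u \<in> carrier_vec n \<Longrightarrow> v \<in> carrier_vec n \<Longrightarrow> u \<bullet> (M *\<^sub>v v) \<le> 1 * (u \<bullet> u) + K0 * (v \<bullet> v)"
    by auto
  define K where "K = 1 + K0"
  have K: "K > 0" "\<And>u. u \<in> carrier_vec n \<Longrightarrow> u \<bullet> (M *\<^sub>v u) \<le> K * (u \<bullet> u)"
    using K0(1) K0(2) by (fastforce simp: K_def algebra_simps)+
  obtain B where B: "B * M = 1\<^sub>m n" "B \<in> carrier_mat n n"
    by (rule injective_mat_inverse[OF M(1) inj]) auto
  obtain K' where K': "K' > 0"
    "\<And>v. v \<in> carrier_vec n \<Longrightarrow> (B *\<^sub>v v) \<bullet> (B *\<^sub>v v) \<le> K' * (v \<bullet> v)"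
    by (rule mult_mat_vec_bound[OF B(2)]) blast
  show ?thesis
  proof (rule that[of "1 / (K * K')"])
    show "1 / (K * K') > 0" using K K' by simp
    fix v :: "real vec" assume v: "v \<in> carrier_vec n"
    define w where "w = M *\<^sub>v v"
    have w: "w \<in> carrier_vec n" unfolding w_def using M v by simp
    \<comment> \<open>This \<open>s\<close> minimizes \<open>v \<bullet> w - 2 * s * (w \<bullet> w)
      + s\<^sup>2 * K * (w \<bullet> w)\<close>, the upper bound for the form at \<open>u\<close>.
      Its nonnegativity then yields \<open>v \<bullet> w \<ge> w \<bullet> w / K\<close>, and the
      inverse \<open>B\<close> converts \<open>w \<bullet> w\<close> back into
      \<open>v \<bullet> v\<close>.\<close>
    define s where "s = 1 / K"
    define u where "u = v - s \<cdot>\<^sub>v w"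
    have u: "u \<in> carrier_vec n" unfolding u_def using v w by simp
    have Mw: "M *\<^sub>v w \<in> carrier_vec n" using M w by simp
    have Mu: "M *\<^sub>v u = w - s \<cdot>\<^sub>v (M *\<^sub>v w)"
      unfolding u_def using mult_minus_distrib_mat_vec[OF M(1) v, of "s \<cdot>\<^sub>v w"] mult_mat_vec[OF M(1) w] w
      by (simp add: w_def)
    have vMw: "v \<bullet> (M *\<^sub>v w) = w \<bullet> w"
      using symmetric_scalar_prod[OF M v w] by (simp add: w_def)
    have "0 \<le> u \<bullet> (M *\<^sub>v u)" by (rule psd[OF u])
    also have "\<dots> = v \<bullet> w - 2 * s * (w \<bullet> w) + s\<^sup>2 * (w \<bullet> (M *\<^sub>v w))"
      unfolding Mu unfolding u_def using v w Mw vMw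
      by (simp add: scalar_prod_minus_distrib[of _ n] minus_scalar_prod_distrib[of _ n]
          smult_scalar_prod_distrib[of _ n] scalar_prod_smult_distrib[of _ n] algebra_simps power2_eq_square)
    also have "s\<^sup>2 * (w \<bullet> (M *\<^sub>v w)) \<le> s\<^sup>2 * (K * (w \<bullet> w))"
      by (intro mult_left_mono K w) simp
    also have "\<dots> = s * (w \<bullet> w)" using K by (simp add: s_def power2_eq_square)
    finally have 1: "v \<bullet> w \<ge> w \<bullet> w / K" by (simp add: s_def)
    have "B *\<^sub>v w = v" unfolding w_def using assoc_mult_mat_vec[OF B(2) M(1) v] B v by simp
    with K'(2)[OF w] have "v \<bullet> v \<le> K' * (w \<bullet> w)" by simp
    then have "1 / (K * K') * (v \<bullet> v) \<le> w \<bullet> w / K" using K K' by (simp add: field_simps)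
    with 1 show "1 / (K * K') * (v \<bullet> v) \<le> v \<bullet> (M *\<^sub>v v)" by (simp add: w_def)
  qed
qed

lemma sym_pos_def_injective:
  assumes "sym_pos_def M" "M \<in> carrier_mat n n" "v \<in> carrier_vec n" "M *\<^sub>v v = 0\<^sub>v n"
  shows "v = 0\<^sub>v n"
  using assms unfolding sym_pos_def_def by (metis carrier_matD(1) less_irrefl scalar_prod_right_zero)

text \<open>Positivity on nonzero vectors implies both semidefiniteness and injectivity, so the
  uniform constant needs no compactness of the unit sphere.\<close>

lemma sym_pos_def_coercive:
  assumes M: "sym_pos_def M" "M \<in> carrier_mat n n"
  obtains c where "c > 0" "\<And>v. v \<in> carrier_vec n \<Longrightarrow> v \<bullet> (M *\<^sub>v v) \<ge> c * (v \<bullet> v)"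
proof (rule semidefinite_injective_coercive[OF M(2)])
  show "transpose_mat M = M" using M by (simp add: sym_pos_def_def)
  fix v :: "real vec" assume v: "v \<in> carrier_vec n"
  show "v \<bullet> (M *\<^sub>v v) \<ge> 0"
    using M v unfolding sym_pos_def_def
    by (cases "v = 0\<^sub>v n") (auto intro: less_imp_le)
  show "M *\<^sub>v v = 0\<^sub>v n \<Longrightarrow> v = 0\<^sub>v n" by (rule sym_pos_def_injective[OF M v])
qed blast

text \<open>The largest \<open>\<mu>\<close> with \<open>v \<bullet> H v \<ge> \<mu> |v|\<^sup>2\<close> is an eigenvalue: otherwise \<open>H - \<mu>\<close> would be
  semidefinite and injective, hence coercive, and \<open>\<mu>\<close> could be increased.\<close>

lemma symmetric_least_eigenvalue:
  fixes H :: "real mat"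
  assumes H: "H \<in> carrier_mat n n" "transpose_mat H = H" and n: "n > 0"
  obtains \<mu> where "\<mu> \<in> spectrum H"
    "\<And>v. v \<in> carrier_vec n \<Longrightarrow> v \<bullet> (H *\<^sub>v v) \<ge> \<mu> * (v \<bullet> v)"
proof -
  define R where "R = {s. \<forall>v \<in> carrier_vec n. v \<bullet> (H *\<^sub>v v) \<ge> s * (v \<bullet> v)}"
  have uH: "- H \<in> carrier_mat n n" using H by simp
  obtain K where K:
    "\<And>u v. u \<in> carrier_vec n \<Longrightarrow> v \<in> carrier_vec n \<Longrightarrow> u \<bullet> (- H *\<^sub>v v) \<le> 1 * (u \<bullet> u) + K * (v \<bullet> v)"
    by (rule bilinear_bound[OF uH, of 1]) (simp, blast)
  have "- (1 + K) \<in> R"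
    unfolding R_def
  proof (clarify)
    fix v :: "real vec" assume v: "v \<in> carrier_vec n"
    have "v \<bullet> (- H *\<^sub>v v) = - (v \<bullet> (H *\<^sub>v v))" using H v by simp
    with K[OF v v] show "- (1 + K) * (v \<bullet> v) \<le> v \<bullet> (H *\<^sub>v v)" by (simp add: algebra_simps)
  qed
  then have ne: "R \<noteq> {}" by auto
  \<comment> \<open>Evaluating at a unit vector bounds \<open>R\<close> from above; such a vector
    exists because \<open>n > 0\<close>.\<close>
  define e :: "real vec" where "e = unit_vec n 0"
  have e: "e \<in> carrier_vec n" "e \<bullet> e = (1 :: real)"
    using n by (simp_all add: e_def)
  have bdd: "bdd_above R"
    by (rule bdd_aboveI[of _ "e \<bullet> (H *\<^sub>v e)"]) (use e in \<open>auto simp: R_def\<close>)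
  define \<mu> where "\<mu> = Sup R"
  have ray: "v \<bullet> (H *\<^sub>v v) \<ge> \<mu> * (v \<bullet> v)" if v: "v \<in> carrier_vec n" for v
  proof (cases "v = 0\<^sub>v n")
    case True
    then show ?thesis using H by simp
  next
    case False
    then have p: "v \<bullet> v > 0" using v scalar_prod_self_pos by blast
    have "\<mu> \<le> v \<bullet> (H *\<^sub>v v) / (v \<bullet> v)"
      unfolding \<mu>_def using ne p v by (intro cSup_least) (auto simp: R_def field_simps)
    then show ?thesis using p by (simp add: field_simps)
  qed
  have "\<mu> \<in> spectrum H"
  proof (rule ccontr)
    assume neg: "\<mu> \<notin> spectrum H"
    define M where "M = H - \<mu> \<cdot>\<^sub>m 1\<^sub>m n"
    have M: "M \<in> carrier_mat n n" unfolding M_def by (intro minus_carrier_mat smult_carrier_mat one_carrier_mat)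
    have MT: "transpose_mat M = M"
      unfolding M_def using H(1)
      by (intro eq_matI) (auto, metis H index_transpose_mat(1) carrier_matD)
    have Mv: "M *\<^sub>v v = H *\<^sub>v v - \<mu> \<cdot>\<^sub>v v" if v: "v \<in> carrier_vec n" for v
      unfolding M_def using H v by (auto simp: minus_mult_distrib_mat_vec[of _ n n])
    have vMv: "v \<bullet> (M *\<^sub>v v) = v \<bullet> (H *\<^sub>v v) - \<mu> * (v \<bullet> v)" if v: "v \<in> carrier_vec n" for v
      unfolding Mv[OF v] using H v by (simp add: scalar_prod_minus_distrib[of _ n])
    obtain c where c: "c > 0" "\<And>v. v \<in> carrier_vec n \<Longrightarrow> v \<bullet> (M *\<^sub>v v) \<ge> c * (v \<bullet> v)"
    proof (rule semidefinite_injective_coercive[OF M MT])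
      fix v :: "real vec" assume v: "v \<in> carrier_vec n"
      show "0 \<le> v \<bullet> (M *\<^sub>v v)" using ray[OF v] by (simp add: vMv[OF v])
      assume "M *\<^sub>v v = 0\<^sub>v n"
      then have "H *\<^sub>v v - \<mu> \<cdot>\<^sub>v v = 0\<^sub>v n" by (simp add: Mv[OF v])
      then have "H *\<^sub>v v = \<mu> \<cdot>\<^sub>v v" using H v
        by (metis (no_types, lifting) carrier_vecD eq_vecI index_minus_vec(1) index_zero_vec(1)
            dim_mult_mat_vec carrier_matD(1) index_smult_vec(2) right_minus_eq)
      with neg v H show "v = 0\<^sub>v n"
        unfolding spectrum_def eigenvalue_def eigenvector_def by auto
    qed blast
    have "\<mu> + c \<in> R"
      unfolding R_def using c(2) by (auto simp: vMv algebra_simps)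
    then have "\<mu> + c \<le> \<mu>" unfolding \<mu>_def by (rule cSup_upper[OF _ bdd])
    with c(1) show False by simp
  qed
  with ray that show ?thesis by blast
qed

section \<open>Lyapunov functions of Hurwitz matrices\<close>

text \<open>The weights grow fast enough for the last diagonal entry to absorb all cross terms
  of the last column.\<close>

lemma triangular_weighted_dissipative:
  fixes T :: "nat \<Rightarrow> nat \<Rightarrow> complex"
  assumes "\<And>k. k < n \<Longrightarrow> Re (T k k) < 0"
  shows "\<exists>c \<alpha>. (\<forall>k<n. c k > (0::real)) \<and> \<alpha> > 0 \<and>
    (\<forall>w. (\<Sum>k<n. c k * Re (cnj (w k) * (\<Sum>j\<in>{k..<n}. T k j * w j))) \<le> - \<alpha> * (\<Sum>k<n. (cmod (w k))\<^sup>2))"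
  using assms
proof (induction n)
  case 0
  show ?case by (rule exI[of _ "\<lambda>_. 1"], rule exI[of _ 1]) auto
next
  case (Suc n)
  have "\<And>k. k < n \<Longrightarrow> Re (T k k) < 0" using Suc.prems by simp
  from Suc.IH[OF this] obtain c \<alpha> where c: "\<And>k. k < n \<Longrightarrow> c k > 0" and \<alpha>: "\<alpha> > 0"
    and le: "\<And>w. (\<Sum>k<n. c k * Re (cnj (w k) * (\<Sum>j\<in>{k..<n}. T k j * w j))) \<le> - \<alpha> * (\<Sum>k<n. (cmod (w k))\<^sup>2)"
    by blast
  define K where "K = (\<Sum>k<n. (c k * cmod (T k n))\<^sup>2 / (4 * (\<alpha> / 2)))"
  have K: "K \<ge> 0" unfolding K_def using \<alpha> by (intro sum_nonneg) auto
  define b where "b = - Re (T n n)"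
  have b: "b > 0" using Suc.prems[of n] by (simp add: b_def)
  \<comment> \<open>\<open>K\<close> is the price, in multiples of
    \<open>(cmod (w n))\<^sup>2\<close>, of absorbing the cross terms with half of \<alpha>. The new
    weight makes the diagonal term \<open>- (K + \<alpha> / 2)\<close> times that square: it pays
    \<open>K\<close> and leaves the rate \<open>\<alpha> / 2\<close> that the other coordinates have
    kept.\<close>
  define c' where "c' = c(n := (K + \<alpha> / 2) / b)"
  have "(\<Sum>k<Suc n. c' k * Re (cnj (w k) * (\<Sum>j\<in>{k..<Suc n}. T k j * w j)))
      \<le> - (\<alpha> / 2) * (\<Sum>k<Suc n. (cmod (w k))\<^sup>2)" for w
  proof -
    let ?W = "\<Sum>k<n. (cmod (w k))\<^sup>2"
    have cross: "c k * Re (cnj (w k) * (T k n * w n))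
        \<le> \<alpha> / 2 * (cmod (w k))\<^sup>2 + (c k * cmod (T k n))\<^sup>2 / (4 * (\<alpha> / 2)) * (cmod (w n))\<^sup>2" if "k < n" for k
    proof -
      have "Re (cnj (w k) * (T k n * w n)) \<le> cmod (cnj (w k) * (T k n * w n))"
        by (rule complex_Re_le_cmod)
      also have "\<dots> = cmod (w k) * (cmod (T k n) * cmod (w n))" by (simp add: norm_mult)
      finally have "c k * Re (cnj (w k) * (T k n * w n)) \<le> c k * (cmod (w k) * (cmod (T k n) * cmod (w n)))"
        using c[OF that] by (intro mult_left_mono) auto
      also have "\<dots> = cmod (w k) * (c k * cmod (T k n) * cmod (w n))" by simp
      also have "\<dots> \<le> \<alpha> / 2 * (cmod (w k))\<^sup>2 + (c k * cmod (T k n) * cmod (w n))\<^sup>2 / (4 * (\<alpha> / 2))"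
        by (rule young_inequality) (use \<alpha> in simp)
      finally show ?thesis by (simp add: power_mult_distrib)
    qed
    have "(\<Sum>k<n. c' k * Re (cnj (w k) * (\<Sum>j\<in>{k..<Suc n}. T k j * w j)))
      = (\<Sum>k<n. c k * Re (cnj (w k) * (\<Sum>j\<in>{k..<n}. T k j * w j)) + c k * Re (cnj (w k) * (T k n * w n)))"
      by (intro sum.cong refl) (simp add: c'_def ring_distribs del: complex_Re_of_nat times_complex.sel)
    also have "\<dots> \<le> - \<alpha> * ?W + (\<Sum>k<n. \<alpha> / 2 * (cmod (w k))\<^sup>2
        + (c k * cmod (T k n))\<^sup>2 / (4 * (\<alpha> / 2)) * (cmod (w n))\<^sup>2)"
      unfolding sum.distrib[of "\<lambda>k. c k * Re (cnj (w k) * (\<Sum>j\<in>{k..<n}. T k j * w j))"]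
      by (intro add_mono le sum_mono cross) auto
    also have "\<dots> = - (\<alpha> / 2) * ?W + K * (cmod (w n))\<^sup>2"
      unfolding K_def sum.distrib sum_distrib_left[symmetric] sum_distrib_right[symmetric] by simp
    finally have 1: "(\<Sum>k<n. c' k * Re (cnj (w k) * (\<Sum>j\<in>{k..<Suc n}. T k j * w j)))
        \<le> - (\<alpha> / 2) * ?W + K * (cmod (w n))\<^sup>2" .
    have "cnj (w n) * (T n n * w n) = T n n * (w n * cnj (w n))"
      by (simp only: mult_ac)
    also have "\<dots> = T n n * of_real ((cmod (w n))\<^sup>2)"
      by (simp only: complex_norm_square)
    finally have eq: "cnj (w n) * (T n n * w n) = T n n * of_real ((cmod (w n))\<^sup>2)" .
    have "Re (cnj (w n) * (T n n * w n)) = - b * (cmod (w n))\<^sup>2"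
      unfolding eq by (simp add: b_def del: of_real_power)
    then have "c' n * Re (cnj (w n) * (\<Sum>j\<in>{n..<Suc n}. T n j * w j)) = (K + \<alpha> / 2) / b * (- b * (cmod (w n))\<^sup>2)"
      by (simp add: c'_def del: times_complex.sel)
    also have "\<dots> = - (K + \<alpha> / 2) * (cmod (w n))\<^sup>2"
      using b by (simp, simp add: algebra_simps)
    finally have "c' n * Re (cnj (w n) * (\<Sum>j\<in>{n..<Suc n}. T n j * w j)) = - (K + \<alpha> / 2) * (cmod (w n))\<^sup>2" .
    with 1 show ?thesis by (simp add: algebra_simps del: times_complex.sel)
  qed
  moreover have "\<forall>k<Suc n. c' k > 0"
    using c K \<alpha> b by (auto simp: c'_def less_Suc_eq intro!: divide_pos_pos add_nonneg_pos)
  ultimately show ?case using \<alpha> by (intro exI[of _ c'] exI[of _ "\<alpha> / 2"]) auto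
qed

text \<open>Schur decomposition along a factorization of the characteristic polynomial, whose roots
  form the diagonal of \<open>T\<close>. The relation is given as \<open>R * A = T * R\<close> so
  that the coordinates \<open>R v\<close> are transformed by \<open>T\<close>; the left inverse
  \<open>R'\<close> shows that they vanish only with \<open>v\<close>.\<close>

lemma complex_triangularization:
  fixes A :: "complex mat"
  assumes A: "A \<in> carrier_mat n n"
  obtains T R R' where "T \<in> carrier_mat n n" "R \<in> carrier_mat n n" "R' \<in> carrier_mat n n"
    "upper_triangular T" "R' * R = 1\<^sub>m n" "R * A = T * R" "\<And>k. k < n \<Longrightarrow> T $$ (k, k) \<in> spectrum A"
proof -
  obtain es where es: "char_poly A = (\<Prod>e\<leftarrow>es. [:- e, 1:])"
    using char_poly_factorized[OF A] by blast
  obtain T R' R where dec: "schur_decomposition A es = (T, R', R)" by (metis prod_cases3)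
  from schur_decomposition[OF A es dec] have sim: "similar_mat_wit A T R' R"
    and ut: "upper_triangular T" and diag: "diag_mat T = es" by auto
  note s = similar_mat_witD2[OF A sim]
  have "R * A = R * (R' * (T * R))"
    using s(3,5-7) by (simp add: assoc_mult_mat[of _ n n _ n _ n])
  also have "\<dots> = (R * R') * (T * R)"
    using s(5-7) by (intro assoc_mult_mat[symmetric, of _ n n _ n _ n]) auto
  also have "\<dots> = T * R" using s by simp
  finally have RA: "R * A = T * R" .
  have "T $$ (k, k) \<in> spectrum A" if "k < n" for k
  proof -
    have "T $$ (k, k) \<in> set es" using that s(5) unfolding diag[symmetric] diag_mat_def by auto
    then have "poly (char_poly A) (T $$ (k, k)) = 0" unfolding es by (rule linear_poly_root)
    then show ?thesis using spectrum_root_char_poly[OF A] by simp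
  qed
  with that[OF s(5,7,6) ut s(1) RA] show ?thesis by blast
qed

text \<open>In coordinates \<open>w = R v\<close> that triangularize \<open>A\<close> the Lyapunov function is a weighted sum
  of the \<open>|w\<^sub>k|\<^sup>2\<close>; it is real because \<open>v\<close> is.\<close>

lemma hurwitz_lyapunov:
  assumes hur: "hurwitz A" and A: "A \<in> carrier_mat n n"
  obtains Q where "Q \<in> carrier_mat n n" "sym_pos_def Q"
    "\<And>v. v \<in> carrier_vec n \<Longrightarrow> v \<noteq> 0\<^sub>v n \<Longrightarrow> v \<bullet> (Q *\<^sub>v (A *\<^sub>v v)) < 0"
proof -
  have cA: "cmat A \<in> carrier_mat n n" using A by simp
  obtain T R R' where T: "T \<in> carrier_mat n n" and R: "R \<in> carrier_mat n n" "R' \<in> carrier_mat n n"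
    and ut: "upper_triangular T" and inv: "R' * R = 1\<^sub>m n" and RA: "R * cmat A = T * R"
    and diag: "\<And>k. k < n \<Longrightarrow> T $$ (k, k) \<in> spectrum (cmat A)"
    by (rule complex_triangularization[OF cA]) blast
  have "Re (T $$ (k, k)) < 0" if "k < n" for k
    using diag[OF that] hur unfolding hurwitz_def by blast
  from triangular_weighted_dissipative[where T = "\<lambda>k j. T $$ (k, j)", OF this]
  obtain c \<alpha> where c: "\<And>k. k < n \<Longrightarrow> c k > (0::real)" and \<alpha>: "\<alpha> > 0"
    and le: "\<And>w. (\<Sum>k<n. c k * Re (cnj (w k) * (\<Sum>j\<in>{k..<n}. T $$ (k, j) * w j)))
        \<le> - \<alpha> * (\<Sum>k<n. (cmod (w k))\<^sup>2)" by blast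
  let ?cv = "map_vec complex_of_real"
  define W where "W v k = (R *\<^sub>v ?cv v) $ k" for v k
  \<comment> \<open>Entrywise real part of the Hermitian matrix \<open>R^H diag(c) R\<close>. The
    identity \<open>form\<close> below is bilinear, not merely quadratic, because it is later
    applied to the pair \<open>v\<close>, \<open>A v\<close>.\<close>
  define Q where "Q = mat n n (\<lambda>(i, j). \<Sum>k<n. c k * Re (cnj (R $$ (k, i)) * R $$ (k, j)))"
  have Q: "Q \<in> carrier_mat n n" by (simp add: Q_def)
  have W: "W v k = (\<Sum>i<n. R $$ (k, i) * of_real (v $ i))" if "v \<in> carrier_vec n" "k < n" for v k
    using that R by (auto simp: W_def scalar_prod_def lessThan_atLeast0 intro!: sum.cong)
  have form: "u \<bullet> (Q *\<^sub>v v) = (\<Sum>k<n. c k * Re (cnj (W u k) * W v k))"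
    if u: "u \<in> carrier_vec n" and v: "v \<in> carrier_vec n" for u v
  proof -
    have "u \<bullet> (Q *\<^sub>v v) = (\<Sum>i<n. \<Sum>j<n. \<Sum>k<n. c k * Re (cnj (R $$ (k, i) * of_real (u $ i)) * (R $$ (k, j) * of_real (v $ j))))"
      unfolding scalar_prod_mat_vec[OF Q u v]
      by (intro sum.cong refl) (simp add: Q_def sum_distrib_left sum_distrib_right algebra_simps)
    also have "\<dots> = (\<Sum>i<n. \<Sum>k<n. \<Sum>j<n. c k * Re (cnj (R $$ (k, i) * of_real (u $ i)) * (R $$ (k, j) * of_real (v $ j))))"
      by (intro sum.cong refl sum.swap)
    also have "\<dots> = (\<Sum>k<n. \<Sum>i<n. \<Sum>j<n. c k * Re (cnj (R $$ (k, i) * of_real (u $ i)) * (R $$ (k, j) * of_real (v $ j))))"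
      by (rule sum.swap)
    also have "\<dots> = (\<Sum>k<n. c k * Re (cnj (W u k) * W v k))"
    proof (intro sum.cong refl)
      fix k assume "k \<in> {..<n}"
      then have "cnj (W u k) * W v k = (\<Sum>i<n. \<Sum>j<n.
          cnj (R $$ (k, i) * of_real (u $ i)) * (R $$ (k, j) * of_real (v $ j)))"
        by (simp only: W u v cnj_sum sum_product lessThan_iff)
      then show "(\<Sum>i<n. \<Sum>j<n. c k * Re (cnj (R $$ (k, i) * of_real (u $ i)) * (R $$ (k, j) * of_real (v $ j))))
          = c k * Re (cnj (W u k) * W v k)"
        by (simp only: Re_sum sum_distrib_left)
    qed
    finally show ?thesis .
  qed
  have sq: "Re (cnj z * z) = (cmod z)\<^sup>2" for z
    by (metis Re_complex_of_real complex_norm_square mult.commute)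
  have pos: "(\<Sum>k<n. (cmod (W v k))\<^sup>2) > 0 \<and> (\<Sum>k<n. c k * (cmod (W v k))\<^sup>2) > 0"
    if v: "v \<in> carrier_vec n" "v \<noteq> 0\<^sub>v n" for v
  proof -
    have "\<exists>k<n. W v k \<noteq> 0"
    proof (rule ccontr)
      assume "\<not> ?thesis"
      then have "R *\<^sub>v ?cv v = 0\<^sub>v n" using R by (intro eq_vecI) (auto simp: W_def)
      then have "R' *\<^sub>v (R *\<^sub>v ?cv v) = 0\<^sub>v n" using R by auto
      moreover have "R' *\<^sub>v (R *\<^sub>v ?cv v) = ?cv v"
        using assoc_mult_mat_vec[OF R(2,1), of "?cv v"] inv v by simp
      ultimately have "?cv v = 0\<^sub>v n" by simp
      then have "v = 0\<^sub>v n" using v(1)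
        by (metis carrier_vecD eq_vecI index_map_vec(1) index_zero_vec of_real_eq_0_iff)
      with v show False by simp
    qed
    then obtain k where k: "k < n" "W v k \<noteq> 0" by blast
    have "(\<Sum>k<n. (cmod (W v k))\<^sup>2) > 0"
      by (rule sum_pos2[of _ k]) (use k in auto)
    moreover have "(\<Sum>k<n. c k * (cmod (W v k))\<^sup>2) > 0"
      by (rule sum_pos2[of _ k]) (use k c in \<open>auto intro!: mult_nonneg_nonneg simp: less_imp_le\<close>)
    ultimately show ?thesis ..
  qed
  have sym: "transpose_mat Q = Q"
    unfolding Q_def by (intro eq_matI) (auto intro!: sum.cong simp: mult.commute)
  have spd: "sym_pos_def Q"
    unfolding sym_pos_def_def using Q sym pos by (auto simp: form sq simp del: times_complex.sel)
  have "v \<bullet> (Q *\<^sub>v (A *\<^sub>v v)) < 0" if v: "v \<in> carrier_vec n" "v \<noteq> 0\<^sub>v n" for v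
  proof -
    have cAv: "?cv (A *\<^sub>v v) = cmat A *\<^sub>v ?cv v"
      by (rule of_real_hom.mult_mat_vec_hom[OF A v(1)])
    have cv: "?cv v \<in> carrier_vec n" using v by simp
    have "R *\<^sub>v ?cv (A *\<^sub>v v) = T *\<^sub>v (R *\<^sub>v ?cv v)"
      unfolding cAv assoc_mult_mat_vec[OF R(1) cA cv, symmetric] RA assoc_mult_mat_vec[OF T R(1) cv] ..
    then have WA: "W (A *\<^sub>v v) k = (\<Sum>j\<in>{k..<n}. T $$ (k, j) * W v j)" if k: "k < n" for k
    proof -
      have "W (A *\<^sub>v v) k = (\<Sum>j\<in>{0..<n}. T $$ (k, j) * W v j)"
        unfolding W_def \<open>R *\<^sub>v ?cv (A *\<^sub>v v) = T *\<^sub>v (R *\<^sub>v ?cv v)\<close>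
        using k T R by (auto simp: scalar_prod_def intro!: sum.cong)
      also have "\<dots> = (\<Sum>j\<in>{k..<n}. T $$ (k, j) * W v j)"
        using upper_triangularD[OF ut, of _ k] k T by (intro sum.mono_neutral_right) auto
      finally show ?thesis .
    qed
    have "v \<bullet> (Q *\<^sub>v (A *\<^sub>v v)) = (\<Sum>k<n. c k * Re (cnj (W v k) * (\<Sum>j\<in>{k..<n}. T $$ (k, j) * W v j)))"
      using A v by (simp add: form WA del: times_complex.sel)
    also have "\<dots> \<le> - \<alpha> * (\<Sum>k<n. (cmod (W v k))\<^sup>2)" by (rule le)
    also have "\<dots> < 0" using pos[OF v] \<alpha> by simp
    finally show ?thesis .
  qed
  with that Q spd show ?thesis by blast
qed

lemma quadratic_form_add_transpose:
  fixes G :: "'a :: comm_ring_1 mat"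
  assumes G: "G \<in> carrier_mat n n" and v: "v \<in> carrier_vec n"
  shows "v \<bullet> ((G + transpose_mat G) *\<^sub>v v) = 2 * (v \<bullet> (G *\<^sub>v v))"
proof -
  have "(transpose_mat G *\<^sub>v v) \<bullet> v = v \<bullet> (G *\<^sub>v v)"
    by (rule transpose_vec_mult_scalar[OF G v v])
  moreover have "(transpose_mat G *\<^sub>v v) \<bullet> v = v \<bullet> (transpose_mat G *\<^sub>v v)"
    using G v by (intro comm_scalar_prod[of _ n]) auto
  ultimately show ?thesis
    using G v by (simp add: add_mult_distrib_mat_vec[of _ n n] scalar_prod_add_distrib[of _ n])
qed

text \<open>A quadratic form sees only the symmetric part of its matrix, so coercivity of
  \<open>G + transpose_mat G\<close> suffices. The extension beyond symmetric matrices is for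
  \<open>- (Q * A)\<close>, which is not symmetric in general.\<close>

lemma positive_form_coercive:
  fixes G :: "real mat"
  assumes G: "G \<in> carrier_mat n n"
    and pos: "\<And>v. v \<in> carrier_vec n \<Longrightarrow> v \<noteq> 0\<^sub>v n \<Longrightarrow> v \<bullet> (G *\<^sub>v v) > 0"
  obtains c where "c > 0" "\<And>v. v \<in> carrier_vec n \<Longrightarrow> v \<bullet> (G *\<^sub>v v) \<ge> c * (v \<bullet> v)"
proof -
  have M: "G + transpose_mat G \<in> carrier_mat n n" using G by simp
  have "transpose_mat (G + transpose_mat G) = G + transpose_mat G"
    using G by (auto simp: transpose_add[of _ n n] comm_add_mat[of _ n n])
  then have "sym_pos_def (G + transpose_mat G)"
    using G pos unfolding sym_pos_def_def by (auto simp: quadratic_form_add_transpose[of _ n])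
  then obtain c where c: "c > 0"
    "\<And>v. v \<in> carrier_vec n \<Longrightarrow> v \<bullet> ((G + transpose_mat G) *\<^sub>v v) \<ge> c * (v \<bullet> v)"
    using sym_pos_def_coercive[OF _ M] by blast
  show ?thesis
    by (rule that[of "c / 2"]) (use c in \<open>auto simp: quadratic_form_add_transpose[OF G] field_simps\<close>)
qed

lemma hurwitz_lyapunov_coercive:
  assumes "hurwitz A" and A: "A \<in> carrier_mat n n"
  obtains Q c where "Q \<in> carrier_mat n n" "sym_pos_def Q" "c > 0"
    "\<And>v. v \<in> carrier_vec n \<Longrightarrow> v \<bullet> (Q *\<^sub>v (A *\<^sub>v v)) \<le> - c * (v \<bullet> v)"
proof -
  obtain Q where Q: "Q \<in> carrier_mat n n" "sym_pos_def Q"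
    and neg: "\<And>v. v \<in> carrier_vec n \<Longrightarrow> v \<noteq> 0\<^sub>v n \<Longrightarrow> v \<bullet> (Q *\<^sub>v (A *\<^sub>v v)) < 0"
    by (rule hurwitz_lyapunov[OF assms]) blast
  have G: "- (Q * A) \<in> carrier_mat n n" using Q A by simp
  have eq: "v \<bullet> (- (Q * A) *\<^sub>v v) = - (v \<bullet> (Q *\<^sub>v (A *\<^sub>v v)))" if "v \<in> carrier_vec n" for v
    using Q A that by simp
  obtain c where "c > 0" "\<And>v. v \<in> carrier_vec n \<Longrightarrow> v \<bullet> (- (Q * A) *\<^sub>v v) \<ge> c * (v \<bullet> v)"
    by (rule positive_form_coercive[OF G]) (use neg eq in auto)
  with eq that[OF Q, of c] show ?thesis by fastforce
qed

section \<open>Switched linear systems\<close>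

text \<open>Lyapunov functions here are differentiable only between switching instants. Induction on
  the exceptional set cuts the interval at one exceptional point, and continuity lets the two halves
  be joined.\<close>

lemma nonincreasing_finite_exceptions:
  fixes f :: "real \<Rightarrow> real"
  assumes "finite F" "a \<le> b" "continuous_on {a..b} f"
    and "\<And>x. a < x \<Longrightarrow> x < b \<Longrightarrow> x \<notin> F \<Longrightarrow> \<exists>y. (f has_real_derivative y) (at x) \<and> y \<le> 0"
  shows "f b \<le> f a"
  using assms
proof (induction F arbitrary: a b rule: finite_induct)
  case empty
  show ?case
    by (rule DERIV_nonpos_imp_decreasing_open[OF empty.prems(1) _ empty.prems(2)]) (rule empty.prems(3), simp_all)
next
  case (insert z F)
  \<comment> \<open>On a subinterval with \<open>z\<close> outside its interior, \<open>z\<close> is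
    no exception any more and the induction hypothesis applies.\<close>
  have sub: "f d \<le> f c" if "a \<le> c" "c \<le> d" "d \<le> b" "z \<notin> {c<..<d}" for c d
  proof (rule insert.IH)
    show "c \<le> d" by fact
    show "continuous_on {c..d} f" by (rule continuous_on_subset[OF insert.prems(2)]) (use that in simp)
    fix x assume "c < x" "x < d" "x \<notin> F"
    with that show "\<exists>y. (f has_real_derivative y) (at x) \<and> y \<le> 0"
      by (intro insert.prems(3)) auto
  qed
  show ?case
  proof (cases "a < z \<and> z < b")
    case True
    then have "f b \<le> f z" "f z \<le> f a" by (auto intro!: sub)
    then show ?thesis by (rule order_trans)
  next
    case False
    then show ?thesis using insert.prems(1) by (intro sub) auto
  qed
qed

text \<open>A Gronwall argument: once \<open>h\<close> stays below
  \<open>\<alpha> * \<epsilon>\<close>, the product of \<open>exp (\<alpha> * (s - T))\<close> and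
  \<open>V s - \<epsilon>\<close> is nonincreasing. Hence \<open>V\<close> is at most \<epsilon>
  plus an exponentially decaying transient, and each of the two gets half of the tolerance
  \<open>e\<close>. Local finiteness of \<open>F\<close> leaves finitely many exceptions on each
  interval from \<open>T\<close> to \<open>s\<close>.\<close>

lemma comparison_tendsto_zero:
  fixes V h :: "real \<Rightarrow> real"
  assumes \<alpha>: "\<alpha> > 0" and h: "(h \<longlongrightarrow> 0) at_top"
    and cont: "continuous_on {0..} V" and nonneg: "\<And>s. s \<ge> 0 \<Longrightarrow> V s \<ge> 0"
    and fin: "\<And>b. finite (F \<inter> {..b})"
    and der: "\<And>s. s > 0 \<Longrightarrow> s \<notin> F \<Longrightarrow> \<exists>D. (V has_real_derivative D) (at s) \<and> D \<le> - \<alpha> * V s + h s"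
  shows "(V \<longlongrightarrow> 0) at_top"
proof (rule tendstoI)
  fix e :: real assume "e > 0"
  define \<epsilon> where "\<epsilon> = e / 2"
  have \<epsilon>: "\<epsilon> > 0" using \<open>e > 0\<close> by (simp add: \<epsilon>_def)
  have "eventually (\<lambda>s. h s < \<alpha> * \<epsilon>) at_top"
    using h \<alpha> \<epsilon> by (intro order_tendstoD) auto
  then obtain T0 where T0: "\<And>s. s \<ge> T0 \<Longrightarrow> h s < \<alpha> * \<epsilon>"
    unfolding eventually_at_top_linorder by blast
  define T where "T = max T0 0"
  have bound: "V s \<le> \<epsilon> + exp (- \<alpha> * (s - T)) * V T" if s: "s \<ge> T" for s
  proof -
    let ?f = "\<lambda>x. exp (\<alpha> * (x - T)) * (V x - \<epsilon>)"
    have "?f s \<le> ?f T"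
    proof (rule nonincreasing_finite_exceptions[OF fin[of s] s])
      show "continuous_on {T..s} ?f"
        by (intro continuous_intros continuous_on_subset[OF cont]) (auto simp: T_def)
      fix x assume x: "T < x" "x < s" "x \<notin> F \<inter> {..s}"
      then have "x > 0" "x \<notin> F" by (auto simp: T_def)
      then obtain D where D: "(V has_real_derivative D) (at x)" "D \<le> - \<alpha> * V x + h x" using der by blast
      have E: "((\<lambda>x. exp (\<alpha> * (x - T))) has_real_derivative \<alpha> * exp (\<alpha> * (x - T))) (at x)"
        by (auto intro!: derivative_eq_intros)
      have "((\<lambda>x. V x - \<epsilon>) has_real_derivative D) (at x)"
        using DERIV_diff[OF D(1) DERIV_const[of \<epsilon>]] by simp
      from DERIV_mult[OF E this]
      have "(?f has_real_derivative exp (\<alpha> * (x - T)) * (\<alpha> * (V x - \<epsilon>) + D)) (at x)"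
        by (rule DERIV_cong) (simp add: ring_distribs)
      moreover have "h x < \<alpha> * \<epsilon>" using T0[of x] x by (simp add: T_def)
      then have "\<alpha> * (V x - \<epsilon>) + D \<le> 0"
        using D(2) by (simp add: right_diff_distrib)
      then have "exp (\<alpha> * (x - T)) * (\<alpha> * (V x - \<epsilon>) + D) \<le> 0"
        by (rule mult_nonneg_nonpos[OF exp_ge_zero])
      ultimately show "\<exists>y. (?f has_real_derivative y) (at x) \<and> y \<le> 0"
        by blast
    qed
    also have "\<dots> \<le> V T" using \<epsilon> by simp
    finally have "?f s \<le> V T" .
    have "exp (- \<alpha> * (s - T)) * exp (\<alpha> * (s - T)) = 1"
      using exp_minus_inverse[of "\<alpha> * (s - T)"] by (simp only: mult_minus_left mult.commute)
    then have "V s - \<epsilon> = exp (- \<alpha> * (s - T)) * exp (\<alpha> * (s - T)) * (V s - \<epsilon>)"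
      by (simp only: mult_1)
    also have "\<dots> = exp (- \<alpha> * (s - T)) * ?f s" by (rule mult.assoc)
    also have "\<dots> \<le> exp (- \<alpha> * (s - T)) * V T"
      using \<open>?f s \<le> V T\<close> by (intro mult_left_mono) auto
    finally show ?thesis by linarith
  qed
  have "filterlim (\<lambda>s. - T + s) at_top at_top"
    by (rule filterlim_tendsto_add_at_top[OF tendsto_const filterlim_ident])
  then have shift: "filterlim (\<lambda>s. s - T) at_top at_top" by simp
  have "filterlim (\<lambda>s. - \<alpha> * (s - T)) at_bot at_top"
    by (rule filterlim_tendsto_neg_mult_at_bot[OF tendsto_const _ shift]) (use \<alpha> in simp)
  then have "((\<lambda>s. exp (- \<alpha> * (s - T)) * V T) \<longlongrightarrow> 0) at_top"
    by (intro tendsto_mult_left_zero filterlim_compose[OF exp_at_bot])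
  then have "eventually (\<lambda>s. exp (- \<alpha> * (s - T)) * V T < \<epsilon>) at_top"
    using \<epsilon> by (intro order_tendstoD) auto
  moreover have "eventually (\<lambda>s. s \<ge> T) at_top" by (rule eventually_ge_at_top)
  ultimately show "eventually (\<lambda>s. dist (V s) 0 < e) at_top"
  proof eventually_elim
    case (elim s)
    have "s \<ge> 0" using elim(2) by (simp add: T_def)
    moreover have "V s < e" using bound[OF elim(2)] elim(1) unfolding \<epsilon>_def by linarith
    ultimately show ?case using nonneg[of s] by simp
  qed
qed

text \<open>The dwell time forces \<open>t k \<ge> real k * \<tau>\<^sub>0\<close>, so only indices
  up to \<open>b / \<tau>\<^sub>0\<close> can contribute.\<close>

lemma switching_instants_locally_finite:
  assumes "switching_signal \<kappa> \<tau>\<^sub>0 t \<sigma>"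
  shows "finite (range t \<inter> {..b})"
proof -
  have t0: "t 0 = 0" and \<tau>: "\<tau>\<^sub>0 > 0" and step: "t (Suc k) - t k \<ge> \<tau>\<^sub>0" for k
    using assms by (auto simp: switching_signal_def)
  have ge: "t k \<ge> real k * \<tau>\<^sub>0" for k
  proof (induction k)
    case (Suc k)
    then show ?case using step[of k] by (simp add: algebra_simps)
  qed (simp add: t0)
  have "range t \<inter> {..b} \<subseteq> t ` {..nat \<lceil>b / \<tau>\<^sub>0\<rceil>}"
  proof clarify
    fix k assume "t k \<le> b"
    with ge[of k] have "real k * \<tau>\<^sub>0 \<le> b" by linarith
    then have "real k \<le> b / \<tau>\<^sub>0" using \<tau> by (simp add: field_simps)
    then have "k \<le> nat \<lceil>b / \<tau>\<^sub>0\<rceil>" by linarith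
    then show "t k \<in> t ` {..nat \<lceil>b / \<tau>\<^sub>0\<rceil>}" by blast
  qed
  then show ?thesis by (rule finite_subset) simp
qed

section \<open>Closure of switched solutions under linear operations\<close>

lemma switched_solution_carrier:
  "switched_solution n t z f \<Longrightarrow> s \<ge> 0 \<Longrightarrow> z s \<in> carrier_vec n"
  by (simp add: switched_solution_def)

lemma switched_solution_cong:
  assumes "switched_solution n t z f" "\<And>s. s \<ge> 0 \<Longrightarrow> f s = g s"
  shows "switched_solution n t z g"
  using assms by (simp add: switched_solution_def)

text \<open>The components are known to equal \<open>w\<close> for nonnegative times only, so a
  two-sided derivative can be transferred only at \<open>s > 0\<close>. Time 0 causes no trouble,
  since it is itself a switching instant and is exempt from the derivative condition.\<close>

lemma switched_solution_transform:
  assumes t0: "0 \<in> range t"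
    and eq: "\<And>s k. s \<ge> 0 \<Longrightarrow> k < n \<Longrightarrow> z s $ k = w k s"
    and carrier: "\<And>s. s \<ge> 0 \<Longrightarrow> z s \<in> carrier_vec n"
    and cont: "\<And>k. k < n \<Longrightarrow> continuous_on {0..} (w k)"
    and der: "\<And>s k. s > 0 \<Longrightarrow> s \<notin> range t \<Longrightarrow> k < n \<Longrightarrow> (w k has_real_derivative f s $ k) (at s)"
  shows "switched_solution n t z f"
  unfolding switched_solution_def
proof (intro conjI allI impI)
  fix s :: real assume "s \<ge> 0"
  then show "z s \<in> carrier_vec n" by (rule carrier)
next
  fix k assume k: "k < n"
  show "continuous_on {0..} (\<lambda>s. z s $ k)"
    by (rule iffD2[OF continuous_on_cong[OF refl] cont[OF k]]) (use k eq in auto)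
next
  fix s :: real and k assume s: "s \<ge> 0" "s \<notin> range t" and k: "k < n"
  then have "s > 0" using t0 by (cases "s = 0") auto
  show "((\<lambda>s'. z s' $ k) has_real_derivative f s $ k) (at s)"
    by (rule has_field_derivative_transform_within_open[OF der[OF \<open>s > 0\<close> s(2) k], of "{0<..}"])
      (use \<open>s > 0\<close> k eq in auto)
qed

lemma switched_solution_mult_mat:
  assumes t0: "0 \<in> range t" and M: "M \<in> carrier_mat m n" and z: "switched_solution n t z f"
    and f: "\<And>s. s \<ge> 0 \<Longrightarrow> f s \<in> carrier_vec n"
  shows "switched_solution m t (\<lambda>s. M *\<^sub>v z s) (\<lambda>s. M *\<^sub>v f s)"
proof (rule switched_solution_transform[OF t0])
  note zc = switched_solution_carrier[OF z]
  fix s :: real and k assume "s \<ge> 0" "k < m"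
  then show "(M *\<^sub>v z s) $ k = (\<Sum>i<n. M $$ (k, i) * z s $ i)"
    using M zc[of s] by (auto simp: scalar_prod_def lessThan_atLeast0 intro!: sum.cong)
next
  fix s :: real assume "s \<ge> 0"
  then show "M *\<^sub>v z s \<in> carrier_vec m" using M switched_solution_carrier[OF z] by auto
next
  fix k
  show "continuous_on {0..} (\<lambda>s. \<Sum>i<n. M $$ (k, i) * z s $ i)"
    using z unfolding switched_solution_def by (auto intro!: continuous_intros)
next
  fix s :: real and k assume s: "s > 0" "s \<notin> range t" and k: "k < m"
  have "((\<lambda>s. \<Sum>i<n. M $$ (k, i) * z s $ i) has_real_derivative (\<Sum>i<n. M $$ (k, i) * f s $ i)) (at s)"
    using z s unfolding switched_solution_def
    by (intro DERIV_sum DERIV_cmult) auto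
  moreover have "(M *\<^sub>v f s) $ k = (\<Sum>i<n. M $$ (k, i) * f s $ i)"
    using M f[of s] s k by (auto simp: scalar_prod_def lessThan_atLeast0 intro!: sum.cong)
  ultimately show "((\<lambda>s. \<Sum>i<n. M $$ (k, i) * z s $ i) has_real_derivative (M *\<^sub>v f s) $ k) (at s)"
    by simp
qed

lemma switched_solution_minus:
  assumes t0: "0 \<in> range t" and z: "switched_solution n t z f" and w: "switched_solution n t w g"
    and g: "\<And>s. s \<ge> 0 \<Longrightarrow> g s \<in> carrier_vec n"
  shows "switched_solution n t (\<lambda>s. z s - w s) (\<lambda>s. f s - g s)"
proof (rule switched_solution_transform[OF t0, where w = "\<lambda>k s. z s $ k - w s $ k"])
  show "z s - w s \<in> carrier_vec n" if "s \<ge> 0" for s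
    using switched_solution_carrier[OF z that] switched_solution_carrier[OF w that] by simp
  show "(z s - w s) $ k = z s $ k - w s $ k" if "s \<ge> 0" "k < n" for s k
    using switched_solution_carrier[OF w that(1)] that by simp
  show "continuous_on {0..} (\<lambda>s. z s $ k - w s $ k)" if "k < n" for k
    using z w that unfolding switched_solution_def by (auto intro!: continuous_intros)
  fix s :: real and k assume s: "s > 0" "s \<notin> range t" and k: "k < n"
  have "((\<lambda>s. z s $ k - w s $ k) has_real_derivative f s $ k - g s $ k) (at s)"
    using z w s k unfolding switched_solution_def by (intro DERIV_diff) auto
  then show "((\<lambda>s. z s $ k - w s $ k) has_real_derivative (f s - g s) $ k) (at s)"
    using g[of s] s k by simp
qed

lemma switched_solution_append:
  assumes t0: "0 \<in> range t" and z: "switched_solution n t z f" and w: "switched_solution m t w g"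
    and f: "\<And>s. s \<ge> 0 \<Longrightarrow> f s \<in> carrier_vec n" and g: "\<And>s. s \<ge> 0 \<Longrightarrow> g s \<in> carrier_vec m"
  shows "switched_solution (n + m) t (\<lambda>s. z s @\<^sub>v w s) (\<lambda>s. f s @\<^sub>v g s)"
proof (rule switched_solution_transform[OF t0, where w = "\<lambda>k s. if k < n then z s $ k else w s $ (k - n)"])
  show "z s @\<^sub>v w s \<in> carrier_vec (n + m)" if "s \<ge> 0" for s
    using switched_solution_carrier[OF z that] switched_solution_carrier[OF w that] by simp
  show "(z s @\<^sub>v w s) $ k = (if k < n then z s $ k else w s $ (k - n))" if "s \<ge> 0" "k < n + m" for s k
    using switched_solution_carrier[OF w that(1)] switched_solution_carrier[OF z that(1)] that by simp
  show "continuous_on {0..} (\<lambda>s. if k < n then z s $ k else w s $ (k - n))" if "k < n + m" for k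
    using z w that unfolding switched_solution_def by (cases "k < n") auto
  fix s :: real and k assume s: "s > 0" "s \<notin> range t" and k: "k < n + m"
  have "(f s @\<^sub>v g s) $ k = (if k < n then f s $ k else g s $ (k - n))"
    using f[of s] g[of s] s k by simp
  then show "((\<lambda>s. if k < n then z s $ k else w s $ (k - n)) has_real_derivative (f s @\<^sub>v g s) $ k) (at s)"
    using z w s k unfolding switched_solution_def by (cases "k < n") auto
qed

section \<open>Vector signals that tend to zero\<close>

definition vanishing :: "nat \<Rightarrow> (real \<Rightarrow> real vec) \<Rightarrow> bool" where
  "vanishing n z \<longleftrightarrow> (\<forall>s \<ge> 0. z s \<in> carrier_vec n) \<and> (\<forall>k<n. ((\<lambda>s. z s $ k) \<longlongrightarrow> 0) at_top)"

lemma tendsto_cong_nonneg: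
  fixes f g :: "real \<Rightarrow> 'a :: topological_space"
  assumes "(f \<longlongrightarrow> l) at_top" "\<And>s. s \<ge> 0 \<Longrightarrow> f s = g s"
  shows "(g \<longlongrightarrow> l) at_top"
  using assms(1)
proof (rule Lim_transform_eventually)
  show "eventually (\<lambda>s. f s = g s) at_top"
    using eventually_ge_at_top[of 0] by eventually_elim (rule assms(2))
qed

lemma vanishing_cong:
  assumes "vanishing n z" "\<And>s. s \<ge> 0 \<Longrightarrow> z s = w s"
  shows "vanishing n w"
  using assms unfolding vanishing_def
  by (auto intro: tendsto_cong_nonneg[where f = "\<lambda>s. z s $ _"])

lemma vanishing_mult_mat:
  assumes z: "vanishing n z" and M: "M \<in> carrier_mat m n"
  shows "vanishing m (\<lambda>s. M *\<^sub>v z s)"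
  unfolding vanishing_def
proof (intro conjI allI impI)
  fix s :: real assume "s \<ge> 0"
  then show "M *\<^sub>v z s \<in> carrier_vec m" using z M by (auto simp: vanishing_def)
next
  fix k assume k: "k < m"
  have "((\<lambda>s. \<Sum>i<n. M $$ (k, i) * z s $ i) \<longlongrightarrow> (\<Sum>i<n. M $$ (k, i) * 0)) at_top"
    using z unfolding vanishing_def by (intro tendsto_sum tendsto_mult tendsto_const) auto
  then have "((\<lambda>s. \<Sum>i<n. M $$ (k, i) * z s $ i) \<longlongrightarrow> 0) at_top" by simp
  then show "((\<lambda>s. (M *\<^sub>v z s) $ k) \<longlongrightarrow> 0) at_top"
  proof (rule tendsto_cong_nonneg)
    fix s :: real assume "s \<ge> 0"
    then have "z s \<in> carrier_vec n" using z by (simp add: vanishing_def)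
    then show "(\<Sum>i<n. M $$ (k, i) * z s $ i) = (M *\<^sub>v z s) $ k"
      using M k by (auto simp: scalar_prod_def lessThan_atLeast0 intro!: sum.cong)
  qed
qed

lemma vanishing_add:
  assumes z: "vanishing n z" and w: "vanishing n w"
  shows "vanishing n (\<lambda>s. z s + w s)"
  unfolding vanishing_def
proof (intro conjI allI impI)
  fix s :: real assume "s \<ge> 0"
  then show "z s + w s \<in> carrier_vec n" using z w by (auto simp: vanishing_def)
next
  fix k assume k: "k < n"
  have "((\<lambda>s. z s $ k + w s $ k) \<longlongrightarrow> 0 + 0) at_top"
    using z w k unfolding vanishing_def by (intro tendsto_add) auto
  then have "((\<lambda>s. z s $ k + w s $ k) \<longlongrightarrow> 0) at_top" by simp
  then show "((\<lambda>s. (z s + w s) $ k) \<longlongrightarrow> 0) at_top"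
    by (rule tendsto_cong_nonneg) (use w k in \<open>auto simp: vanishing_def\<close>)
qed

lemma vanishing_appendD:
  assumes "\<And>s. s \<ge> 0 \<Longrightarrow> z s \<in> carrier_vec n" "\<And>s. s \<ge> 0 \<Longrightarrow> w s \<in> carrier_vec m"
    and v: "vanishing (n + m) (\<lambda>s. z s @\<^sub>v w s)"
  shows "vanishing n z" "vanishing m w"
proof -
  have lim: "((\<lambda>s. (z s @\<^sub>v w s) $ k) \<longlongrightarrow> 0) at_top" if "k < n + m" for k
    using v that by (simp add: vanishing_def)
  have "((\<lambda>s. z s $ k) \<longlongrightarrow> 0) at_top" if "k < n" for k
    by (rule tendsto_cong_nonneg[OF lim[of k]])
      (use that in \<open>simp_all add: carrier_vecD[OF assms(1)] carrier_vecD[OF assms(2)]\<close>)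
  then show "vanishing n z" using assms by (simp add: vanishing_def)
  have "((\<lambda>s. w s $ k) \<longlongrightarrow> 0) at_top" if "k < m" for k
    by (rule tendsto_cong_nonneg[OF lim[of "n + k"]])
      (use that in \<open>simp_all add: carrier_vecD[OF assms(1)] carrier_vecD[OF assms(2)]\<close>)
  then show "vanishing m w" using assms by (simp add: vanishing_def)
qed

text \<open>Componentwise limits suit linear images and concatenations, whereas Lyapunov estimates
  control \<open>z s \<bullet> z s\<close>; this is the passage between the two. Backwards, each
  squared component is dominated by the squared norm.\<close>

lemma vanishing_iff_norm:
  "vanishing n z \<longleftrightarrow> (\<forall>s \<ge> 0. z s \<in> carrier_vec n) \<and> ((\<lambda>s. z s \<bullet> z s) \<longlongrightarrow> 0) at_top"
proof safe
  assume z: "vanishing n z"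
  then show "z s \<in> carrier_vec n" if "s \<ge> 0" for s using that by (simp add: vanishing_def)
  have "((\<lambda>s. \<Sum>i<n. z s $ i * z s $ i) \<longlongrightarrow> (\<Sum>i<n. 0 * 0)) at_top"
    using z unfolding vanishing_def by (intro tendsto_sum tendsto_mult) auto
  then have "((\<lambda>s. \<Sum>i<n. z s $ i * z s $ i) \<longlongrightarrow> 0) at_top" by simp
  then show "((\<lambda>s. z s \<bullet> z s) \<longlongrightarrow> 0) at_top"
    by (rule tendsto_cong_nonneg) (use z in \<open>auto simp: vanishing_def scalar_prod_def lessThan_atLeast0\<close>)
next
  assume c: "\<forall>s\<ge>0. z s \<in> carrier_vec n" and lim: "((\<lambda>s. z s \<bullet> z s) \<longlongrightarrow> 0) at_top"
  have "((\<lambda>s. z s $ k) \<longlongrightarrow> 0) at_top" if k: "k < n" for k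
  proof -
    have "((\<lambda>s. (z s $ k)\<^sup>2) \<longlongrightarrow> 0) at_top"
    proof (rule tendsto_sandwich[OF _ _ tendsto_const lim])
      show "eventually (\<lambda>s. (z s $ k)\<^sup>2 \<le> z s \<bullet> z s) at_top"
        using eventually_ge_at_top[of "0::real"]
        by eventually_elim (use c k component_square_le in auto)
    qed auto
    then have "((\<lambda>s. sqrt ((z s $ k)\<^sup>2)) \<longlongrightarrow> sqrt 0) at_top" by (rule tendsto_real_sqrt)
    then show ?thesis by (simp add: tendsto_rabs_zero_iff)
  qed
  with c show "vanishing n z" by (simp add: vanishing_def)
qed

text \<open>Written as a finite double sum, the form needs nothing but the componentwise
  derivatives. Symmetry of \<open>Q\<close> merges the two terms of the product rule.\<close>

lemma quadratic_form_switched_solution: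
  assumes Q: "Q \<in> carrier_mat n n" "transpose_mat Q = Q" and z: "switched_solution n t z f"
    and t0: "0 \<in> range t"
  shows "continuous_on {0..} (\<lambda>s. z s \<bullet> (Q *\<^sub>v z s))"
    and "s > 0 \<Longrightarrow> s \<notin> range t \<Longrightarrow> f s \<in> carrier_vec n \<Longrightarrow>
      ((\<lambda>s. z s \<bullet> (Q *\<^sub>v z s)) has_real_derivative 2 * (z s \<bullet> (Q *\<^sub>v f s))) (at s)"
proof -
  let ?V = "\<lambda>s. z s \<bullet> (Q *\<^sub>v z s)"
  note zc = switched_solution_carrier[OF z]
  let ?W = "\<lambda>s. \<Sum>i<n. \<Sum>j<n. z s $ i * Q $$ (i, j) * z s $ j"
  have VW: "?W s = ?V s" if "s \<ge> 0" for s
    using scalar_prod_mat_vec[OF Q(1) zc zc] that by simp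
  show "continuous_on {0..} ?V"
  proof (rule iffD1[OF continuous_on_cong[OF refl]])
    show "continuous_on {0..} ?W"
      using z by (auto simp: switched_solution_def intro!: continuous_intros)
  qed (use VW in simp)
  assume s: "s > 0" "s \<notin> range t" and f: "f s \<in> carrier_vec n"
  have zs: "z s \<in> carrier_vec n" using zc s by simp
  have der: "((\<lambda>s'. z s' $ k) has_real_derivative f s $ k) (at s)" if "k < n" for k
    using z s that by (simp add: switched_solution_def)
  have "(?W has_real_derivative
      (\<Sum>i<n. \<Sum>j<n. f s $ i * Q $$ (i, j) * z s $ j + z s $ i * Q $$ (i, j) * f s $ j)) (at s)"
    by (intro DERIV_sum) (auto intro!: derivative_eq_intros der)
  also have "(\<Sum>i<n. \<Sum>j<n. f s $ i * Q $$ (i, j) * z s $ j + z s $ i * Q $$ (i, j) * f s $ j)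
      = f s \<bullet> (Q *\<^sub>v z s) + z s \<bullet> (Q *\<^sub>v f s)"
    by (simp add: scalar_prod_mat_vec[OF Q(1) zs f] scalar_prod_mat_vec[OF Q(1) f zs] sum.distrib)
  also have "\<dots> = 2 * (z s \<bullet> (Q *\<^sub>v f s))"
    using symmetric_scalar_prod[OF Q f zs] by simp
  finally show "(?V has_real_derivative 2 * (z s \<bullet> (Q *\<^sub>v f s))) (at s)"
    by (rule has_field_derivative_transform_within_open[of _ _ _ "{0<..}"]) (use s VW in auto)
qed

text \<open>The input \<open>g\<close> enters \<open>V = z \<bullet> Q z\<close> only through a multiple of \<open>|g|\<^sup>2\<close>, after Young's
  inequality has absorbed the cross term \<open>z \<bullet> Q g\<close> into the dissipation.\<close>

lemma hurwitz_vanishing_input: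
  assumes hur: "hurwitz M" and M: "M \<in> carrier_mat n n"
    and z: "switched_solution n t z (\<lambda>s. M *\<^sub>v z s + g s)" and g: "vanishing n g"
    and t0: "0 \<in> range t" and fin: "\<And>b. finite (range t \<inter> {..b})"
  shows "vanishing n z"
proof -
  note zc = switched_solution_carrier[OF z]
  have gc: "g s \<in> carrier_vec n" if "s \<ge> 0" for s using g that by (simp add: vanishing_def)
  obtain Q c where Q: "Q \<in> carrier_mat n n" "sym_pos_def Q" and c: "c > 0"
    and dis: "\<And>v. v \<in> carrier_vec n \<Longrightarrow> v \<bullet> (Q *\<^sub>v (M *\<^sub>v v)) \<le> - c * (v \<bullet> v)"
    by (rule hurwitz_lyapunov_coercive[OF hur M]) blast
  have QT: "transpose_mat Q = Q" using Q by (simp add: sym_pos_def_def)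
  obtain e where e: "e > 0" "\<And>v. v \<in> carrier_vec n \<Longrightarrow> v \<bullet> (Q *\<^sub>v v) \<ge> e * (v \<bullet> v)"
    by (rule sym_pos_def_coercive[OF Q(2,1)]) blast
  obtain K where K: "\<And>u v. u \<in> carrier_vec n \<Longrightarrow> v \<in> carrier_vec n \<Longrightarrow>
      u \<bullet> (Q *\<^sub>v v) \<le> c / 2 * (u \<bullet> u) + K * (v \<bullet> v)"
    by (rule bilinear_bound[OF Q(1), of "c / 2"]) (use c in \<open>simp, blast\<close>)
  obtain B where B: "B > 0" "\<And>u v. u \<in> carrier_vec n \<Longrightarrow> v \<in> carrier_vec n \<Longrightarrow>
      u \<bullet> (Q *\<^sub>v v) \<le> 1 * (u \<bullet> u) + B * (v \<bullet> v)"
    by (rule bilinear_bound[OF Q(1), of 1]) (simp, blast)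
  let ?V = "\<lambda>s. z s \<bullet> (Q *\<^sub>v z s)"
  \<comment> \<open>The cross term takes \<open>c / 2\<close> of the dissipation \<open>c\<close>;
    doubling leaves \<open>- c * (z s \<bullet> z s) + 2 * K * (g s \<bullet> g s)\<close>. Since
    \<open>?V s \<le> (1 + B) * (z s \<bullet> z s)\<close>, the rate in terms of \<open>?V\<close>
    is \<open>c / (1 + B)\<close>.\<close>
  have "(?V \<longlongrightarrow> 0) at_top"
  proof (rule comparison_tendsto_zero[where F = "range t" and \<alpha> = "c / (1 + B)" and h = "\<lambda>s. 2 * K * (g s \<bullet> g s)"])
    show "c / (1 + B) > 0" using c B by simp
    show "((\<lambda>s. 2 * K * (g s \<bullet> g s)) \<longlongrightarrow> 0) at_top"
      using g unfolding vanishing_iff_norm by (auto intro: tendsto_mult_right_zero)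
    show "continuous_on {0..} ?V" by (rule quadratic_form_switched_solution(1)[OF Q(1) QT z t0])
    show "?V s \<ge> 0" if "s \<ge> 0" for s
      using e(2)[OF zc[OF that]] e(1) scalar_prod_self_nonneg[of "z s"]
      by (meson order_trans mult_nonneg_nonneg less_imp_le)
    show "finite (range t \<inter> {..b})" for b by (rule fin)
    fix s assume s: "s > 0" "s \<notin> range t"
    then have zs: "z s \<in> carrier_vec n" and gs: "g s \<in> carrier_vec n" using zc gc by auto
    have Mz: "M *\<^sub>v z s \<in> carrier_vec n" using M zs by simp
    have "z s \<bullet> (Q *\<^sub>v (M *\<^sub>v z s + g s)) = z s \<bullet> (Q *\<^sub>v (M *\<^sub>v z s)) + z s \<bullet> (Q *\<^sub>v g s)"
      using Q zs gs Mz by (simp add: mult_add_distrib_mat_vec[of _ n n] scalar_prod_add_distrib[of _ n])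
    then have "2 * (z s \<bullet> (Q *\<^sub>v (M *\<^sub>v z s + g s))) \<le> - c * (z s \<bullet> z s) + 2 * K * (g s \<bullet> g s)"
      using dis[OF zs] K[OF zs gs] by simp
    moreover have "c / (1 + B) * ?V s \<le> c / (1 + B) * ((1 + B) * (z s \<bullet> z s))"
      using B(2)[OF zs zs] B(1) c by (intro mult_left_mono) (auto simp: algebra_simps)
    then have "c / (1 + B) * ?V s \<le> c * (z s \<bullet> z s)" using B by simp
    ultimately have "2 * (z s \<bullet> (Q *\<^sub>v (M *\<^sub>v z s + g s))) \<le> - (c / (1 + B)) * ?V s + 2 * K * (g s \<bullet> g s)"
      by simp
    moreover have "(?V has_real_derivative 2 * (z s \<bullet> (Q *\<^sub>v (M *\<^sub>v z s + g s)))) (at s)"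
      by (rule quadratic_form_switched_solution(2)[OF Q(1) QT z t0 s]) (use Mz gs in simp)
    ultimately show "\<exists>D. (?V has_real_derivative D) (at s) \<and> D \<le> - (c / (1 + B)) * ?V s + 2 * K * (g s \<bullet> g s)"
      by blast
  qed
  then have lim: "((\<lambda>s. ?V s / e) \<longlongrightarrow> 0) at_top" by (rule tendsto_divide_zero)
  have "((\<lambda>s. z s \<bullet> z s) \<longlongrightarrow> 0) at_top"
  proof (rule tendsto_sandwich[OF _ _ tendsto_const lim])
    show "eventually (\<lambda>s. z s \<bullet> z s \<le> ?V s / e) at_top"
      using eventually_ge_at_top[of "0::real"]
      by eventually_elim (use e zc in \<open>simp add: field_simps\<close>)
  qed (simp add: scalar_prod_self_nonneg)
  then show ?thesis using zc by (simp add: vanishing_iff_norm)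
qed

section \<open>The leader observers\<close>

lemma smult_mat_mult_vec:
  fixes M :: "'a :: comm_semiring_0 mat"
  assumes "M \<in> carrier_mat nr nc" "v \<in> carrier_vec nc"
  shows "(k \<cdot>\<^sub>m M) *\<^sub>v v = k \<cdot>\<^sub>v (M *\<^sub>v v)"
  using assms by (intro eq_vecI) (auto simp: scalar_prod_def sum_distrib_left mult.assoc intro!: sum.cong)

text \<open>The two products with \<open>P\<close> are transposes of each other and so contribute
  equally. This scalar version of the matrix inequality is used in both directions: to verify it for
  a constructed \<open>P\<close>, and to exploit it for a given one.\<close>

lemma observer_form:
  fixes P S\<^sub>0 F\<^sub>0 :: "real mat"
  assumes P: "P \<in> carrier_mat n n" "transpose_mat P = P"
    and S: "S\<^sub>0 \<in> carrier_mat n n" and F: "F\<^sub>0 \<in> carrier_mat l n" and v: "v \<in> carrier_vec n"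
  shows "v \<bullet> (- (P * S\<^sub>0 + transpose_mat S\<^sub>0 * P - 2 \<cdot>\<^sub>m (transpose_mat F\<^sub>0 * F\<^sub>0)) *\<^sub>v v)
    = 2 * ((F\<^sub>0 *\<^sub>v v) \<bullet> (F\<^sub>0 *\<^sub>v v)) - 2 * (v \<bullet> (P *\<^sub>v (S\<^sub>0 *\<^sub>v v)))"
proof -
  have Sv: "S\<^sub>0 *\<^sub>v v \<in> carrier_vec n" and Fv: "F\<^sub>0 *\<^sub>v v \<in> carrier_vec l" using S F v by auto
  have G: "P * S\<^sub>0 \<in> carrier_mat n n" using P S by simp
  have "transpose_mat S\<^sub>0 * P = transpose_mat (P * S\<^sub>0)"
    using transpose_mult[OF P(1) S] P(2) by simp
  then have lhs: "v \<bullet> ((P * S\<^sub>0 + transpose_mat S\<^sub>0 * P) *\<^sub>v v) = 2 * (v \<bullet> (P *\<^sub>v (S\<^sub>0 *\<^sub>v v)))"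
    using quadratic_form_add_transpose[OF G v] P S v by simp
  have R: "transpose_mat F\<^sub>0 * F\<^sub>0 \<in> carrier_mat n n" using F by simp
  have "v \<bullet> ((transpose_mat F\<^sub>0 * F\<^sub>0) *\<^sub>v v) = (transpose_mat F\<^sub>0 *\<^sub>v (F\<^sub>0 *\<^sub>v v)) \<bullet> v"
    using F v Fv by (subst comm_scalar_prod[of _ n]) auto
  also have "\<dots> = (F\<^sub>0 *\<^sub>v v) \<bullet> (F\<^sub>0 *\<^sub>v v)" by (rule transpose_vec_mult_scalar[OF F v Fv])
  finally have rhs: "v \<bullet> ((2 \<cdot>\<^sub>m (transpose_mat F\<^sub>0 * F\<^sub>0)) *\<^sub>v v) = 2 * ((F\<^sub>0 *\<^sub>v v) \<bullet> (F\<^sub>0 *\<^sub>v v))"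
    using R v by (simp add: smult_mat_mult_vec[OF R v])
  have M: "P * S\<^sub>0 + transpose_mat S\<^sub>0 * P \<in> carrier_mat n n" using P S by simp
  have R2: "2 \<cdot>\<^sub>m (transpose_mat F\<^sub>0 * F\<^sub>0) \<in> carrier_mat n n" using R by simp
  have Mv: "(P * S\<^sub>0 + transpose_mat S\<^sub>0 * P) *\<^sub>v v \<in> carrier_vec n" using M v by simp
  have Rv: "(2 \<cdot>\<^sub>m (transpose_mat F\<^sub>0 * F\<^sub>0)) *\<^sub>v v \<in> carrier_vec n" using R2 v by simp
  have "v \<bullet> (- (P * S\<^sub>0 + transpose_mat S\<^sub>0 * P - 2 \<cdot>\<^sub>m (transpose_mat F\<^sub>0 * F\<^sub>0)) *\<^sub>v v)
      = - (v \<bullet> ((P * S\<^sub>0 + transpose_mat S\<^sub>0 * P - 2 \<cdot>\<^sub>m (transpose_mat F\<^sub>0 * F\<^sub>0)) *\<^sub>v v))"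
    using minus_carrier_mat[OF R2] M R2 v by (subst uminus_mult_mat_vec) auto
  also have "\<dots> = - (2 * (v \<bullet> (P *\<^sub>v (S\<^sub>0 *\<^sub>v v))) - 2 * ((F\<^sub>0 *\<^sub>v v) \<bullet> (F\<^sub>0 *\<^sub>v v)))"
    unfolding minus_mult_distrib_mat_vec[OF M R2 v] scalar_prod_minus_distrib[OF v Mv Rv] lhs rhs ..
  finally show ?thesis by simp
qed

lemma observer_matrix_symmetric:
  fixes P S\<^sub>0 F\<^sub>0 :: "real mat"
  assumes P: "P \<in> carrier_mat n n" "transpose_mat P = P"
    and S: "S\<^sub>0 \<in> carrier_mat n n" and F: "F\<^sub>0 \<in> carrier_mat l n"
  defines "M \<equiv> - (P * S\<^sub>0 + transpose_mat S\<^sub>0 * P - 2 \<cdot>\<^sub>m (transpose_mat F\<^sub>0 * F\<^sub>0))"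
  shows "M \<in> carrier_mat n n" "transpose_mat M = M"
proof -
  define G where "G = P * S\<^sub>0"
  define R where "R = transpose_mat F\<^sub>0 * F\<^sub>0"
  have G: "G \<in> carrier_mat n n" using P S by (simp add: G_def)
  have R: "R \<in> carrier_mat n n" using F by (simp add: R_def)
  have RT: "transpose_mat R = R"
    unfolding R_def using F by (simp add: transpose_mult[of _ n l _ n])
  have R_sym: "R $$ (j, i) = R $$ (i, j)" if "i < n" "j < n" for i j
    using arg_cong[OF RT, of "\<lambda>X. X $$ (i, j)"] R that by simp
  have "transpose_mat S\<^sub>0 * P = transpose_mat G"
    unfolding G_def using transpose_mult[OF P(1) S] P(2) by simp
  then have M: "M = - (G + transpose_mat G - 2 \<cdot>\<^sub>m R)" by (simp add: M_def G_def R_def)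
  show "M \<in> carrier_mat n n" unfolding M using G R by (intro uminus_carrier_mat minus_carrier_mat) auto
  show "transpose_mat M = M"
    unfolding M using G R R_sym by (intro eq_matI) auto
qed

text \<open>\<open>P\<close> is a multiple of a Lyapunov matrix of \<open>S\<^sub>0 + L F\<^sub>0\<close>; after Young's inequality the
  term \<open>L F\<^sub>0\<close> costs only a multiple of \<open>|F\<^sub>0 v|\<^sup>2\<close>, which the scaling normalizes.\<close>

lemma detectable_observer_matrix:
  assumes det: "detectable F\<^sub>0 S\<^sub>0" and S: "S\<^sub>0 \<in> carrier_mat n n" and F: "F\<^sub>0 \<in> carrier_mat l n"
  obtains P where "P \<in> carrier_mat n n" "sym_pos_def P"
    "sym_pos_def (- (P * S\<^sub>0 + transpose_mat S\<^sub>0 * P - 2 \<cdot>\<^sub>m (transpose_mat F\<^sub>0 * F\<^sub>0)))"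
proof -
  obtain L where L: "L \<in> carrier_mat n l" and hur: "hurwitz (S\<^sub>0 + L * F\<^sub>0)"
    using det S F by (auto simp: detectable_def)
  have SLF: "S\<^sub>0 + L * F\<^sub>0 \<in> carrier_mat n n" using S L F by simp
  obtain Q c where Q: "Q \<in> carrier_mat n n" "sym_pos_def Q" and c: "c > 0"
    and dis: "\<And>v. v \<in> carrier_vec n \<Longrightarrow> v \<bullet> (Q *\<^sub>v ((S\<^sub>0 + L * F\<^sub>0) *\<^sub>v v)) \<le> - c * (v \<bullet> v)"
    by (rule hurwitz_lyapunov_coercive[OF hur SLF]) blast
  have QT: "transpose_mat Q = Q" using Q by (simp add: sym_pos_def_def)
  \<comment> \<open>The sign is negative because the output injection term moves to the other side
    when \<open>v \<bullet> (Q *\<^sub>v (S\<^sub>0 *\<^sub>v v))\<close> is isolated.\<close>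
  have QL: "- (Q * L) \<in> carrier_mat n l" using Q L by simp
  obtain K where K: "K > 0" "\<And>u v. u \<in> carrier_vec n \<Longrightarrow> v \<in> carrier_vec l \<Longrightarrow>
      u \<bullet> (- (Q * L) *\<^sub>v v) \<le> c / 2 * (u \<bullet> u) + K * (v \<bullet> v)"
    by (rule bilinear_bound[OF QL, of "c / 2"]) (use c in \<open>simp, blast\<close>)
  define P where "P = (1 / K) \<cdot>\<^sub>m Q"
  have P: "P \<in> carrier_mat n n" using Q by (simp add: P_def)
  have Pv: "P *\<^sub>v v = (1 / K) \<cdot>\<^sub>v (Q *\<^sub>v v)" if "v \<in> carrier_vec n" for v
    unfolding P_def by (rule smult_mat_mult_vec[OF Q(1) that])
  have Qsym: "Q $$ (j, i) = Q $$ (i, j)" if "i < n" "j < n" for i j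
    using arg_cong[OF QT, of "\<lambda>X. X $$ (i, j)"] Q that by simp
  have PT: "transpose_mat P = P"
    unfolding P_def using Q Qsym by (intro eq_matI) auto
  have spd: "sym_pos_def P"
    using Q K P PT unfolding sym_pos_def_def by (auto simp: Pv)
  let ?M = "- (P * S\<^sub>0 + transpose_mat S\<^sub>0 * P - 2 \<cdot>\<^sub>m (transpose_mat F\<^sub>0 * F\<^sub>0))"
  note M = observer_matrix_symmetric[OF P PT S F]
  have "v \<bullet> (?M *\<^sub>v v) > 0" if v: "v \<in> carrier_vec n" "v \<noteq> 0\<^sub>v n" for v
  proof -
    have Sv: "S\<^sub>0 *\<^sub>v v \<in> carrier_vec n" and Fv: "F\<^sub>0 *\<^sub>v v \<in> carrier_vec l" using S F v by auto
    have LFv: "L *\<^sub>v (F\<^sub>0 *\<^sub>v v) \<in> carrier_vec n" using L Fv by simp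
    have "(S\<^sub>0 + L * F\<^sub>0) *\<^sub>v v = S\<^sub>0 *\<^sub>v v + L *\<^sub>v (F\<^sub>0 *\<^sub>v v)"
      using S L F v by (simp add: add_mult_distrib_mat_vec[of _ n n])
    then have "v \<bullet> (Q *\<^sub>v (S\<^sub>0 *\<^sub>v v)) + v \<bullet> (Q *\<^sub>v (L *\<^sub>v (F\<^sub>0 *\<^sub>v v))) \<le> - c * (v \<bullet> v)"
      using dis[OF v(1)] Q v Sv LFv
      by (simp add: mult_add_distrib_mat_vec[of _ n n] scalar_prod_add_distrib[of _ n])
    moreover have "v \<bullet> (- (Q * L) *\<^sub>v (F\<^sub>0 *\<^sub>v v)) = - (v \<bullet> (Q *\<^sub>v (L *\<^sub>v (F\<^sub>0 *\<^sub>v v))))"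
      using Q L F v Fv LFv by (subst uminus_mult_mat_vec) auto
    ultimately have "v \<bullet> (Q *\<^sub>v (S\<^sub>0 *\<^sub>v v)) \<le> - (c / 2) * (v \<bullet> v) + K * ((F\<^sub>0 *\<^sub>v v) \<bullet> (F\<^sub>0 *\<^sub>v v))"
      using K(2)[OF v(1) Fv] by simp
    moreover have "c / 2 * (v \<bullet> v) > 0" using c scalar_prod_self_pos[OF v] by simp
    ultimately have "v \<bullet> (Q *\<^sub>v (S\<^sub>0 *\<^sub>v v)) < K * ((F\<^sub>0 *\<^sub>v v) \<bullet> (F\<^sub>0 *\<^sub>v v))" by simp
    then have "1 / K * (v \<bullet> (Q *\<^sub>v (S\<^sub>0 *\<^sub>v v))) < (F\<^sub>0 *\<^sub>v v) \<bullet> (F\<^sub>0 *\<^sub>v v)"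
      using K(1) by (simp add: field_simps)
    moreover have "v \<bullet> (P *\<^sub>v (S\<^sub>0 *\<^sub>v v)) = 1 / K * (v \<bullet> (Q *\<^sub>v (S\<^sub>0 *\<^sub>v v)))"
      using Q v Sv by (simp add: Pv[OF Sv])
    ultimately show ?thesis unfolding observer_form[OF P PT S F v(1)] by simp
  qed
  then have "sym_pos_def ?M" using M unfolding sym_pos_def_def by auto
  with that P spd show ?thesis by blast
qed

section \<open>Grounded Laplacians and the quadratic form of a graph\<close>

lemma grounded_laplacian_carrier: "grounded_laplacian N a \<in> carrier_mat N N"
  by (simp add: grounded_laplacian_def laplacian_def mat_delete_def)

text \<open>Deleting row and column 0 shifts the indices: position \<open>i\<close> belongs to
  follower \<open>Suc i\<close>. The degree on the diagonal still counts the edge from the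
  leader.\<close>

lemma grounded_laplacian_index:
  assumes "i < N" "j < N"
  shows "grounded_laplacian N a $$ (i, j) =
    (if i = j then \<Sum>k \<in> {0..N} - {Suc i}. a (Suc i) k else - a (Suc i) (Suc j))"
  using assms by (simp add: grounded_laplacian_def laplacian_def mat_delete_def)

lemma grounded_laplacian_symmetric:
  assumes "graph_connected N a"
  shows "transpose_mat (grounded_laplacian N a) = grounded_laplacian N a"
proof (rule eq_matI)
  fix i j assume "i < dim_row (grounded_laplacian N a)" "j < dim_col (grounded_laplacian N a)"
  then have "i < N" "j < N" using grounded_laplacian_carrier[of N a] by auto
  moreover from this have "a (Suc i) (Suc j) = a (Suc j) (Suc i)"
    using assms by (auto simp: graph_connected_def)
  ultimately show "transpose_mat (grounded_laplacian N a) $$ (i, j) = grounded_laplacian N a $$ (i, j)"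
    using grounded_laplacian_carrier[of N a] by (simp add: grounded_laplacian_index)
qed (use grounded_laplacian_carrier[of N a] in auto)

text \<open>The quadratic form of the grounded Laplacian when \<open>w 0 = 0\<close>, written over
  the nodes themselves. Follower indices stay unshifted, and the inner sum has the shape in which
  the coupling of the observers produces it.\<close>

definition graph_form :: "nat \<Rightarrow> (nat \<Rightarrow> nat \<Rightarrow> real) \<Rightarrow> (nat \<Rightarrow> real) \<Rightarrow> real" where
  "graph_form N a w = (\<Sum>i = 1..N. w i * (\<Sum>j = 0..N. a i j * (w i - w j)))"

lemma grounded_laplacian_form:
  assumes a: "comm_graph N a" and w0: "w 0 = 0"
  defines "v \<equiv> vec N (\<lambda>i. w (Suc i))"
  shows "v \<bullet> (grounded_laplacian N a *\<^sub>v v) = graph_form N a w"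
proof -
  have row: "(\<Sum>j<N. grounded_laplacian N a $$ (i, j) * w (Suc j))
      = (\<Sum>j = 0..N. a (Suc i) j * (w (Suc i) - w j))" if i: "i < N" for i
  proof -
    have aii: "a (Suc i) (Suc i) = 0" using a i by (auto simp: comm_graph_def)
    \<comment> \<open>The diagonal weight and the value at the leader are zero, so the terms
      \<open>k = Suc i\<close> here and \<open>j = 0\<close> below can be added, and both sums run
      over all nodes.\<close>
    have deg: "(\<Sum>k \<in> {0..N} - {Suc i}. a (Suc i) k) = (\<Sum>k = 0..N. a (Suc i) k)"
      using i aii by (subst sum.remove[of "{0..N}" "Suc i"]) auto
    have "(\<Sum>j<N. grounded_laplacian N a $$ (i, j) * w (Suc j))
        = (\<Sum>j<N. (if j = i then (\<Sum>k = 0..N. a (Suc i) k) * w (Suc i) else 0) - a (Suc i) (Suc j) * w (Suc j))"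
      using i aii by (intro sum.cong) (auto simp: grounded_laplacian_index deg)
    also have "\<dots> = (\<Sum>k = 0..N. a (Suc i) k) * w (Suc i) - (\<Sum>j<N. a (Suc i) (Suc j) * w (Suc j))"
      using i by (simp add: sum_subtractf)
    also have "(\<Sum>j<N. a (Suc i) (Suc j) * w (Suc j)) = (\<Sum>j = 0..N. a (Suc i) j * w j)"
      using w0 by (simp add: atMost_atLeast0[symmetric] sum.atMost_shift)
    finally show ?thesis
      by (simp add: right_diff_distrib sum_subtractf sum_distrib_right)
  qed
  have v: "v \<in> carrier_vec N" by (simp add: v_def)
  have "v \<bullet> (grounded_laplacian N a *\<^sub>v v)
      = (\<Sum>i<N. w (Suc i) * (\<Sum>j<N. grounded_laplacian N a $$ (i, j) * w (Suc j)))"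
    unfolding scalar_prod_mat_vec[OF grounded_laplacian_carrier v v]
    by (simp add: v_def sum_distrib_left mult.assoc)
  also have "\<dots> = (\<Sum>i<N. w (Suc i) * (\<Sum>j = 0..N. a (Suc i) j * (w (Suc i) - w j)))"
    by (intro sum.cong refl) (simp add: row)
  also have "\<dots> = graph_form N a w"
    by (simp add: graph_form_def sum.atLeast1_atMost_eq)
  finally show ?thesis .
qed

text \<open>Exchanging \<open>i\<close> and \<open>j\<close> in the part between followers, where
  the weights are symmetric, and averaging gives squares of differences. Edges from the leader have
  no partner, hence their factor 2.\<close>

lemma graph_form_sum_squares:
  assumes con: "graph_connected N a" and w0: "w 0 = 0"
  shows "2 * graph_form N a w =
    (\<Sum>i = 1..N. \<Sum>j = 1..N. a i j * (w i - w j)\<^sup>2) + 2 * (\<Sum>i = 1..N. a i 0 * (w i)\<^sup>2)"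
proof -
  define X where "X = (\<Sum>i = 1..N. \<Sum>j = 1..N. w i * (a i j * (w i - w j)))"
  have "X = (\<Sum>j = 1..N. \<Sum>i = 1..N. w i * (a i j * (w i - w j)))"
    unfolding X_def by (rule sum.swap)
  also have "\<dots> = (\<Sum>i = 1..N. \<Sum>j = 1..N. w j * (a i j * (w j - w i)))"
    using con by (intro sum.cong refl) (auto simp: graph_connected_def)
  finally have "2 * X = X + (\<Sum>i = 1..N. \<Sum>j = 1..N. w j * (a i j * (w j - w i)))" by simp
  also have "\<dots> = (\<Sum>i = 1..N. \<Sum>j = 1..N. a i j * (w i - w j)\<^sup>2)"
    unfolding X_def sum.distrib[symmetric]
    by (intro sum.cong refl) (simp add: power2_eq_square algebra_simps)
  finally have X: "2 * X = (\<Sum>i = 1..N. \<Sum>j = 1..N. a i j * (w i - w j)\<^sup>2)" .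
  have "(\<Sum>j = 0..N. a i j * (w i - w j)) = a i 0 * w i + (\<Sum>j = 1..N. a i j * (w i - w j))" for i
    using w0 by (simp add: sum.atLeast_Suc_atMost)
  then have "graph_form N a w = (\<Sum>i = 1..N. a i 0 * (w i)\<^sup>2) + X"
    by (simp add: graph_form_def X_def ring_distribs sum.distrib sum_distrib_left power2_eq_square mult_ac)
  with X show ?thesis by simp
qed

text \<open>If the form were not positive, all squares would vanish: followers joined by an edge
  would agree, and followers that hear the leader would have value 0. The value 0 then spreads along
  the directed paths from the leader to every node.\<close>

lemma graph_form_pos:
  assumes a: "comm_graph N a" and con: "graph_connected N a" and w0: "w 0 = 0"
    and k: "k \<in> {1..N}" "w k \<noteq> 0"
  shows "graph_form N a w > 0"
proof (rule ccontr)
  assume neg: "\<not> ?thesis"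
  have a_nonneg: "a i j \<ge> 0" if "i \<in> {0..N}" "j \<in> {0..N}" for i j
    using a that by (auto simp: comm_graph_def)
  let ?X = "\<Sum>i = 1..N. \<Sum>j = 1..N. a i j * (w i - w j)\<^sup>2" and ?Y = "\<Sum>i = 1..N. a i 0 * (w i)\<^sup>2"
  have "?X \<ge> 0" "?Y \<ge> 0" by (auto intro!: sum_nonneg mult_nonneg_nonneg a_nonneg)
  with neg graph_form_sum_squares[where w = w, OF con w0] have "?X = 0" "?Y = 0" by auto
  have X: "a i j * (w i - w j)\<^sup>2 = 0" if "i \<in> {1..N}" "j \<in> {1..N}" for i j
  proof -
    have "(\<Sum>j = 1..N. a i j * (w i - w j)\<^sup>2) = 0"
      using \<open>?X = 0\<close> that(1)
      by (subst (asm) sum_nonneg_eq_0_iff) (auto intro!: sum_nonneg mult_nonneg_nonneg a_nonneg)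
    then show ?thesis
      using that by (subst (asm) sum_nonneg_eq_0_iff) (auto intro!: mult_nonneg_nonneg a_nonneg)
  qed
  from \<open>?Y = 0\<close> have Y: "a i 0 * (w i)\<^sup>2 = 0" if "i \<in> {1..N}" for i
    using that by (subst (asm) sum_nonneg_eq_0_iff) (auto intro!: mult_nonneg_nonneg a_nonneg)
  have "(0, i) \<in> (graph_edges N a)\<^sup>* \<Longrightarrow> w i = 0" for i
  proof (induction rule: rtrancl_induct)
    case base
    show ?case by (rule w0)
  next
    case (step j i)
    then have e: "j \<in> {0..N}" "i \<in> {0..N}" "a i j > 0" by (auto simp: graph_edges_def)
    show ?case
    proof (cases "i = 0")
      case True
      then show ?thesis by (simp add: w0)
    next
      case i: False
      show ?thesis
      proof (cases "j = 0")
        case True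
        then show ?thesis using Y[of i] e i by auto
      next
        case False
        then show ?thesis using X[of i j] e i step.IH by auto
      qed
    qed
  qed
  with con k show False by (auto simp: graph_connected_def)
qed

text \<open>Positivity comes from \<open>graph_form_pos\<close> at an eigenvector; the lower bound
  comes from the least eigenvalue of the graph concerned, which is at least the common minimum.
  \<open>N \<ge> 1\<close> and \<open>\<kappa> \<ge> 1\<close> make the set under \<open>Min\<close>
  nonempty.\<close>

lemma lambda_bar_bounds:
  assumes N: "N \<ge> 1" and \<kappa>: "\<kappa> \<ge> 1"
    and a: "\<And>p. p \<in> {1..\<kappa>} \<Longrightarrow> comm_graph N (a p)"
    and con: "\<And>p. p \<in> {1..\<kappa>} \<Longrightarrow> graph_connected N (a p)"
  shows "lambda_bar N \<kappa> a > 0"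
    and "p \<in> {1..\<kappa>} \<Longrightarrow> w 0 = 0 \<Longrightarrow> graph_form N (a p) w \<ge> lambda_bar N \<kappa> a * (\<Sum>i = 1..N. (w i)\<^sup>2)"
proof -
  let ?H = "\<lambda>p. grounded_laplacian N (a p)"
  let ?Sp = "\<Union>p \<in> {1..\<kappa>}. spectrum (?H p)"
  have least: "\<exists>\<mu> \<in> spectrum (?H p). \<forall>v \<in> carrier_vec N. v \<bullet> (?H p *\<^sub>v v) \<ge> \<mu> * (v \<bullet> v)"
    if p: "p \<in> {1..\<kappa>}" for p
    by (rule symmetric_least_eigenvalue[OF grounded_laplacian_carrier
          grounded_laplacian_symmetric[OF con[OF p]]]) (use N in auto)
  have fin: "finite ?Sp"
    using card_finite_spectrum(1)[OF grounded_laplacian_carrier] by blast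
  have ne: "?Sp \<noteq> {}" using least[of 1] \<kappa> by auto
  have "\<mu> > 0" if "\<mu> \<in> ?Sp" for \<mu>
  proof -
    from that obtain p v where p: "p \<in> {1..\<kappa>}" and v: "v \<in> carrier_vec N" "v \<noteq> 0\<^sub>v N"
      and ev: "?H p *\<^sub>v v = \<mu> \<cdot>\<^sub>v v"
      using carrier_matD(1)[OF grounded_laplacian_carrier]
      by (auto simp: spectrum_def eigenvalue_def eigenvector_def)
    \<comment> \<open>The eigenvector is extended by the value 0 at the leader; follower
      \<open>i\<close> sits at position \<open>i - 1\<close>.\<close>
    define w where "w i = (if i = 0 then 0 else v $ (i - 1))" for i
    have vw: "vec N (\<lambda>i. w (Suc i)) = v" using v by (intro eq_vecI) (auto simp: w_def)
    obtain k where "k < N" "v $ k \<noteq> 0"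
      using v by (metis carrier_vecD eq_vecI index_zero_vec)
    then have "graph_form N (a p) w > 0"
      by (intro graph_form_pos[of _ _ _ "Suc k"] a con p) (auto simp: w_def)
    moreover have "graph_form N (a p) w = v \<bullet> (?H p *\<^sub>v v)"
      using grounded_laplacian_form[OF a[OF p], of w] vw by (simp add: w_def)
    moreover have "v \<bullet> (?H p *\<^sub>v v) = \<mu> * (v \<bullet> v)" unfolding ev using v by simp
    ultimately have "\<mu> * (v \<bullet> v) > 0" by simp
    then show ?thesis using scalar_prod_self_pos[OF v] by (simp add: zero_less_mult_iff)
  qed
  then show "lambda_bar N \<kappa> a > 0" unfolding lambda_bar_def using Min_in[OF fin ne] by blast
  assume p: "p \<in> {1..\<kappa>}" and w0: "w 0 = 0"
  from least[OF p] obtain \<mu> where \<mu>: "\<mu> \<in> spectrum (?H p)"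
    "\<And>v. v \<in> carrier_vec N \<Longrightarrow> v \<bullet> (?H p *\<^sub>v v) \<ge> \<mu> * (v \<bullet> v)" by blast
  have le: "lambda_bar N \<kappa> a \<le> \<mu>" unfolding lambda_bar_def using fin \<mu>(1) p by (intro Min_le) auto
  let ?v = "vec N (\<lambda>i. w (Suc i))"
  have vv: "?v \<bullet> ?v = (\<Sum>i = 1..N. (w i)\<^sup>2)"
    by (simp add: scalar_prod_def sum.atLeast1_atMost_eq lessThan_atLeast0 power2_eq_square)
  have "lambda_bar N \<kappa> a * (?v \<bullet> ?v) \<le> \<mu> * (?v \<bullet> ?v)"
    by (rule mult_right_mono[OF le scalar_prod_self_nonneg])
  also have "\<dots> \<le> ?v \<bullet> (?H p *\<^sub>v ?v)" by (rule \<mu>(2)) simp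
  also have "\<dots> = graph_form N (a p) w" by (rule grounded_laplacian_form[where w = w, OF a[OF p] w0])
  finally show "graph_form N (a p) w \<ge> lambda_bar N \<kappa> a * (\<Sum>i = 1..N. (w i)\<^sup>2)" by (simp only: vv)
qed

lemma mu_star_graph_form:
  assumes N: "N \<ge> 1" and \<kappa>: "\<kappa> \<ge> 1"
    and a: "\<And>p. p \<in> {1..\<kappa>} \<Longrightarrow> comm_graph N (a p)"
    and con: "\<And>p. p \<in> {1..\<kappa>} \<Longrightarrow> graph_connected N (a p)"
    and p: "p \<in> {1..\<kappa>}" and w0: "w 0 = 0"
  shows "mu_star N \<kappa> a * graph_form N (a p) w \<ge> (\<Sum>i = 1..N. (w i)\<^sup>2)"
proof -
  let ?b = "lambda_bar N \<kappa> a"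
  have b: "?b > 0" by (rule lambda_bar_bounds(1)[OF N \<kappa> a con])
  have le: "?b * (\<Sum>i = 1..N. (w i)\<^sup>2) \<le> graph_form N (a p) w"
    by (rule lambda_bar_bounds(2)[where w = w, OF N \<kappa> a con p w0])
  have nn: "(\<Sum>i = 1..N. (w i)\<^sup>2) \<ge> 0" by (intro sum_nonneg) auto
  have "(\<Sum>i = 1..N. (w i)\<^sup>2) = 1 / ?b * (?b * (\<Sum>i = 1..N. (w i)\<^sup>2))" using b by simp
  also have "\<dots> \<le> mu_star N \<kappa> a * (?b * (\<Sum>i = 1..N. (w i)\<^sup>2))"
    using b nn by (intro mult_right_mono) (auto simp: mu_star_def)
  also have "\<dots> \<le> mu_star N \<kappa> a * graph_form N (a p) w"
    by (rule mult_left_mono[OF le]) (auto simp: mu_star_def)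
  finally show ?thesis .
qed

text \<open>The signal \<open>\<eta>\<^sub>v\<close> at a fixed time, the leader being included as
  \<open>j = 0\<close>. Building it with \<open>vec n\<close> fixes its dimension whatever the
  arguments are.\<close>

definition diffusive_sum :: "nat \<Rightarrow> nat \<Rightarrow> (nat \<Rightarrow> nat \<Rightarrow> real) \<Rightarrow> (nat \<Rightarrow> real vec) \<Rightarrow> nat \<Rightarrow> real vec" where
  "diffusive_sum n N a e i = vec n (\<lambda>k. \<Sum>j = 0..N. a i j * (e i $ k - e j $ k))"

lemma mult_mat_diffusive_sum:
  assumes F: "F \<in> carrier_mat l n" and e: "\<And>j. j \<in> {0..N} \<Longrightarrow> e j \<in> carrier_vec n" and i: "i \<in> {0..N}"
  shows "F *\<^sub>v diffusive_sum n N a e i = diffusive_sum l N a (\<lambda>j. F *\<^sub>v e j) i"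
proof (rule eq_vecI)
  fix k assume "k < dim_vec (diffusive_sum l N a (\<lambda>j. F *\<^sub>v e j) i)"
  then have k: "k < l" by (simp add: diffusive_sum_def)
  have Fe: "(F *\<^sub>v e j) $ k = (\<Sum>h<n. F $$ (k, h) * e j $ h)" if "j \<in> {0..N}" for j
    using F k e[OF that] by (auto simp: scalar_prod_def lessThan_atLeast0 intro!: sum.cong)
  have "(F *\<^sub>v diffusive_sum n N a e i) $ k
      = (\<Sum>h<n. \<Sum>j = 0..N. F $$ (k, h) * (a i j * (e i $ h - e j $ h)))"
    using F k by (auto simp: diffusive_sum_def scalar_prod_def lessThan_atLeast0 sum_distrib_left intro!: sum.cong)
  also have "\<dots> = (\<Sum>j = 0..N. \<Sum>h<n. F $$ (k, h) * (a i j * (e i $ h - e j $ h)))"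
    by (rule sum.swap)
  also have "\<dots> = (\<Sum>j = 0..N. a i j * ((F *\<^sub>v e i) $ k - (F *\<^sub>v e j) $ k))"
  proof (intro sum.cong refl)
    fix j assume "j \<in> {0..N}"
    then show "(\<Sum>h<n. F $$ (k, h) * (a i j * (e i $ h - e j $ h))) = a i j * ((F *\<^sub>v e i) $ k - (F *\<^sub>v e j) $ k)"
      unfolding Fe[OF i] Fe[OF \<open>j \<in> {0..N}\<close>]
      by (simp add: sum_subtractf[symmetric] sum_distrib_left algebra_simps)
  qed
  finally show "(F *\<^sub>v diffusive_sum n N a e i) $ k = diffusive_sum l N a (\<lambda>j. F *\<^sub>v e j) i $ k"
    using k by (simp add: diffusive_sum_def)
qed (use F in \<open>simp add: diffusive_sum_def\<close>)

text \<open>The coupling acts on each of the \<open>l\<close> coordinates separately. Treating them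
  one by one does the work of the Kronecker product of the grounded Laplacian with an identity
  matrix.\<close>

lemma sum_scalar_prod_diffusive_sum:
  assumes f: "\<And>i. i \<in> {1..N} \<Longrightarrow> f i \<in> carrier_vec l"
  shows "(\<Sum>i = 1..N. f i \<bullet> diffusive_sum l N a f i) = (\<Sum>k<l. graph_form N a (\<lambda>i. f i $ k))"
proof -
  have "(\<Sum>i = 1..N. f i \<bullet> diffusive_sum l N a f i)
      = (\<Sum>i = 1..N. \<Sum>k<l. f i $ k * (\<Sum>j = 0..N. a i j * (f i $ k - f j $ k)))"
    by (auto simp: diffusive_sum_def scalar_prod_def lessThan_atLeast0 intro!: sum.cong)
  also have "\<dots> = (\<Sum>k<l. graph_form N a (\<lambda>i. f i $ k))"
    unfolding graph_form_def by (rule sum.swap)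
  finally show ?thesis .
qed

lemma observer_gain_inverse:
  assumes "observer_gain n S\<^sub>0 F\<^sub>0 \<mu> P L\<^sub>0"
  obtains B where "B \<in> carrier_mat n n" "P * B = 1\<^sub>m n" "L\<^sub>0 = (- \<mu>) \<cdot>\<^sub>m (B * transpose_mat F\<^sub>0)"
proof -
  from assms have P: "P \<in> carrier_mat n n" "sym_pos_def P"
    and L0: "L\<^sub>0 = (- \<mu>) \<cdot>\<^sub>m (the (mat_inverse P) * transpose_mat F\<^sub>0)"
    by (auto simp: observer_gain_def)
  obtain B where "mat_inverse P = Some B" "P * B = 1\<^sub>m n" "B \<in> carrier_mat n n"
    by (rule injective_mat_inverse[OF P(1) sym_pos_def_injective[OF P(2,1)]]) auto
  with L0 that show ?thesis by simp
qed

lemma observer_gain_carrier: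
  assumes "observer_gain n S\<^sub>0 F\<^sub>0 \<mu> P L\<^sub>0" "F\<^sub>0 \<in> carrier_mat l n"
  shows "L\<^sub>0 \<in> carrier_mat n l"
  using observer_gain_inverse[OF assms(1)] assms(2)
  by (metis mult_carrier_mat smult_carrier_mat transpose_carrier_mat)

text \<open>Since \<open>P L\<^sub>0 = - \<mu> F\<^sub>0\<^sup>T\<close>, the coupling contributes \<open>- \<mu>\<close> times the graph forms of the components
  of \<open>F\<^sub>0 e\<close>, and \<open>\<mu> \<ge> 1 / \<lambda>\<close> makes these dominate \<open>\<Sum>|F\<^sub>0 e\<^sub>i|\<^sup>2\<close> whatever the active graph.\<close>

lemma coupled_observer_dissipation:
  assumes obs: "observer_gain n S\<^sub>0 F\<^sub>0 \<mu> P L\<^sub>0"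
    and S: "S\<^sub>0 \<in> carrier_mat n n" and F: "F\<^sub>0 \<in> carrier_mat l n"
  obtains c where "c > 0"
    "\<And>N a e. (\<And>w. w 0 = 0 \<Longrightarrow> \<mu> * graph_form N a w \<ge> (\<Sum>i = 1..N. (w i)\<^sup>2)) \<Longrightarrow> e 0 = 0\<^sub>v n \<Longrightarrow>
      (\<And>i. i \<in> {0..N} \<Longrightarrow> e i \<in> carrier_vec n) \<Longrightarrow>
      (\<Sum>i = 1..N. 2 * (e i \<bullet> (P *\<^sub>v (S\<^sub>0 *\<^sub>v e i + (L\<^sub>0 * F\<^sub>0) *\<^sub>v diffusive_sum n N a e i))))
      \<le> - c * (\<Sum>i = 1..N. e i \<bullet> e i)"
proof -
  from obs have P: "P \<in> carrier_mat n n" "sym_pos_def P"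
    and M: "sym_pos_def (- (P * S\<^sub>0 + transpose_mat S\<^sub>0 * P - 2 \<cdot>\<^sub>m (transpose_mat F\<^sub>0 * F\<^sub>0)))"
    by (auto simp: observer_gain_def)
  have PT: "transpose_mat P = P" using P by (simp add: sym_pos_def_def)
  obtain c where c: "c > 0" and dis: "\<And>v. v \<in> carrier_vec n \<Longrightarrow>
      v \<bullet> (- (P * S\<^sub>0 + transpose_mat S\<^sub>0 * P - 2 \<cdot>\<^sub>m (transpose_mat F\<^sub>0 * F\<^sub>0)) *\<^sub>v v) \<ge> c * (v \<bullet> v)"
    by (rule sym_pos_def_coercive[OF M observer_matrix_symmetric(1)[OF P(1) PT S F]]) blast
  obtain B where B: "B \<in> carrier_mat n n" "P * B = 1\<^sub>m n"
    and L0: "L\<^sub>0 = (- \<mu>) \<cdot>\<^sub>m (B * transpose_mat F\<^sub>0)"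
    by (rule observer_gain_inverse[OF obs])
  have FT: "transpose_mat F\<^sub>0 \<in> carrier_mat n l" using F by simp
  have L: "L\<^sub>0 \<in> carrier_mat n l" by (rule observer_gain_carrier[OF obs F])
  have PL: "P *\<^sub>v (L\<^sub>0 *\<^sub>v w) = (- \<mu>) \<cdot>\<^sub>v (transpose_mat F\<^sub>0 *\<^sub>v w)" if w: "w \<in> carrier_vec l" for w
  proof -
    have FTw: "transpose_mat F\<^sub>0 *\<^sub>v w \<in> carrier_vec n" using FT w by simp
    have BF: "B * transpose_mat F\<^sub>0 \<in> carrier_mat n l" using B FT by simp
    have "L\<^sub>0 *\<^sub>v w = (- \<mu>) \<cdot>\<^sub>v (B *\<^sub>v (transpose_mat F\<^sub>0 *\<^sub>v w))"
      unfolding L0 smult_mat_mult_vec[OF BF w] assoc_mult_mat_vec[OF B(1) FT w] ..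
    moreover have "P *\<^sub>v (B *\<^sub>v (transpose_mat F\<^sub>0 *\<^sub>v w)) = transpose_mat F\<^sub>0 *\<^sub>v w"
      using assoc_mult_mat_vec[OF P(1) B(1) FTw] B(2) FTw by simp
    moreover have "B *\<^sub>v (transpose_mat F\<^sub>0 *\<^sub>v w) \<in> carrier_vec n" using B FTw by simp
    ultimately show ?thesis using mult_mat_vec[OF P(1)] by simp
  qed
  \<comment> \<open>The rate \<open>c\<close> is chosen before the graph and the errors, so it is
    the same for every active graph.\<close>
  show ?thesis
  proof (rule that[OF c])
    fix N a and e :: "nat \<Rightarrow> real vec"
    assume form: "\<And>w. w 0 = 0 \<Longrightarrow> \<mu> * graph_form N a w \<ge> (\<Sum>i = 1..N. (w i)\<^sup>2)"
      and e0: "e 0 = 0\<^sub>v n" and e: "\<And>i. i \<in> {0..N} \<Longrightarrow> e i \<in> carrier_vec n"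
    let ?f = "\<lambda>i. F\<^sub>0 *\<^sub>v e i"
    have f: "?f i \<in> carrier_vec l" if "i \<in> {0..N}" for i using F e[OF that] by simp
    \<comment> \<open>The inequality for \<open>P\<close> leaves a surplus
      \<open>2 * (?f i \<bullet> ?f i)\<close> that need not be compensated within a single
      follower. It is paid by the coupling only after summation over all followers.\<close>
    have bound: "2 * (e i \<bullet> (P *\<^sub>v (S\<^sub>0 *\<^sub>v e i + (L\<^sub>0 * F\<^sub>0) *\<^sub>v diffusive_sum n N a e i)))
        \<le> - c * (e i \<bullet> e i) + 2 * (?f i \<bullet> ?f i) - 2 * \<mu> * (?f i \<bullet> diffusive_sum l N a ?f i)"
      if i: "i \<in> {1..N}" for i
    proof -
      let ?d = "diffusive_sum n N a e i" and ?g = "diffusive_sum l N a ?f i"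
      have i0: "i \<in> {0..N}" using i by simp
      have d: "?d \<in> carrier_vec n" and g: "?g \<in> carrier_vec l" by (simp_all add: diffusive_sum_def)
      have ei: "e i \<in> carrier_vec n" by (rule e[OF i0])
      have Sei: "S\<^sub>0 *\<^sub>v e i \<in> carrier_vec n" using S ei by simp
      have Lg: "L\<^sub>0 *\<^sub>v ?g \<in> carrier_vec n" using L g by simp
      have FTg: "transpose_mat F\<^sub>0 *\<^sub>v ?g \<in> carrier_vec n" using FT g by simp
      have Fd: "F\<^sub>0 *\<^sub>v ?d = ?g" by (rule mult_mat_diffusive_sum[OF F _ i0]) (rule e)
      have LFd: "(L\<^sub>0 * F\<^sub>0) *\<^sub>v ?d = L\<^sub>0 *\<^sub>v ?g"
        unfolding assoc_mult_mat_vec[OF L F d] Fd ..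
      have "e i \<bullet> (P *\<^sub>v (S\<^sub>0 *\<^sub>v e i + L\<^sub>0 *\<^sub>v ?g))
          = e i \<bullet> (P *\<^sub>v (S\<^sub>0 *\<^sub>v e i)) + e i \<bullet> (P *\<^sub>v (L\<^sub>0 *\<^sub>v ?g))"
        using P ei Sei Lg by (simp add: mult_add_distrib_mat_vec[of _ n n] scalar_prod_add_distrib[of _ n])
      also have "e i \<bullet> (P *\<^sub>v (L\<^sub>0 *\<^sub>v ?g)) = - \<mu> * (e i \<bullet> (transpose_mat F\<^sub>0 *\<^sub>v ?g))"
        unfolding PL[OF g] by (rule scalar_prod_smult_distrib[OF ei FTg])
      also have "e i \<bullet> (transpose_mat F\<^sub>0 *\<^sub>v ?g) = ?g \<bullet> ?f i"
        using transpose_vec_mult_scalar[OF F ei g] comm_scalar_prod[OF ei FTg] by simp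
      also have "\<dots> = ?f i \<bullet> ?g" by (rule comm_scalar_prod[OF g f[OF i0]])
      finally show ?thesis
        using dis[OF ei] unfolding LFd observer_form[OF P(1) PT S F ei] by simp
    qed
    have coupling: "(\<Sum>i = 1..N. ?f i \<bullet> diffusive_sum l N a ?f i) = (\<Sum>k<l. graph_form N a (\<lambda>i. ?f i $ k))"
      by (rule sum_scalar_prod_diffusive_sum) (use f in simp)
    have "(\<Sum>i = 1..N. 2 * (e i \<bullet> (P *\<^sub>v (S\<^sub>0 *\<^sub>v e i + (L\<^sub>0 * F\<^sub>0) *\<^sub>v diffusive_sum n N a e i))))
        \<le> (\<Sum>i = 1..N. - c * (e i \<bullet> e i) + 2 * (?f i \<bullet> ?f i) - 2 * \<mu> * (?f i \<bullet> diffusive_sum l N a ?f i))"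
      by (rule sum_mono) (rule bound)
    also have "\<dots> = - c * (\<Sum>i = 1..N. e i \<bullet> e i) + 2 * (\<Sum>i = 1..N. ?f i \<bullet> ?f i)
        - 2 * \<mu> * (\<Sum>k<l. graph_form N a (\<lambda>i. ?f i $ k))"
      unfolding coupling[symmetric] by (simp add: sum.distrib sum_subtractf sum_distrib_left sum_negf)
    also have "\<dots> \<le> - c * (\<Sum>i = 1..N. e i \<bullet> e i)"
    proof -
      have "(\<Sum>i = 1..N. ?f i \<bullet> ?f i) = (\<Sum>i = 1..N. \<Sum>k<l. (?f i $ k)\<^sup>2)"
        using F by (auto simp: scalar_prod_def lessThan_atLeast0 power2_eq_square intro!: sum.cong)
      also have "\<dots> = (\<Sum>k<l. \<Sum>i = 1..N. (?f i $ k)\<^sup>2)" by (rule sum.swap)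
      also have "\<dots> \<le> (\<Sum>k<l. \<mu> * graph_form N a (\<lambda>i. ?f i $ k))"
        by (intro sum_mono form) (use F e0 in simp)
      finally show ?thesis by (simp add: sum_distrib_left[symmetric])
    qed
    finally show "(\<Sum>i = 1..N. 2 * (e i \<bullet> (P *\<^sub>v (S\<^sub>0 *\<^sub>v e i + (L\<^sub>0 * F\<^sub>0) *\<^sub>v diffusive_sum n N a e i))))
        \<le> - c * (\<Sum>i = 1..N. e i \<bullet> e i)" .
  qed
qed

text \<open>\<open>P\<close> does not depend on the active graph, so the total form is continuous
  across switching instants and obeys one differential inequality with rate
  \<open>c / (1 + B)\<close>. Each summand is nonnegative, so decay of the sum forces decay of every
  error.\<close>

lemma coupled_observer_vanishing:
  assumes obs: "observer_gain n S\<^sub>0 F\<^sub>0 \<mu> P L\<^sub>0"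
    and S: "S\<^sub>0 \<in> carrier_mat n n" and F: "F\<^sub>0 \<in> carrier_mat l n"
    and t0: "0 \<in> range t" and fin: "\<And>b. finite (range t \<inter> {..b})"
    and form: "\<And>s w. s \<ge> 0 \<Longrightarrow> w 0 = 0 \<Longrightarrow> \<mu> * graph_form N (a (\<sigma> s)) w \<ge> (\<Sum>i = 1..N. (w i)\<^sup>2)"
    and e0: "\<And>s. s \<ge> 0 \<Longrightarrow> e 0 s = 0\<^sub>v n"
    and sol: "\<And>i. i \<in> {1..N} \<Longrightarrow> switched_solution n t (e i)
      (\<lambda>s. S\<^sub>0 *\<^sub>v e i s + (L\<^sub>0 * F\<^sub>0) *\<^sub>v diffusive_sum n N (a (\<sigma> s)) (\<lambda>j. e j s) i)"
    and i: "i \<in> {1..N}"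
  shows "vanishing n (e i)"
proof -
  from obs have P: "P \<in> carrier_mat n n" "sym_pos_def P"
    by (auto simp: observer_gain_def)
  have PT: "transpose_mat P = P" using P by (simp add: sym_pos_def_def)
  have L: "L\<^sub>0 * F\<^sub>0 \<in> carrier_mat n n" using observer_gain_carrier[OF obs F] F by simp
  have ec: "e i s \<in> carrier_vec n" if "s \<ge> 0" "i \<in> {0..N}" for i s
    using that e0[OF that(1)] switched_solution_carrier[OF sol that(1)] by (cases "i = 0") auto
  obtain c where c: "c > 0" and dis: "\<And>N a e. (\<And>w. w 0 = 0 \<Longrightarrow> \<mu> * graph_form N a w \<ge> (\<Sum>i = 1..N. (w i)\<^sup>2)) \<Longrightarrow> e 0 = 0\<^sub>v n \<Longrightarrow>
      (\<And>i. i \<in> {0..N} \<Longrightarrow> e i \<in> carrier_vec n) \<Longrightarrow>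
      (\<Sum>i = 1..N. 2 * (e i \<bullet> (P *\<^sub>v (S\<^sub>0 *\<^sub>v e i + (L\<^sub>0 * F\<^sub>0) *\<^sub>v diffusive_sum n N a e i))))
      \<le> - c * (\<Sum>i = 1..N. e i \<bullet> e i)"
    by (rule coupled_observer_dissipation[OF obs S F]) blast
  obtain b where b: "b > 0" "\<And>v. v \<in> carrier_vec n \<Longrightarrow> v \<bullet> (P *\<^sub>v v) \<ge> b * (v \<bullet> v)"
    by (rule sym_pos_def_coercive[OF P(2,1)]) blast
  obtain B where B: "B > 0" "\<And>u v. u \<in> carrier_vec n \<Longrightarrow> v \<in> carrier_vec n \<Longrightarrow>
      u \<bullet> (P *\<^sub>v v) \<le> 1 * (u \<bullet> u) + B * (v \<bullet> v)"
    by (rule bilinear_bound[OF P(1), of 1]) (simp, blast)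
  let ?V = "\<lambda>s. \<Sum>i = 1..N. e i s \<bullet> (P *\<^sub>v e i s)"
  have Pe_nonneg: "e i s \<bullet> (P *\<^sub>v e i s) \<ge> 0" if "s \<ge> 0" "i \<in> {0..N}" for i s
    using b(2)[OF ec[OF that]] b(1) scalar_prod_self_nonneg[of "e i s"]
    by (meson order_trans mult_nonneg_nonneg less_imp_le)
  have "(?V \<longlongrightarrow> 0) at_top"
  proof (rule comparison_tendsto_zero[where F = "range t" and \<alpha> = "c / (1 + B)" and h = "\<lambda>_. 0"])
    show "c / (1 + B) > 0" using c B by simp
    show "continuous_on {0..} ?V"
      by (intro continuous_on_sum quadratic_form_switched_solution(1)[OF P(1) PT sol t0])
    show "?V s \<ge> 0" if "s \<ge> 0" for s
      using that by (intro sum_nonneg Pe_nonneg) auto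
    show "finite (range t \<inter> {..b})" for b by (rule fin)
    fix s assume s: "s > 0" "s \<notin> range t"
    then have s0: "s \<ge> 0" by simp
    let ?d = "\<lambda>i. S\<^sub>0 *\<^sub>v e i s + (L\<^sub>0 * F\<^sub>0) *\<^sub>v diffusive_sum n N (a (\<sigma> s)) (\<lambda>j. e j s) i"
    let ?D = "\<Sum>i = 1..N. 2 * (e i s \<bullet> (P *\<^sub>v ?d i))"
    have d: "?d i \<in> carrier_vec n" for i
      using carrier_matD(1)[OF L] by (intro carrier_vecI) simp
    have "(?V has_real_derivative ?D) (at s)"
      by (intro DERIV_sum quadratic_form_switched_solution(2)[OF P(1) PT sol t0 s] d)
    moreover have "?D \<le> - c * (\<Sum>i = 1..N. e i s \<bullet> e i s)"
      by (rule dis) (use s0 form e0 ec in auto)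
    moreover have "?V s \<le> (\<Sum>i = 1..N. (1 + B) * (e i s \<bullet> e i s))"
      by (intro sum_mono) (use B(2)[OF ec[OF s0] ec[OF s0]] in \<open>force simp: algebra_simps\<close>)
    then have "c / (1 + B) * ?V s \<le> c / (1 + B) * ((1 + B) * (\<Sum>i = 1..N. e i s \<bullet> e i s))"
      using c B(1) by (intro mult_left_mono) (auto simp: sum_distrib_left)
    then have "c / (1 + B) * ?V s \<le> c * (\<Sum>i = 1..N. e i s \<bullet> e i s)" using B(1) by simp
    ultimately show "\<exists>D. (?V has_real_derivative D) (at s) \<and> D \<le> - (c / (1 + B)) * ?V s + 0"
      by (intro exI[of _ ?D]) simp
  qed simp
  then have lim: "((\<lambda>s. ?V s / b) \<longlongrightarrow> 0) at_top" by (rule tendsto_divide_zero)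
  have "((\<lambda>s. e i s \<bullet> e i s) \<longlongrightarrow> 0) at_top"
  proof (rule tendsto_sandwich[OF _ _ tendsto_const lim])
    show "eventually (\<lambda>s. e i s \<bullet> e i s \<le> ?V s / b) at_top"
      using eventually_ge_at_top[of "0::real"]
    proof eventually_elim
      case (elim s)
      have "b * (e i s \<bullet> e i s) \<le> e i s \<bullet> (P *\<^sub>v e i s)" by (rule b(2)[OF ec]) (use elim i in auto)
      also have "\<dots> \<le> ?V s"
        by (rule member_le_sum[OF i]) (use elim Pe_nonneg in auto)
      finally show ?case using b(1) by (simp add: field_simps)
    qed
  qed (simp add: scalar_prod_self_nonneg)
  then show ?thesis using ec i by (simp add: vanishing_iff_norm)
qed

section \<open>The followers\<close>

text \<open>Plant and observer receive the same input: \<open>b\<close> stands for its effect on the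
  state and \<open>w\<close> for its feedthrough into the output. Both cancel in the differences,
  which leaves the errors autonomous although the control depends on \<eta>.\<close>

lemma observer_error_dynamics:
  fixes A B C E S L\<^sub>1 L\<^sub>2 :: "real mat"
  assumes A: "A \<in> carrier_mat n n" and C: "C \<in> carrier_mat l n" and E: "E \<in> carrier_mat n q"
    and S: "S \<in> carrier_mat q q" and L: "L\<^sub>1 \<in> carrier_mat n l" "L\<^sub>2 \<in> carrier_mat q l"
    and x: "x \<in> carrier_vec n" "\<xi> \<in> carrier_vec n" and d: "d \<in> carrier_vec q" "\<zeta> \<in> carrier_vec q"
    and b: "b \<in> carrier_vec n" and w: "w \<in> carrier_vec l"
  shows "four_block_mat (A + L\<^sub>1 * C) E (L\<^sub>2 * C) S *\<^sub>v ((\<xi> - x) @\<^sub>v (\<zeta> - d)) =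
    (A *\<^sub>v \<xi> + E *\<^sub>v \<zeta> + b - L\<^sub>1 *\<^sub>v ((C *\<^sub>v x + w) - (C *\<^sub>v \<xi> + w)) - (A *\<^sub>v x + b + E *\<^sub>v d))
    @\<^sub>v (S *\<^sub>v \<zeta> - L\<^sub>2 *\<^sub>v ((C *\<^sub>v x + w) - (C *\<^sub>v \<xi> + w)) - S *\<^sub>v d)"
proof -
  have Cx: "C *\<^sub>v x \<in> carrier_vec l" "C *\<^sub>v \<xi> \<in> carrier_vec l" using C x by auto
  have y: "(C *\<^sub>v x + w) - (C *\<^sub>v \<xi> + w) = C *\<^sub>v x - C *\<^sub>v \<xi>"
    using Cx w C by (intro eq_vecI) (auto simp del: index_mult_mat_vec)
  have Ly: "M *\<^sub>v (C *\<^sub>v x - C *\<^sub>v \<xi>) = M *\<^sub>v (C *\<^sub>v x) - M *\<^sub>v (C *\<^sub>v \<xi>)"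
    "(M * C) *\<^sub>v (\<xi> - x) = M *\<^sub>v (C *\<^sub>v \<xi>) - M *\<^sub>v (C *\<^sub>v x)" if "M \<in> carrier_mat k l" for M k
  proof -
    have MC: "M * C \<in> carrier_mat k n" using that C by simp
    show "M *\<^sub>v (C *\<^sub>v x - C *\<^sub>v \<xi>) = M *\<^sub>v (C *\<^sub>v x) - M *\<^sub>v (C *\<^sub>v \<xi>)"
      by (rule mult_minus_distrib_mat_vec[OF that Cx])
    show "(M * C) *\<^sub>v (\<xi> - x) = M *\<^sub>v (C *\<^sub>v \<xi>) - M *\<^sub>v (C *\<^sub>v x)"
      unfolding mult_minus_distrib_mat_vec[OF MC x(2,1)] using that C x by simp
  qed
  have LC: "L\<^sub>1 * C \<in> carrier_mat n n" "L\<^sub>2 * C \<in> carrier_mat q n" using L C by auto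
  have AL: "A + L\<^sub>1 * C \<in> carrier_mat n n" using A LC by simp
  have ex: "\<xi> - x \<in> carrier_vec n" and ed: "\<zeta> - d \<in> carrier_vec q" using x d by auto
  have "(A + L\<^sub>1 * C) *\<^sub>v (\<xi> - x) + E *\<^sub>v (\<zeta> - d)
      = A *\<^sub>v \<xi> + E *\<^sub>v \<zeta> + b - L\<^sub>1 *\<^sub>v (C *\<^sub>v x - C *\<^sub>v \<xi>) - (A *\<^sub>v x + b + E *\<^sub>v d)"
    unfolding add_mult_distrib_mat_vec[OF A LC(1) ex] mult_minus_distrib_mat_vec[OF A x(2,1)]
      mult_minus_distrib_mat_vec[OF E d(2,1)] Ly[OF L(1)]
    using A E L b by (intro eq_vecI) (auto simp del: index_mult_mat_vec)
  moreover have "(L\<^sub>2 * C) *\<^sub>v (\<xi> - x) + S *\<^sub>v (\<zeta> - d)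
      = S *\<^sub>v \<zeta> - L\<^sub>2 *\<^sub>v (C *\<^sub>v x - C *\<^sub>v \<xi>) - S *\<^sub>v d"
    unfolding mult_minus_distrib_mat_vec[OF S d(2,1)] Ly[OF L(2)]
    using S L by (intro eq_vecI) (auto simp del: index_mult_mat_vec)
  ultimately show ?thesis
    unfolding y four_block_mat_mult_vec[OF AL E LC(2) S ex ed] by simp
qed

text \<open>The regulator equations make \<open>x = X\<^sub>1 d + X\<^sub>2 r\<close> an invariant subspace on which the output
  error vanishes; \<open>z\<close> measures the distance to it and \<open>g\<close> collects the estimation errors.\<close>

lemma regulated_dynamics:
  fixes A B C D E S S\<^sub>0 F\<^sub>0 :: "real mat"
  assumes dims: "A \<in> carrier_mat n n" "B \<in> carrier_mat n m" "C \<in> carrier_mat l n" "D \<in> carrier_mat l m"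
      "E \<in> carrier_mat n q" "S \<in> carrier_mat q q" "S\<^sub>0 \<in> carrier_mat n\<^sub>0 n\<^sub>0" "F\<^sub>0 \<in> carrier_mat l n\<^sub>0"
    and reg: "regulator_equations n m q n\<^sub>0 l A B C D E S S\<^sub>0 F\<^sub>0 X\<^sub>1 X\<^sub>2 U\<^sub>1 U\<^sub>2"
    and K\<^sub>1: "K\<^sub>1 \<in> carrier_mat m n"
    and x: "x \<in> carrier_vec n" "\<xi> \<in> carrier_vec n" and d: "d \<in> carrier_vec q" "\<zeta> \<in> carrier_vec q"
    and r: "r \<in> carrier_vec n\<^sub>0" "\<eta> \<in> carrier_vec n\<^sub>0"
  defines "K\<^sub>2 \<equiv> U\<^sub>1 - K\<^sub>1 * X\<^sub>1" and "K\<^sub>3 \<equiv> U\<^sub>2 - K\<^sub>1 * X\<^sub>2"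
  defines "u \<equiv> K\<^sub>1 *\<^sub>v \<xi> + K\<^sub>2 *\<^sub>v \<zeta> + K\<^sub>3 *\<^sub>v \<eta>"
    and "z \<equiv> x - X\<^sub>1 *\<^sub>v d - X\<^sub>2 *\<^sub>v r"
    and "g \<equiv> K\<^sub>1 *\<^sub>v (\<xi> - x) + K\<^sub>2 *\<^sub>v (\<zeta> - d) + K\<^sub>3 *\<^sub>v (\<eta> - r)"
  shows "A *\<^sub>v x + B *\<^sub>v u + E *\<^sub>v d - X\<^sub>1 *\<^sub>v (S *\<^sub>v d) - X\<^sub>2 *\<^sub>v (S\<^sub>0 *\<^sub>v r) = (A + B * K\<^sub>1) *\<^sub>v z + B *\<^sub>v g" (is ?dyn)
    and "C *\<^sub>v x + D *\<^sub>v u - F\<^sub>0 *\<^sub>v r = (C + D * K\<^sub>1) *\<^sub>v z + D *\<^sub>v g" (is ?out)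
proof -
  from reg have X: "X\<^sub>1 \<in> carrier_mat n q" "X\<^sub>2 \<in> carrier_mat n n\<^sub>0"
    and U: "U\<^sub>1 \<in> carrier_mat m q" "U\<^sub>2 \<in> carrier_mat m n\<^sub>0"
    and eqs: "X\<^sub>1 * S = A * X\<^sub>1 + B * U\<^sub>1 + E" "0\<^sub>m l q = C * X\<^sub>1 + D * U\<^sub>1"
      "X\<^sub>2 * S\<^sub>0 = A * X\<^sub>2 + B * U\<^sub>2" "0\<^sub>m l n\<^sub>0 = C * X\<^sub>2 + D * U\<^sub>2 - F\<^sub>0"
    by (auto simp: regulator_equations_def)
  have KX: "K\<^sub>1 * X\<^sub>1 \<in> carrier_mat m q" "K\<^sub>1 * X\<^sub>2 \<in> carrier_mat m n\<^sub>0" using K\<^sub>1 X by auto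
  have K: "K\<^sub>2 \<in> carrier_mat m q" "K\<^sub>3 \<in> carrier_mat m n\<^sub>0"
    unfolding K\<^sub>2_def K\<^sub>3_def using KX by (auto intro: minus_carrier_mat)
  have Xd: "X\<^sub>1 *\<^sub>v d \<in> carrier_vec n" and Xr: "X\<^sub>2 *\<^sub>v r \<in> carrier_vec n"
    and Ud: "U\<^sub>1 *\<^sub>v d \<in> carrier_vec m" and Ur: "U\<^sub>2 *\<^sub>v r \<in> carrier_vec m"
    using X U d r by auto
  have z: "z \<in> carrier_vec n" unfolding z_def using x Xd Xr by simp
  have g: "g \<in> carrier_vec m" unfolding g_def using K\<^sub>1 K x d r by simp
  have K1z: "K\<^sub>1 *\<^sub>v z \<in> carrier_vec m" using K\<^sub>1 z by simp
  have xz: "x = z + X\<^sub>1 *\<^sub>v d + X\<^sub>2 *\<^sub>v r"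
    unfolding z_def using x Xd Xr X by (intro eq_vecI) (auto simp del: index_mult_mat_vec)
  have Mx: "M *\<^sub>v x = M *\<^sub>v z + M *\<^sub>v (X\<^sub>1 *\<^sub>v d) + M *\<^sub>v (X\<^sub>2 *\<^sub>v r)" if "M \<in> carrier_mat k n" for M :: "real mat" and k
    unfolding arg_cong[OF xz, of "\<lambda>v. M *\<^sub>v v"] mult_add_distrib_mat_vec[OF that add_carrier_vec[OF z Xd] Xr]
      mult_add_distrib_mat_vec[OF that z Xd] ..
  have K2d: "K\<^sub>2 *\<^sub>v d = U\<^sub>1 *\<^sub>v d - K\<^sub>1 *\<^sub>v (X\<^sub>1 *\<^sub>v d)"
    unfolding K\<^sub>2_def minus_mult_distrib_mat_vec[OF U(1) KX(1) d(1)] assoc_mult_mat_vec[OF K\<^sub>1 X(1) d(1)] ..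
  have K3r: "K\<^sub>3 *\<^sub>v r = U\<^sub>2 *\<^sub>v r - K\<^sub>1 *\<^sub>v (X\<^sub>2 *\<^sub>v r)"
    unfolding K\<^sub>3_def minus_mult_distrib_mat_vec[OF U(2) KX(2) r(1)] assoc_mult_mat_vec[OF K\<^sub>1 X(2) r(1)] ..
  \<comment> \<open>Here the formulas for \<open>K\<^sub>2\<close> and \<open>K\<^sub>3\<close> act:
    their parts with \<open>K\<^sub>1\<close> cancel the shift from \<open>x\<close> to
    \<open>z\<close>, so that on exact estimates the control is the feedforward of the regulator
    equations plus \<open>K\<^sub>1 *\<^sub>v z\<close>.\<close>
  have u: "u = K\<^sub>1 *\<^sub>v z + U\<^sub>1 *\<^sub>v d + U\<^sub>2 *\<^sub>v r + g"
    unfolding u_def g_def mult_minus_distrib_mat_vec[OF K\<^sub>1 x(2,1)] mult_minus_distrib_mat_vec[OF K(1) d(2,1)]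
      mult_minus_distrib_mat_vec[OF K(2) r(2,1)] K2d K3r Mx[OF K\<^sub>1]
    using K\<^sub>1 K U by (intro eq_vecI) (auto simp del: index_mult_mat_vec)
  have Mu: "M *\<^sub>v u = M *\<^sub>v (K\<^sub>1 *\<^sub>v z) + M *\<^sub>v (U\<^sub>1 *\<^sub>v d) + M *\<^sub>v (U\<^sub>2 *\<^sub>v r) + M *\<^sub>v g"
    if "M \<in> carrier_mat k m" for M :: "real mat" and k
    unfolding u mult_add_distrib_mat_vec[OF that add_carrier_vec[OF add_carrier_vec[OF K1z Ud] Ur] g]
      mult_add_distrib_mat_vec[OF that add_carrier_vec[OF K1z Ud] Ur] mult_add_distrib_mat_vec[OF that K1z Ud] ..
  have AX: "A * X\<^sub>1 \<in> carrier_mat n q" "A * X\<^sub>2 \<in> carrier_mat n n\<^sub>0" using dims X by auto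
  have BU: "B * U\<^sub>1 \<in> carrier_mat n q" "B * U\<^sub>2 \<in> carrier_mat n n\<^sub>0" using dims U by auto
  have CX: "C * X\<^sub>1 \<in> carrier_mat l q" "C * X\<^sub>2 \<in> carrier_mat l n\<^sub>0" using dims X by auto
  have DU: "D * U\<^sub>1 \<in> carrier_mat l q" "D * U\<^sub>2 \<in> carrier_mat l n\<^sub>0" using dims U by auto
  have ABd: "A * X\<^sub>1 + B * U\<^sub>1 \<in> carrier_mat n q" and CDr: "C * X\<^sub>2 + D * U\<^sub>2 \<in> carrier_mat l n\<^sub>0"
    using AX BU CX DU by auto
  have XS: "X\<^sub>1 *\<^sub>v (S *\<^sub>v d) = A *\<^sub>v (X\<^sub>1 *\<^sub>v d) + B *\<^sub>v (U\<^sub>1 *\<^sub>v d) + E *\<^sub>v d"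
    unfolding assoc_mult_mat_vec[OF X(1) dims(6) d(1), symmetric] eqs(1)
      add_mult_distrib_mat_vec[OF ABd dims(5) d(1)] add_mult_distrib_mat_vec[OF AX(1) BU(1) d(1)]
      assoc_mult_mat_vec[OF dims(1) X(1) d(1)] assoc_mult_mat_vec[OF dims(2) U(1) d(1)] ..
  have XS0: "X\<^sub>2 *\<^sub>v (S\<^sub>0 *\<^sub>v r) = A *\<^sub>v (X\<^sub>2 *\<^sub>v r) + B *\<^sub>v (U\<^sub>2 *\<^sub>v r)"
    unfolding assoc_mult_mat_vec[OF X(2) dims(7) r(1), symmetric] eqs(3)
      add_mult_distrib_mat_vec[OF AX(2) BU(2) r(1)]
      assoc_mult_mat_vec[OF dims(1) X(2) r(1)] assoc_mult_mat_vec[OF dims(2) U(2) r(1)] ..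
  have "0\<^sub>m l q *\<^sub>v d = C *\<^sub>v (X\<^sub>1 *\<^sub>v d) + D *\<^sub>v (U\<^sub>1 *\<^sub>v d)"
    unfolding eqs(2) add_mult_distrib_mat_vec[OF CX(1) DU(1) d(1)]
      assoc_mult_mat_vec[OF dims(3) X(1) d(1)] assoc_mult_mat_vec[OF dims(4) U(1) d(1)] ..
  moreover have "(0\<^sub>m l q *\<^sub>v d) $ k = 0" if "k < l" for k using d that by simp
  ultimately have Cd: "(C *\<^sub>v (X\<^sub>1 *\<^sub>v d) + D *\<^sub>v (U\<^sub>1 *\<^sub>v d)) $ k = 0" if "k < l" for k
    using that by metis
  have "0\<^sub>m l n\<^sub>0 *\<^sub>v r = C *\<^sub>v (X\<^sub>2 *\<^sub>v r) + D *\<^sub>v (U\<^sub>2 *\<^sub>v r) - F\<^sub>0 *\<^sub>v r"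
    unfolding eqs(4) minus_mult_distrib_mat_vec[OF CDr dims(8) r(1)] add_mult_distrib_mat_vec[OF CX(2) DU(2) r(1)]
      assoc_mult_mat_vec[OF dims(3) X(2) r(1)] assoc_mult_mat_vec[OF dims(4) U(2) r(1)] ..
  moreover have "(0\<^sub>m l n\<^sub>0 *\<^sub>v r) $ k = 0" if "k < l" for k using r that by simp
  ultimately have Cr: "(C *\<^sub>v (X\<^sub>2 *\<^sub>v r) + D *\<^sub>v (U\<^sub>2 *\<^sub>v r) - F\<^sub>0 *\<^sub>v r) $ k = 0" if "k < l" for k
    using that by metis
  have BK: "B * K\<^sub>1 \<in> carrier_mat n n" and DK: "D * K\<^sub>1 \<in> carrier_mat l n" using dims K\<^sub>1 by auto
  show ?dyn
    unfolding add_mult_distrib_mat_vec[OF dims(1) BK z] assoc_mult_mat_vec[OF dims(2) K\<^sub>1 z]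
      Mx[OF dims(1)] Mu[OF dims(2)] XS XS0
    using dims by (intro eq_vecI) (auto simp del: index_mult_mat_vec)
  show ?out
    unfolding add_mult_distrib_mat_vec[OF dims(3) DK z] assoc_mult_mat_vec[OF dims(4) K\<^sub>1 z]
      Mx[OF dims(3)] Mu[OF dims(4)]
  proof (rule eq_vecI)
    fix k assume "k < dim_vec (C *\<^sub>v z + D *\<^sub>v (K\<^sub>1 *\<^sub>v z) + D *\<^sub>v g)"
    then have k: "k < l" using dims by simp
    show "(C *\<^sub>v z + C *\<^sub>v (X\<^sub>1 *\<^sub>v d) + C *\<^sub>v (X\<^sub>2 *\<^sub>v r)
        + (D *\<^sub>v (K\<^sub>1 *\<^sub>v z) + D *\<^sub>v (U\<^sub>1 *\<^sub>v d) + D *\<^sub>v (U\<^sub>2 *\<^sub>v r) + D *\<^sub>v g) - F\<^sub>0 *\<^sub>v r) $ k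
        = (C *\<^sub>v z + D *\<^sub>v (K\<^sub>1 *\<^sub>v z) + D *\<^sub>v g) $ k"
      using Cd[OF k] Cr[OF k] k dims by (simp del: index_mult_mat_vec)
  qed (use dims in simp)
qed

text \<open>The network enters only through the hypothesis that \<open>\<eta> s - r s\<close>
  vanishes, so each follower can be treated in isolation.\<close>

lemma follower_output_regulation:
  fixes A B C D E S S\<^sub>0 F\<^sub>0 :: "real mat"
  assumes dims: "A \<in> carrier_mat n n" "B \<in> carrier_mat n m" "C \<in> carrier_mat l n" "D \<in> carrier_mat l m"
      "E \<in> carrier_mat n q" "S \<in> carrier_mat q q" "S\<^sub>0 \<in> carrier_mat n\<^sub>0 n\<^sub>0" "F\<^sub>0 \<in> carrier_mat l n\<^sub>0"
    and reg: "regulator_equations n m q n\<^sub>0 l A B C D E S S\<^sub>0 F\<^sub>0 X\<^sub>1 X\<^sub>2 U\<^sub>1 U\<^sub>2"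
    and gains: "follower_gains n m q l A B C E S X\<^sub>1 X\<^sub>2 U\<^sub>1 U\<^sub>2 K\<^sub>1 K\<^sub>2 K\<^sub>3 L\<^sub>1 L\<^sub>2"
    and t0: "0 \<in> range t" and fin: "\<And>b. finite (range t \<inter> {..b})"
    and r: "switched_solution n\<^sub>0 t r (\<lambda>s. S\<^sub>0 *\<^sub>v r s)"
    and x: "switched_solution n t x (\<lambda>s. A *\<^sub>v x s + B *\<^sub>v u s + E *\<^sub>v d s)"
    and d: "switched_solution q t d (\<lambda>s. S *\<^sub>v d s)"
    and \<xi>: "switched_solution n t \<xi> (\<lambda>s. A *\<^sub>v \<xi> s + E *\<^sub>v \<zeta> s + B *\<^sub>v u s - L\<^sub>1 *\<^sub>v (y s - yhat s))"
    and \<zeta>: "switched_solution q t \<zeta> (\<lambda>s. S *\<^sub>v \<zeta> s - L\<^sub>2 *\<^sub>v (y s - yhat s))"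
    and u: "\<And>s. s \<ge> 0 \<Longrightarrow> u s = K\<^sub>1 *\<^sub>v \<xi> s + K\<^sub>2 *\<^sub>v \<zeta> s + K\<^sub>3 *\<^sub>v \<eta> s"
    and y: "\<And>s. s \<ge> 0 \<Longrightarrow> y s = C *\<^sub>v x s + D *\<^sub>v u s"
    and yhat: "\<And>s. s \<ge> 0 \<Longrightarrow> yhat s = C *\<^sub>v \<xi> s + D *\<^sub>v u s"
    and \<eta>c: "\<And>s. s \<ge> 0 \<Longrightarrow> \<eta> s \<in> carrier_vec n\<^sub>0" and \<eta>: "vanishing n\<^sub>0 (\<lambda>s. \<eta> s - r s)"
  shows "vanishing l (\<lambda>s. y s - F\<^sub>0 *\<^sub>v r s)"
proof -
  from gains have K\<^sub>1: "K\<^sub>1 \<in> carrier_mat m n" and hK: "hurwitz (A + B * K\<^sub>1)"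
    and K\<^sub>2: "K\<^sub>2 = U\<^sub>1 - K\<^sub>1 * X\<^sub>1" and K\<^sub>3: "K\<^sub>3 = U\<^sub>2 - K\<^sub>1 * X\<^sub>2"
    and L: "L\<^sub>1 \<in> carrier_mat n l" "L\<^sub>2 \<in> carrier_mat q l"
    and hL: "hurwitz (four_block_mat (A + L\<^sub>1 * C) E (L\<^sub>2 * C) S)"
    by (auto simp: follower_gains_def)
  from reg have X: "X\<^sub>1 \<in> carrier_mat n q" "X\<^sub>2 \<in> carrier_mat n n\<^sub>0"
    by (auto simp: regulator_equations_def)
  have K: "K\<^sub>2 \<in> carrier_mat m q" "K\<^sub>3 \<in> carrier_mat m n\<^sub>0"
    unfolding K\<^sub>2 K\<^sub>3 using K\<^sub>1 X by (auto intro!: minus_carrier_mat mult_carrier_mat)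
  note rc = switched_solution_carrier[OF r] and xc = switched_solution_carrier[OF x]
    and dc = switched_solution_carrier[OF d] and \<xi>c = switched_solution_carrier[OF \<xi>]
    and \<zeta>c = switched_solution_carrier[OF \<zeta>]
  have uc: "u s \<in> carrier_vec m" if "s \<ge> 0" for s
    unfolding u[OF that] using K\<^sub>1 K \<xi>c[OF that] \<zeta>c[OF that] \<eta>c[OF that] by simp
  have Buc: "B *\<^sub>v u s \<in> carrier_vec n" and Duc: "D *\<^sub>v u s \<in> carrier_vec l" if "s \<ge> 0" for s
    using dims uc[OF that] by auto
  have xdc: "A *\<^sub>v x s + B *\<^sub>v u s + E *\<^sub>v d s \<in> carrier_vec n" and ddc: "S *\<^sub>v d s \<in> carrier_vec q"
    and rdc: "S\<^sub>0 *\<^sub>v r s \<in> carrier_vec n\<^sub>0" if "s \<ge> 0" for s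
    using dims xc[OF that] Buc[OF that] dc[OF that] rc[OF that] by auto
  have yc: "y s - yhat s \<in> carrier_vec l" if "s \<ge> 0" for s
    unfolding y[OF that] yhat[OF that] using dims xc[OF that] \<xi>c[OF that] Duc[OF that] by simp

  have \<xi>\<zeta>c: "A *\<^sub>v \<xi> s + E *\<^sub>v \<zeta> s + B *\<^sub>v u s \<in> carrier_vec n" "L\<^sub>1 *\<^sub>v (y s - yhat s) \<in> carrier_vec n"
    "S *\<^sub>v \<zeta> s \<in> carrier_vec q" "L\<^sub>2 *\<^sub>v (y s - yhat s) \<in> carrier_vec q" if "s \<ge> 0" for s
    using dims L \<xi>c[OF that] Buc[OF that] \<zeta>c[OF that] yc[OF that] by auto
  let ?M = "four_block_mat (A + L\<^sub>1 * C) E (L\<^sub>2 * C) S"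
  let ?w = "\<lambda>s. (\<xi> s - x s) @\<^sub>v (\<zeta> s - d s)"
  have M: "?M \<in> carrier_mat (n + q) (n + q)" using dims L by auto
  have exc: "\<xi> s - x s \<in> carrier_vec n" and edc: "\<zeta> s - d s \<in> carrier_vec q" if "s \<ge> 0" for s
    using xc[OF that] dc[OF that] \<xi>c[OF that] \<zeta>c[OF that] by auto
  have "switched_solution (n + q) t ?w (\<lambda>s.
      (A *\<^sub>v \<xi> s + E *\<^sub>v \<zeta> s + B *\<^sub>v u s - L\<^sub>1 *\<^sub>v (y s - yhat s) - (A *\<^sub>v x s + B *\<^sub>v u s + E *\<^sub>v d s))
      @\<^sub>v (S *\<^sub>v \<zeta> s - L\<^sub>2 *\<^sub>v (y s - yhat s) - S *\<^sub>v d s))"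
    by (intro switched_solution_append switched_solution_minus t0 \<xi> x \<zeta> d xdc ddc minus_carrier_vec \<xi>\<zeta>c)
  \<comment> \<open>The zero input puts the autonomous error system into the shape required by
    \<open>hurwitz_vanishing_input\<close>.\<close>
  then have "switched_solution (n + q) t ?w (\<lambda>s. ?M *\<^sub>v ?w s + 0\<^sub>v (n + q))"
  proof (rule switched_solution_cong)
    fix s :: real assume s: "s \<ge> 0"
    have "?M *\<^sub>v ?w s + 0\<^sub>v (n + q) = ?M *\<^sub>v ?w s"
      using M exc[OF s] edc[OF s] by simp
    also have "\<dots> = (A *\<^sub>v \<xi> s + E *\<^sub>v \<zeta> s + B *\<^sub>v u s - L\<^sub>1 *\<^sub>v (y s - yhat s) - (A *\<^sub>v x s + B *\<^sub>v u s + E *\<^sub>v d s))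
      @\<^sub>v (S *\<^sub>v \<zeta> s - L\<^sub>2 *\<^sub>v (y s - yhat s) - S *\<^sub>v d s)"
      unfolding y[OF s] yhat[OF s]
      by (rule observer_error_dynamics[OF dims(1,3,5,6) L xc[OF s] \<xi>c[OF s] dc[OF s] \<zeta>c[OF s] Buc[OF s] Duc[OF s]])
    finally show "(A *\<^sub>v \<xi> s + E *\<^sub>v \<zeta> s + B *\<^sub>v u s - L\<^sub>1 *\<^sub>v (y s - yhat s) - (A *\<^sub>v x s + B *\<^sub>v u s + E *\<^sub>v d s))
      @\<^sub>v (S *\<^sub>v \<zeta> s - L\<^sub>2 *\<^sub>v (y s - yhat s) - S *\<^sub>v d s) = ?M *\<^sub>v ?w s + 0\<^sub>v (n + q)" ..
  qed
  then have "vanishing (n + q) ?w"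
    by (rule hurwitz_vanishing_input[OF hL M _ _ t0 fin]) (simp add: vanishing_def)
  note errors = vanishing_appendD[OF exc edc this]

  let ?z = "\<lambda>s. x s - X\<^sub>1 *\<^sub>v d s - X\<^sub>2 *\<^sub>v r s"
  let ?g = "\<lambda>s. K\<^sub>1 *\<^sub>v (\<xi> s - x s) + K\<^sub>2 *\<^sub>v (\<zeta> s - d s) + K\<^sub>3 *\<^sub>v (\<eta> s - r s)"
  have g: "vanishing m ?g"
    by (intro vanishing_add vanishing_mult_mat[OF errors(1) K\<^sub>1] vanishing_mult_mat[OF errors(2) K(1)]
        vanishing_mult_mat[OF \<eta> K(2)])
  have "switched_solution n t ?z (\<lambda>s. A *\<^sub>v x s + B *\<^sub>v u s + E *\<^sub>v d s - X\<^sub>1 *\<^sub>v (S *\<^sub>v d s) - X\<^sub>2 *\<^sub>v (S\<^sub>0 *\<^sub>v r s))"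
    by (intro switched_solution_minus switched_solution_mult_mat[OF t0 X(1)] switched_solution_mult_mat[OF t0 X(2)]
        t0 x d r mult_mat_vec_carrier[OF X(1)] mult_mat_vec_carrier[OF X(2)] ddc rdc) auto
  then have "switched_solution n t ?z (\<lambda>s. (A + B * K\<^sub>1) *\<^sub>v ?z s + B *\<^sub>v ?g s)"
    by (rule switched_solution_cong)
      (simp only: u K\<^sub>2 K\<^sub>3 regulated_dynamics(1)[OF dims reg K\<^sub>1 xc \<xi>c dc \<zeta>c rc \<eta>c])
  moreover have ABK: "A + B * K\<^sub>1 \<in> carrier_mat n n" using dims K\<^sub>1 by simp
  ultimately have z: "vanishing n ?z"
    by (intro hurwitz_vanishing_input[OF hK ABK _ vanishing_mult_mat[OF g dims(2)] t0 fin])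
  have CDK: "C + D * K\<^sub>1 \<in> carrier_mat l n" using dims K\<^sub>1 by simp
  have "vanishing l (\<lambda>s. (C + D * K\<^sub>1) *\<^sub>v ?z s + D *\<^sub>v ?g s)"
    by (intro vanishing_add vanishing_mult_mat[OF z CDK] vanishing_mult_mat[OF g dims(4)])
  then show ?thesis
    by (rule vanishing_cong)
      (simp only: y u K\<^sub>2 K\<^sub>3 regulated_dynamics(2)[OF dims reg K\<^sub>1 xc \<xi>c dc \<zeta>c rc \<eta>c])
qed

text \<open>A stabilizing injection for the system stacked from state and disturbance is cut into
  its upper \<open>n\<close> rows, \<open>L\<^sub>1\<close>, and its lower \<open>q\<close> rows,
  \<open>L\<^sub>2\<close>. As the output matrix is \<open>[C, 0]\<close>, completed by empty lower
  blocks, the injection changes only the first block column. \<open>K\<^sub>2\<close> and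
  \<open>K\<^sub>3\<close> are determined by \<open>K\<^sub>1\<close>.\<close>

lemma follower_gains_exist:
  assumes dims: "A \<in> carrier_mat n n" "B \<in> carrier_mat n m" "C \<in> carrier_mat l n"
      "E \<in> carrier_mat n q" "S \<in> carrier_mat q q"
    and stab: "stabilizable A B"
    and det: "detectable (four_block_mat C (0\<^sub>m l q) (0\<^sub>m 0 n) (0\<^sub>m 0 q)) (four_block_mat A E (0\<^sub>m q n) S)"
  shows "\<exists>K\<^sub>1 K\<^sub>2 K\<^sub>3 L\<^sub>1 L\<^sub>2. follower_gains n m q l A B C E S X\<^sub>1 X\<^sub>2 U\<^sub>1 U\<^sub>2 K\<^sub>1 K\<^sub>2 K\<^sub>3 L\<^sub>1 L\<^sub>2"
proof -
  obtain K\<^sub>1 where K: "K\<^sub>1 \<in> carrier_mat m n" "hurwitz (A + B * K\<^sub>1)"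
    using stab dims by (auto simp: stabilizable_def)
  obtain L where L: "L \<in> carrier_mat (n + q) l"
    and hur: "hurwitz (four_block_mat A E (0\<^sub>m q n) S + L * four_block_mat C (0\<^sub>m l q) (0\<^sub>m 0 n) (0\<^sub>m 0 q))"
    using det dims by (auto simp: detectable_def)
  define L\<^sub>1 where "L\<^sub>1 = mat n l (\<lambda>(i, j). L $$ (i, j))"
  define L\<^sub>2 where "L\<^sub>2 = mat q l (\<lambda>(i, j). L $$ (n + i, j))"
  have L12: "L\<^sub>1 \<in> carrier_mat n l" "L\<^sub>2 \<in> carrier_mat q l" by (simp_all add: L\<^sub>1_def L\<^sub>2_def)
  have row: "row L i = row L\<^sub>1 i" if "i < n" for i
    using that L by (intro eq_vecI) (auto simp: L\<^sub>1_def)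
  have row': "row L i = row L\<^sub>2 (i - n)" if "n \<le> i" "i < n + q" for i
    using that L by (intro eq_vecI) (auto simp: L\<^sub>2_def)
  have col: "col (four_block_mat C (0\<^sub>m l q) (0\<^sub>m 0 n) (0\<^sub>m 0 q)) j = (if j < n then col C j else 0\<^sub>v l)"
    if "j < n + q" for j
    using that dims by (intro eq_vecI) auto
  have "four_block_mat A E (0\<^sub>m q n) S + L * four_block_mat C (0\<^sub>m l q) (0\<^sub>m 0 n) (0\<^sub>m 0 q)
      = four_block_mat (A + L\<^sub>1 * C) E (L\<^sub>2 * C) S"
    using L L12 dims by (intro eq_matI) (auto simp: row row' col)
  with hur have "hurwitz (four_block_mat (A + L\<^sub>1 * C) E (L\<^sub>2 * C) S)" by simp
  with K L12 show ?thesis unfolding follower_gains_def by blast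
qed

theorem theorem1:
  fixes N \<kappa> l n\<^sub>0 :: nat
    and n m q :: "nat \<Rightarrow> nat"
    and A B C D E S :: "nat \<Rightarrow> real mat"
    and S\<^sub>0 F\<^sub>0 :: "real mat"
    and a :: "nat \<Rightarrow> nat \<Rightarrow> nat \<Rightarrow> real"
    and \<sigma> :: "real \<Rightarrow> nat"
    and t :: "nat \<Rightarrow> real"
    and \<tau>\<^sub>0 :: real
    and X\<^sub>1 X\<^sub>2 U\<^sub>1 U\<^sub>2 :: "nat \<Rightarrow> real mat"
  assumes N: "N \<ge> 1"
    and leader_dims: "S\<^sub>0 \<in> carrier_mat n\<^sub>0 n\<^sub>0" "F\<^sub>0 \<in> carrier_mat l n\<^sub>0"
    and follower_dims: "\<forall>i \<in> {1..N}.
          A i \<in> carrier_mat (n i) (n i) \<and> B i \<in> carrier_mat (n i) (m i) \<and>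
          C i \<in> carrier_mat l (n i) \<and> D i \<in> carrier_mat l (m i) \<and>
          E i \<in> carrier_mat (n i) (q i) \<and> S i \<in> carrier_mat (q i) (q i)"
    and detectable_leader: "detectable F\<^sub>0 S\<^sub>0"
    and eigenvalues_leader: "\<forall>z \<in> spectrum (cmat S\<^sub>0). \<not> Re z < 0"
    and eigenvalues_disturbance: "\<forall>i \<in> {1..N}. \<forall>z \<in> spectrum (cmat (S i)). \<not> Re z < 0"
    and stabilizable: "\<forall>i \<in> {1..N}. stabilizable (A i) (B i)"
    and graphs: "\<forall>p \<in> {1..\<kappa>}. comm_graph N (a p)"
    and switching: "switching_signal \<kappa> \<tau>\<^sub>0 t \<sigma>"
    and connected: "\<forall>p \<in> {1..\<kappa>}. graph_connected N (a p)"
    and regulator: "\<forall>i \<in> {1..N}.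
          regulator_equations (n i) (m i) (q i) n\<^sub>0 l (A i) (B i) (C i) (D i) (E i) (S i) S\<^sub>0 F\<^sub>0
            (X\<^sub>1 i) (X\<^sub>2 i) (U\<^sub>1 i) (U\<^sub>2 i)"
    and detectable_followers: "\<forall>i \<in> {1..N}.
          detectable
            (four_block_mat (C i) (0\<^sub>m l (q i)) (0\<^sub>m 0 (n i)) (0\<^sub>m 0 (q i)))
            (four_block_mat (A i) (E i) (0\<^sub>m (q i) (n i)) (S i))"
  shows "(\<exists>K\<^sub>1 K\<^sub>2 K\<^sub>3 L\<^sub>1 L\<^sub>2 P L\<^sub>0.
           (\<forall>i \<in> {1..N}. follower_gains (n i) (m i) (q i) l (A i) (B i) (C i) (E i) (S i)
              (X\<^sub>1 i) (X\<^sub>2 i) (U\<^sub>1 i) (U\<^sub>2 i) (K\<^sub>1 i) (K\<^sub>2 i) (K\<^sub>3 i) (L\<^sub>1 i) (L\<^sub>2 i)) \<and>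
           observer_gain n\<^sub>0 S\<^sub>0 F\<^sub>0 (mu_star N \<kappa> a) P L\<^sub>0)
       \<and>
         (\<forall>K\<^sub>1 K\<^sub>2 K\<^sub>3 L\<^sub>1 L\<^sub>2 P L\<^sub>0.
           (\<forall>i \<in> {1..N}. follower_gains (n i) (m i) (q i) l (A i) (B i) (C i) (E i) (S i)
              (X\<^sub>1 i) (X\<^sub>2 i) (U\<^sub>1 i) (U\<^sub>2 i) (K\<^sub>1 i) (K\<^sub>2 i) (K\<^sub>3 i) (L\<^sub>1 i) (L\<^sub>2 i)) \<and>
           observer_gain n\<^sub>0 S\<^sub>0 F\<^sub>0 (mu_star N \<kappa> a) P L\<^sub>0 \<longrightarrow>
           (\<forall>(r :: real \<Rightarrow> real vec) (y\<^sub>0 :: real \<Rightarrow> real vec)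
              (x :: nat \<Rightarrow> real \<Rightarrow> real vec) (d :: nat \<Rightarrow> real \<Rightarrow> real vec)
              (\<xi> :: nat \<Rightarrow> real \<Rightarrow> real vec) (\<zeta> :: nat \<Rightarrow> real \<Rightarrow> real vec)
              (\<eta> :: nat \<Rightarrow> real \<Rightarrow> real vec) (\<eta>\<^sub>v :: nat \<Rightarrow> real \<Rightarrow> real vec)
              (u :: nat \<Rightarrow> real \<Rightarrow> real vec) (y :: nat \<Rightarrow> real \<Rightarrow> real vec)
              (yhat :: nat \<Rightarrow> real \<Rightarrow> real vec).
              switched_solution n\<^sub>0 t r (\<lambda>s. S\<^sub>0 *\<^sub>v r s) \<and>
              (\<forall>s \<ge> 0. y\<^sub>0 s = F\<^sub>0 *\<^sub>v r s) \<and>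
              (\<forall>s \<ge> 0. \<eta> 0 s = r s) \<and>
              (\<forall>i \<in> {1..N}.
                 switched_solution (n i) t (x i)
                   (\<lambda>s. A i *\<^sub>v x i s + B i *\<^sub>v u i s + E i *\<^sub>v d i s) \<and>
                 switched_solution (q i) t (d i) (\<lambda>s. S i *\<^sub>v d i s) \<and>
                 switched_solution (n i) t (\<xi> i)
                   (\<lambda>s. A i *\<^sub>v \<xi> i s + E i *\<^sub>v \<zeta> i s + B i *\<^sub>v u i s - L\<^sub>1 i *\<^sub>v (y i s - yhat i s)) \<and>
                 switched_solution (q i) t (\<zeta> i)
                   (\<lambda>s. S i *\<^sub>v \<zeta> i s - L\<^sub>2 i *\<^sub>v (y i s - yhat i s)) \<and>
                 switched_solution n\<^sub>0 t (\<eta> i)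
                   (\<lambda>s. S\<^sub>0 *\<^sub>v \<eta> i s + (L\<^sub>0 * F\<^sub>0) *\<^sub>v \<eta>\<^sub>v i s) \<and>
                 (\<forall>s \<ge> 0.
                    u i s = K\<^sub>1 i *\<^sub>v \<xi> i s + K\<^sub>2 i *\<^sub>v \<zeta> i s + K\<^sub>3 i *\<^sub>v \<eta> i s \<and>
                    y i s = C i *\<^sub>v x i s + D i *\<^sub>v u i s \<and>
                    yhat i s = C i *\<^sub>v \<xi> i s + D i *\<^sub>v u i s \<and>
                    \<eta>\<^sub>v i s = vec n\<^sub>0 (\<lambda>k. \<Sum>j = 0..N. a (\<sigma> s) i j * (\<eta> i s $ k - \<eta> j s $ k)))) \<longrightarrow>
              (\<forall>i \<in> {1..N}. \<forall>k < l. ((\<lambda>s. (y i s - y\<^sub>0 s) $ k) \<longlongrightarrow> 0) at_top)))"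
proof (rule conjI)
  \<comment> \<open>A signal with values in \<open>{1..\<kappa>}\<close> requires at least one
    graph, so the minimum in \<open>lambda_bar\<close> is over a nonempty set.\<close>
  have \<kappa>: "\<kappa> \<ge> 1"
  proof -
    have "\<sigma> 0 \<in> {1..\<kappa>}" using switching by (simp add: switching_signal_def)
    then show ?thesis by simp
  qed
  have t0: "0 \<in> range t" using switching unfolding switching_signal_def by (metis rangeI)
  have fin: "finite (range t \<inter> {..b})" for b by (rule switching_instants_locally_finite[OF switching])
  obtain P where "P \<in> carrier_mat n\<^sub>0 n\<^sub>0" "sym_pos_def P"
    "sym_pos_def (- (P * S\<^sub>0 + transpose_mat S\<^sub>0 * P - 2 \<cdot>\<^sub>m (transpose_mat F\<^sub>0 * F\<^sub>0)))"
    by (rule detectable_observer_matrix[OF detectable_leader leader_dims]) blast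
  then have P: "observer_gain n\<^sub>0 S\<^sub>0 F\<^sub>0 (mu_star N \<kappa> a) P
      ((- mu_star N \<kappa> a) \<cdot>\<^sub>m (the (mat_inverse P) * transpose_mat F\<^sub>0))"
    by (simp add: observer_gain_def)
  have "\<exists>K\<^sub>1 K\<^sub>2 K\<^sub>3 L\<^sub>1 L\<^sub>2. follower_gains (n i) (m i) (q i) l (A i) (B i) (C i) (E i) (S i)
      (X\<^sub>1 i) (X\<^sub>2 i) (U\<^sub>1 i) (U\<^sub>2 i) K\<^sub>1 K\<^sub>2 K\<^sub>3 L\<^sub>1 L\<^sub>2" if i: "i \<in> {1..N}" for i
    by (rule follower_gains_exist) (use i follower_dims stabilizable detectable_followers in auto)
  then obtain K\<^sub>1 K\<^sub>2 K\<^sub>3 L\<^sub>1 L\<^sub>2 where "\<forall>i \<in> {1..N}. follower_gains (n i) (m i) (q i) l (A i) (B i) (C i) (E i) (S i)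
      (X\<^sub>1 i) (X\<^sub>2 i) (U\<^sub>1 i) (U\<^sub>2 i) (K\<^sub>1 i) (K\<^sub>2 i) (K\<^sub>3 i) (L\<^sub>1 i) (L\<^sub>2 i)"
    by metis
  with P show "\<exists>K\<^sub>1 K\<^sub>2 K\<^sub>3 L\<^sub>1 L\<^sub>2 P L\<^sub>0.
      (\<forall>i \<in> {1..N}. follower_gains (n i) (m i) (q i) l (A i) (B i) (C i) (E i) (S i)
        (X\<^sub>1 i) (X\<^sub>2 i) (U\<^sub>1 i) (U\<^sub>2 i) (K\<^sub>1 i) (K\<^sub>2 i) (K\<^sub>3 i) (L\<^sub>1 i) (L\<^sub>2 i)) \<and>
      observer_gain n\<^sub>0 S\<^sub>0 F\<^sub>0 (mu_star N \<kappa> a) P L\<^sub>0"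
    by blast
  show "(\<forall>K\<^sub>1 K\<^sub>2 K\<^sub>3 L\<^sub>1 L\<^sub>2 P L\<^sub>0.
           (\<forall>i \<in> {1..N}. follower_gains (n i) (m i) (q i) l (A i) (B i) (C i) (E i) (S i)
              (X\<^sub>1 i) (X\<^sub>2 i) (U\<^sub>1 i) (U\<^sub>2 i) (K\<^sub>1 i) (K\<^sub>2 i) (K\<^sub>3 i) (L\<^sub>1 i) (L\<^sub>2 i)) \<and>
           observer_gain n\<^sub>0 S\<^sub>0 F\<^sub>0 (mu_star N \<kappa> a) P L\<^sub>0 \<longrightarrow>
           (\<forall>(r :: real \<Rightarrow> real vec) (y\<^sub>0 :: real \<Rightarrow> real vec)
              (x :: nat \<Rightarrow> real \<Rightarrow> real vec) (d :: nat \<Rightarrow> real \<Rightarrow> real vec)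
              (\<xi> :: nat \<Rightarrow> real \<Rightarrow> real vec) (\<zeta> :: nat \<Rightarrow> real \<Rightarrow> real vec)
              (\<eta> :: nat \<Rightarrow> real \<Rightarrow> real vec) (\<eta>\<^sub>v :: nat \<Rightarrow> real \<Rightarrow> real vec)
              (u :: nat \<Rightarrow> real \<Rightarrow> real vec) (y :: nat \<Rightarrow> real \<Rightarrow> real vec)
              (yhat :: nat \<Rightarrow> real \<Rightarrow> real vec).
              switched_solution n\<^sub>0 t r (\<lambda>s. S\<^sub>0 *\<^sub>v r s) \<and>
              (\<forall>s \<ge> 0. y\<^sub>0 s = F\<^sub>0 *\<^sub>v r s) \<and>
              (\<forall>s \<ge> 0. \<eta> 0 s = r s) \<and>
              (\<forall>i \<in> {1..N}.
                 switched_solution (n i) t (x i)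
                   (\<lambda>s. A i *\<^sub>v x i s + B i *\<^sub>v u i s + E i *\<^sub>v d i s) \<and>
                 switched_solution (q i) t (d i) (\<lambda>s. S i *\<^sub>v d i s) \<and>
                 switched_solution (n i) t (\<xi> i)
                   (\<lambda>s. A i *\<^sub>v \<xi> i s + E i *\<^sub>v \<zeta> i s + B i *\<^sub>v u i s - L\<^sub>1 i *\<^sub>v (y i s - yhat i s)) \<and>
                 switched_solution (q i) t (\<zeta> i)
                   (\<lambda>s. S i *\<^sub>v \<zeta> i s - L\<^sub>2 i *\<^sub>v (y i s - yhat i s)) \<and>
                 switched_solution n\<^sub>0 t (\<eta> i)
                   (\<lambda>s. S\<^sub>0 *\<^sub>v \<eta> i s + (L\<^sub>0 * F\<^sub>0) *\<^sub>v \<eta>\<^sub>v i s) \<and>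
                 (\<forall>s \<ge> 0.
                    u i s = K\<^sub>1 i *\<^sub>v \<xi> i s + K\<^sub>2 i *\<^sub>v \<zeta> i s + K\<^sub>3 i *\<^sub>v \<eta> i s \<and>
                    y i s = C i *\<^sub>v x i s + D i *\<^sub>v u i s \<and>
                    yhat i s = C i *\<^sub>v \<xi> i s + D i *\<^sub>v u i s \<and>
                    \<eta>\<^sub>v i s = vec n\<^sub>0 (\<lambda>k. \<Sum>j = 0..N. a (\<sigma> s) i j * (\<eta> i s $ k - \<eta> j s $ k)))) \<longrightarrow>
              (\<forall>i \<in> {1..N}. \<forall>k < l. ((\<lambda>s. (y i s - y\<^sub>0 s) $ k) \<longlongrightarrow> 0) at_top)))"
  proof (intro allI impI, elim conjE, intro ballI allI impI)
    fix K\<^sub>1 K\<^sub>2 K\<^sub>3 L\<^sub>1 L\<^sub>2 P L\<^sub>0 r y\<^sub>0 x d \<xi> \<zeta> \<eta> \<eta>\<^sub>v u y yhat i k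
    assume gains: "\<forall>i \<in> {1..N}. follower_gains (n i) (m i) (q i) l (A i) (B i) (C i) (E i) (S i)
        (X\<^sub>1 i) (X\<^sub>2 i) (U\<^sub>1 i) (U\<^sub>2 i) (K\<^sub>1 i) (K\<^sub>2 i) (K\<^sub>3 i) (L\<^sub>1 i) (L\<^sub>2 i)"
      and obs: "observer_gain n\<^sub>0 S\<^sub>0 F\<^sub>0 (mu_star N \<kappa> a) P L\<^sub>0"
      and r: "switched_solution n\<^sub>0 t r (\<lambda>s. S\<^sub>0 *\<^sub>v r s)"
      and y0: "\<forall>s \<ge> 0. y\<^sub>0 s = F\<^sub>0 *\<^sub>v r s" and \<eta>0: "\<forall>s \<ge> 0. \<eta> 0 s = r s"
      and loop: "(\<forall>i \<in> {1..N}.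
                 switched_solution (n i) t (x i)
                   (\<lambda>s. A i *\<^sub>v x i s + B i *\<^sub>v u i s + E i *\<^sub>v d i s) \<and>
                 switched_solution (q i) t (d i) (\<lambda>s. S i *\<^sub>v d i s) \<and>
                 switched_solution (n i) t (\<xi> i)
                   (\<lambda>s. A i *\<^sub>v \<xi> i s + E i *\<^sub>v \<zeta> i s + B i *\<^sub>v u i s - L\<^sub>1 i *\<^sub>v (y i s - yhat i s)) \<and>
                 switched_solution (q i) t (\<zeta> i)
                   (\<lambda>s. S i *\<^sub>v \<zeta> i s - L\<^sub>2 i *\<^sub>v (y i s - yhat i s)) \<and>
                 switched_solution n\<^sub>0 t (\<eta> i)
                   (\<lambda>s. S\<^sub>0 *\<^sub>v \<eta> i s + (L\<^sub>0 * F\<^sub>0) *\<^sub>v \<eta>\<^sub>v i s) \<and>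
                 (\<forall>s \<ge> 0.
                    u i s = K\<^sub>1 i *\<^sub>v \<xi> i s + K\<^sub>2 i *\<^sub>v \<zeta> i s + K\<^sub>3 i *\<^sub>v \<eta> i s \<and>
                    y i s = C i *\<^sub>v x i s + D i *\<^sub>v u i s \<and>
                    yhat i s = C i *\<^sub>v \<xi> i s + D i *\<^sub>v u i s \<and>
                    \<eta>\<^sub>v i s = vec n\<^sub>0 (\<lambda>k. \<Sum>j = 0..N. a (\<sigma> s) i j * (\<eta> i s $ k - \<eta> j s $ k))))"
      and i: "i \<in> {1..N}" and k: "k < l"
    note rc = switched_solution_carrier[OF r]
    have \<eta>sol: "switched_solution n\<^sub>0 t (\<eta> j) (\<lambda>s. S\<^sub>0 *\<^sub>v \<eta> j s + (L\<^sub>0 * F\<^sub>0) *\<^sub>v \<eta>\<^sub>v j s)"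
      and \<eta>v: "s \<ge> 0 \<Longrightarrow> \<eta>\<^sub>v j s = diffusive_sum n\<^sub>0 N (a (\<sigma> s)) (\<lambda>j. \<eta> j s) j" if "j \<in> {1..N}" for j s
      using loop that by (auto simp: diffusive_sum_def)
    have \<eta>c: "\<eta> j s \<in> carrier_vec n\<^sub>0" if "j \<in> {0..N}" "s \<ge> 0" for j s
      using that rc[OF that(2)] \<eta>0 switched_solution_carrier[OF \<eta>sol that(2)] by (cases "j = 0") auto
    have "vanishing n\<^sub>0 (\<lambda>s. \<eta> i s - r s)"
    proof (rule coupled_observer_vanishing[where e = "\<lambda>j s. \<eta> j s - r s", OF obs leader_dims t0 fin _ _ _ i])
      fix s :: real and w :: "nat \<Rightarrow> real" assume "s \<ge> 0" "w 0 = 0"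
      then show "mu_star N \<kappa> a * graph_form N (a (\<sigma> s)) w \<ge> (\<Sum>i = 1..N. (w i)\<^sup>2)"
        using switching graphs connected by (intro mu_star_graph_form[OF N \<kappa>]) (auto simp: switching_signal_def)
    next
      fix s :: real assume "s \<ge> 0"
      then show "\<eta> 0 s - r s = 0\<^sub>v n\<^sub>0" using \<eta>0 rc by simp
    next
      fix j assume j: "j \<in> {1..N}"
      have S0r: "S\<^sub>0 *\<^sub>v r s \<in> carrier_vec n\<^sub>0" if "s \<ge> 0" for s using leader_dims(1) rc[OF that] by simp
      show "switched_solution n\<^sub>0 t (\<lambda>s. \<eta> j s - r s) (\<lambda>s. S\<^sub>0 *\<^sub>v (\<eta> j s - r s)
          + (L\<^sub>0 * F\<^sub>0) *\<^sub>v diffusive_sum n\<^sub>0 N (a (\<sigma> s)) (\<lambda>j. \<eta> j s - r s) j)"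
      proof (rule switched_solution_cong[OF switched_solution_minus[OF t0 \<eta>sol[OF j] r S0r]])
        fix s :: real assume s: "s \<ge> 0"
        have "dim_vec (r s) = n\<^sub>0" using rc[OF s] by simp
        \<comment> \<open>Subtracting the same \<open>r s\<close> at every node, the leader
          included, leaves all differences unchanged; the errors are therefore coupled exactly as
          the observers are.\<close>
        then have "diffusive_sum n\<^sub>0 N (a (\<sigma> s)) (\<lambda>j. \<eta> j s - r s) j = \<eta>\<^sub>v j s"
          unfolding \<eta>v[OF j s] by (auto simp: diffusive_sum_def)
        moreover have "S\<^sub>0 *\<^sub>v (\<eta> j s - r s) = S\<^sub>0 *\<^sub>v \<eta> j s - S\<^sub>0 *\<^sub>v r s"
          using j s by (intro mult_minus_distrib_mat_vec[OF leader_dims(1)] \<eta>c rc) auto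
        ultimately show "S\<^sub>0 *\<^sub>v \<eta> j s + (L\<^sub>0 * F\<^sub>0) *\<^sub>v \<eta>\<^sub>v j s - S\<^sub>0 *\<^sub>v r s = S\<^sub>0 *\<^sub>v (\<eta> j s - r s)
          + (L\<^sub>0 * F\<^sub>0) *\<^sub>v diffusive_sum n\<^sub>0 N (a (\<sigma> s)) (\<lambda>j. \<eta> j s - r s) j"
          using observer_gain_carrier[OF obs leader_dims(2)] leader_dims
          by (intro eq_vecI) (auto simp del: index_mult_mat_vec)
      qed
    qed
    then have "vanishing l (\<lambda>s. y i s - F\<^sub>0 *\<^sub>v r s)"
      using follower_dims regulator gains loop i \<eta>c
      by (intro follower_output_regulation[where x = "x i" and d = "d i" and \<xi> = "\<xi> i" and \<zeta> = "\<zeta> i"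
            and \<eta> = "\<eta> i" and u = "u i" and yhat = "yhat i" and n = "n i" and m = "m i" and q = "q i"
            and A = "A i" and B = "B i" and C = "C i" and D = "D i" and E = "E i" and S = "S i",
            OF _ _ _ _ _ _ leader_dims _ _ t0 fin r]) auto
    then have "((\<lambda>s. (y i s - F\<^sub>0 *\<^sub>v r s) $ k) \<longlongrightarrow> 0) at_top" using k by (simp add: vanishing_def)
    then show "((\<lambda>s. (y i s - y\<^sub>0 s) $ k) \<longlongrightarrow> 0) at_top"
      by (rule tendsto_cong_nonneg) (simp add: y0)
  qed
qed

end
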